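(* Let $k\ge 2$ be an integer, $p>2$, and $U\in L^p_{sym}([0,1]^2)$. Let $X=(X_1,\dots,X_k)$ be a uniform random vector in $[0,1]^k$. (1) For any $\phi>0$, the upper bound $$\|\mathcal{U}_X\|_\square-\|U\|_\square\le \left(30\|U\|_p+6\sqrt{2\phi p}\,(\|U\|_1+2\|U\|_p)\,\frac{\sqrt{\ln k}}{k^{\frac{p-3}{4p}-\phi}}\right)k^{-\frac14+\frac1{4p}}$$ holds with probability at least $1-4k^{-\phi p}$. (2) For any $\gamma\in(1/p,1/2)$, the lower bound $$\|\mathcal{U}_X\|_\square-\|U\|_\square\ge -\left(\|U\|_\square+6\sqrt{2(\gamma p-1)}\,(\|U\|_1+2\|U\|_p)\right)k^{-1/2+\gamma}\sqrt{\ln k}$$ holds with probability at least $1-4k^{1-\gamma p}$.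
   Context: $L^p_{sym}([0,1]^2)$ is the set of symmetric real-valued measurable functions ("kernels") $U:[0,1]^2\to\mathbb{R}$ ($U(x,y)=U(y,x)$) with $\|U\|_p=\left(\int_{[0,1]^2}|U|^p\right)^{1/p}<\infty$. Here $1\le p<\infty$. For $X=(X_1,\dots,X_k)$ with $X_1,\dots,X_k$ i.i.d. uniform on $[0,1]$, the sample $\mathcal{U}_X$ is the step function on $[0,1]^2$ with uniform steps of length $1/k$ in each variable, taking on $[(i-1)/k,i/k]\times[(j-1)/k,j/k]$ the value $U(X_i,X_j)$ if $i\ne j$ and $0$ if $i=j$. The cut norm of $W\in L^1([0,1]^2)$ is $\|W\|_\square=\sup_{S,T\subseteq[0,1]}\left|\int_{S\times T}W(x,y)\,dx\,dy\right|$, the supremum being over measurable sets. *)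

theory Defs
  imports "HOL-Probability.Probability"
begin

abbreviation unit_square :: "(real \<times> real) set" where
  "unit_square \<equiv> {0..1} \<times> {0..1}"

definition Lp_norm :: "real \<Rightarrow> (real \<times> real \<Rightarrow> real) \<Rightarrow> real" where
  "Lp_norm p U = (LINT z|lebesgue_on unit_square. \<bar>U z\<bar> powr p) powr (1 / p)"

(* Kernels are Lebesgue measurable functions, not classes modulo null sets;
   values outside the unit square are irrelevant. *)
definition Lp_sym :: "real \<Rightarrow> (real \<times> real \<Rightarrow> real) set" where
  "Lp_sym p = {U. U \<in> borel_measurable (lebesgue_on unit_square) \<and>
     (\<forall>x\<in>{0..1}. \<forall>y\<in>{0..1}. U (x, y) = U (y, x)) \<and>
     integrable (lebesgue_on unit_square) (\<lambda>z. \<bar>U z\<bar> powr p)}"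

(* The members of sets (lebesgue_on {0..1}) are the Lebesgue measurable subsets of [0,1].
   For integrable W the supremum is over a bounded nonempty set of reals. *)
definition cut_norm :: "(real \<times> real \<Rightarrow> real) \<Rightarrow> real" where
  "cut_norm W = (SUP (S, T) \<in> sets (lebesgue_on {0..1}) \<times> sets (lebesgue_on {0..1}).
     \<bar>LINT z:S \<times> T|lebesgue. W z\<bar>)"

(* Half-open steps, so that adjacent steps do not overlap; this affects the step function
   below only on a null set. *)
definition step_interval :: "nat \<Rightarrow> nat \<Rightarrow> real set" where
  "step_interval k i = {(real i - 1) / real k ..< real i / real k}"

definition sample :: "nat \<Rightarrow> (real \<times> real \<Rightarrow> real) \<Rightarrow> (nat \<Rightarrow> real) \<Rightarrow> real \<times> real \<Rightarrow> real" where
  "sample k U x z = (\<Sum>i\<in>{1..k}. \<Sum>j\<in>{1..k}.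
     (if i = j then 0 else U (x i, x j)) * indicator (step_interval k i \<times> step_interval k j) z)"

end

theory Submission
  imports Defs
begin

text \<open>
  Up to the factor \<open>k\<^sup>2\<close>, the cut norm of the sample is the largest absolute rectangle sum of the random
  matrix with entries \<open>U (X\<^sub>i, X\<^sub>j)\<close>.

  \<^emph>\<open>Mean.\<close> Averaging over all bipartitions of the index set bounds a rectangle sum by four times the mean
  of rectangle sums whose rows and columns use disjoint sets of sample points. The best set of rows for
  given columns replaces the row sums by their positive parts, and the class of all column sets becomes
  a class of functions of the row points. Symmetrization and the contraction principle for the positive
  part remove the randomness of the row points, and the same argument with the roles exchanged removes
  that of the column points. Both steps cost only \<open>O(k powr (3/2))\<close> times the \<open>L\<^sup>2\<close> norm, which is smaller
  than the theorem requires. In the second step the supremum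
  runs over all measurable sets; an \<open>L\<^sup>1\<close> approximation of the kernel makes this class finite.

  \<^emph>\<open>Concentration.\<close> The differences of the largest rectangle sum are not bounded, since the row sums of the
  matrix are only controlled in \<open>L\<^sup>p\<close>. Deleting a set \<open>D\<close> of indices at the price \<open>c * card D\<close> and minimizing over
  \<open>D\<close> gives a function whose differences are at most \<open>c\<close> everywhere, which never exceeds the original one,
  and which agrees with it when all row sums are at most \<open>c\<close>. McDiarmid's inequality applies to this
  function, and the probability of a large row sum is estimated by the \<open>p\<close>-th moment.
\<close>

section \<open>Concentration for functions of independent variables\<close>

text \<open>There are exponentially many rectangles and the entries have only p moments, so
  rectangles are never estimated one by one; symmetrization has a cost that does not depend on the
  number of sets. The factor 4 of the bipartitions does not harm the main term, because a
  bipartition retains on average a quarter of the off-diagonal pairs: the cut norm keeps the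
  constant 1, which a comparison of the two cut norms requires. The price per deleted index is
  \<open>2 * k * \<tau> * N\<close> with \<open>N\<close> the p-norm, so a row sum exceeds it with
  probability at most \<open>\<tau> powr - p\<close>. A large \<open>\<tau>\<close> makes this event
  rare and McDiarmid's bound weak; \<open>k powr (1 / p + \<phi>)\<close> and
  \<open>k powr \<gamma>\<close> are the compromises behind the two parts. The lower bound has no
  exceptional event for the row sums: large rows only lower the mean of the regularized function.
  Kernels are Lebesgue measurable while the product measures are Borel, so the kernel is exchanged
  for a Borel version; this is harmless since the sample has a zero diagonal and two distinct sample
  points have an absolutely continuous joint law.\<close>

abbreviation iid :: "'a measure \<Rightarrow> 'i set \<Rightarrow> ('i \<Rightarrow> 'a) measure" where
  "iid M I \<equiv> Pi\<^sub>M I (\<lambda>_. M)"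

context prob_space
begin

lemma prob_space_iid: "prob_space (iid M I)"
  by (intro prob_space_PiM prob_space_axioms)

lemma integrable_bounded:
  fixes f :: "'a \<Rightarrow> real"
  assumes "f \<in> borel_measurable M" "\<And>x. x \<in> space M \<Longrightarrow> \<bar>f x\<bar> \<le> K"
  shows "integrable M f"
  using assms by (intro integrable_const_bound[where B = K]) auto

text \<open>An oscillation of at most \<open>c\<close> puts \<open>h\<close> into an interval of
  length \<open>c\<close> that starts at its infimum, and Hoeffding's lemma is applied there with
  parameter 1. Stating the hypothesis through differences matches the bounded-difference condition
  of McDiarmid's inequality.\<close>

lemma Hoeffding_mgf:
  fixes h :: "'a \<Rightarrow> real"
  assumes [measurable]: "h \<in> borel_measurable M"
    and c: "\<And>x y. x \<in> space M \<Longrightarrow> y \<in> space M \<Longrightarrow> \<bar>h x - h y\<bar> \<le> c"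
  shows "(\<integral>x. exp (h x) \<partial>M) \<le> exp ((\<integral>x. h x \<partial>M) + c\<^sup>2 / 8)"
proof -
  obtain x0 where x0: "x0 \<in> space M"
    using not_empty by blast
  define a where "a = (INF x\<in>space M. h x)"
  have bdd: "bdd_below (h ` space M)"
    using c[OF x0] by (intro bdd_belowI2[where m = "h x0 - c"]) (smt (verit))
  have ha: "a \<le> h x" if "x \<in> space M" for x
    unfolding a_def using bdd that by (rule cINF_lower)
  have hb: "h x \<le> a + c" if x: "x \<in> space M" for x
  proof -
    have "h x - c \<le> a"
      unfolding a_def using x0 c[OF x] by (intro cINF_greatest) (auto, smt (verit))
    then show ?thesis by simp
  qed
  interpret h: interval_bounded_random_variable M h a "a + c"
    by unfold_locales (use ha hb in auto)
  have int: "integrable M h" by (rule h.integrable)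
  have inte: "integrable M (\<lambda>x. exp (h x - expectation h))"
    using hb by (intro integrable_bounded[where K = "exp (a + c - expectation h)"]) auto
  have "ennreal (\<integral>x. exp (h x - expectation h) \<partial>M) = (\<integral>\<^sup>+x. exp (h x - expectation h) \<partial>M)"
    by (rule nn_integral_eq_integral[symmetric]) (use inte in auto)
  also have "\<dots> \<le> ennreal (exp (c\<^sup>2 / 8))"
    using h.Hoeffdings_lemma_nn_integral[of 1] by simp
  finally have "(\<integral>x. exp (h x - expectation h) \<partial>M) \<le> exp (c\<^sup>2 / 8)"
    by simp
  moreover have "(\<integral>x. exp (h x - expectation h) \<partial>M) = (\<integral>x. exp (h x) \<partial>M) / exp (expectation h)"
    by (simp add: exp_diff)
  ultimately have "(\<integral>x. exp (h x) \<partial>M) \<le> exp (expectation h) * exp (c\<^sup>2 / 8)"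
    by (simp add: field_simps)
  then show ?thesis
    by (metis exp_add)
qed

lemma fun_upd_space_iid:
  "x \<in> space (iid M I) \<Longrightarrow> y \<in> space M \<Longrightarrow> x(i := y) \<in> space (iid M (insert i I))"
  by (auto simp: space_PiM PiE_def extensional_def)

text \<open>Both orders of integration are used: the new coordinate innermost in order to average it
  out, outermost in order to freeze it. The bound \<open>K\<close> provides integrability for
  Fubini's theorem.\<close>

lemma iid_integral_insert:
  fixes f :: "('i \<Rightarrow> 'a) \<Rightarrow> real"
  assumes I: "finite I" "i \<notin> I" and [measurable]: "f \<in> borel_measurable (iid M (insert i I))"
    and bdd: "\<And>x. x \<in> space (iid M (insert i I)) \<Longrightarrow> \<bar>f x\<bar> \<le> K"
  shows "(\<integral>x. f x \<partial>iid M (insert i I)) = (\<integral>x. (\<integral>y. f (x(i := y)) \<partial>M) \<partial>iid M I)"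
    and "(\<integral>x. f x \<partial>iid M (insert i I)) = (\<integral>y. (\<integral>x. f (x(i := y)) \<partial>iid M I) \<partial>M)"
proof -
  interpret product_sigma_finite "\<lambda>_::'i. M" by unfold_locales
  interpret P: prob_space "iid M I" by (rule prob_space_iid)
  interpret Q: prob_space "iid M (insert i I)" by (rule prob_space_iid)
  interpret PM: pair_prob_space "iid M I" M ..
  show 1: "(\<integral>x. f x \<partial>iid M (insert i I)) = (\<integral>x. (\<integral>y. f (x(i := y)) \<partial>M) \<partial>iid M I)"
    using I bdd by (intro product_integral_insert Q.integrable_bounded[where K = K]) auto
  have "integrable (iid M I \<Otimes>\<^sub>M M) (\<lambda>(x, y). f (x(i := y)))"
    by (intro PM.integrable_bounded[where K = K])
       (auto intro!: bdd fun_upd_space_iid simp: space_pair_measure)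
  then have "(\<integral>x. (\<integral>y. f (x(i := y)) \<partial>M) \<partial>iid M I) = (\<integral>y. (\<integral>x. f (x(i := y)) \<partial>iid M I) \<partial>M)"
    by (rule PM.Fubini_integral[symmetric])
  with 1 show "(\<integral>x. f x \<partial>iid M (insert i I)) = (\<integral>y. (\<integral>x. f (x(i := y)) \<partial>iid M I) \<partial>M)"
    by simp
qed

text \<open>Induction on the coordinates takes the place of a martingale: averaging \<open>g\<close>
  over one coordinate leaves a function of the others with the same difference bound
  \<open>c\<close>, and by Hoeffding's lemma the averaging costs a factor
  \<open>exp (c\<^sup>2 / 8)\<close>.\<close>

lemma McDiarmid_mgf:
  fixes g :: "('i \<Rightarrow> 'a) \<Rightarrow> real" and c :: real
  assumes "finite I" "g \<in> borel_measurable (iid M I)"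
    and "\<And>x. x \<in> space (iid M I) \<Longrightarrow> \<bar>g x\<bar> \<le> K"
    and "\<And>x i y. x \<in> space (iid M I) \<Longrightarrow> i \<in> I \<Longrightarrow> y \<in> space M \<Longrightarrow> \<bar>g (x(i := y)) - g x\<bar> \<le> c"
  shows "(\<integral>x. exp (g x) \<partial>iid M I) \<le> exp ((\<integral>x. g x \<partial>iid M I) + card I * c\<^sup>2 / 8)"
  using assms
proof (induction I arbitrary: g rule: finite_induct)
  case empty
  show ?case by (simp add: PiM_empty lebesgue_integral_count_space_finite)
next
  case (insert i I)
  note [measurable] = insert.prems(1)
  interpret P: prob_space "iid M I" by (rule prob_space_iid)
  interpret Q: prob_space "iid M (insert i I)" by (rule prob_space_iid)
  define h where "h x = (\<integral>y. g (x(i := y)) \<partial>M)" for x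
  have h_meas [measurable]: "h \<in> borel_measurable (iid M I)"
    unfolding h_def by measurable
  have upd: "fun_upd x i y \<in> space (iid M (insert i I))"
    if "x \<in> space (iid M I)" "y \<in> space M" for x y
    using that by (rule fun_upd_space_iid)
  have gi_int: "integrable M (\<lambda>y. g (x(i := y)))" if x: "x \<in> space (iid M I)" for x
    using insert.hyps x insert.prems(2) upd[OF x] by (intro integrable_bounded[where K = K]) auto
  have step: "(\<integral>y. exp (g (x(i := y))) \<partial>M) \<le> exp (c\<^sup>2 / 8) * exp (h x)" if x: "x \<in> space (iid M I)" for x
  proof -
    have "\<bar>g (x(i := y)) - g (x(i := y'))\<bar> \<le> c" if "y \<in> space M" "y' \<in> space M" for y y'
      using insert.prems(3)[OF upd[OF x that(2)] insertI1 that(1)] by (simp only: fun_upd_upd)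
    with Hoeffding_mgf[of "\<lambda>y. g (x(i := y))" c] insert.hyps x show ?thesis
      by (simp add: h_def exp_add mult_ac)
  qed
  have h_bdd: "\<bar>h x\<bar> \<le> K" if x: "x \<in> space (iid M I)" for x
  proof -
    have "\<bar>h x\<bar> \<le> (\<integral>y. \<bar>g (x(i := y))\<bar> \<partial>M)"
      unfolding h_def by (rule integral_abs_bound)
    also have "\<dots> \<le> (\<integral>y. K \<partial>M)"
      by (intro integral_mono integrable_abs gi_int x integrable_const insert.prems(2) upd)
    finally show ?thesis by (simp add: prob_space)
  qed
  have IH: "(\<integral>x. exp (h x) \<partial>iid M I) \<le> exp ((\<integral>x. h x \<partial>iid M I) + card I * c\<^sup>2 / 8)"
  proof (rule insert.IH[OF h_meas h_bdd])
    fix x j z assume x: "x \<in> space (iid M I)" and j: "j \<in> I" and z: "z \<in> space M"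
    have x': "x(j := z) \<in> space (iid M I)"
      using fun_upd_space_iid[OF x z, of j] j by (simp add: insert_absorb)
    have "\<bar>h (x(j := z)) - h x\<bar> = \<bar>\<integral>y. g (x(j := z, i := y)) - g (x(i := y)) \<partial>M\<bar>"
      using gi_int[OF x] gi_int[OF x'] by (simp add: h_def)
    also have "\<dots> \<le> (\<integral>y. \<bar>g (x(j := z, i := y)) - g (x(i := y))\<bar> \<partial>M)"
      by (rule integral_abs_bound)
    also have "\<dots> \<le> (\<integral>y. c \<partial>M)"
    proof (intro integral_mono integrable_abs Bochner_Integration.integrable_diff gi_int x x' integrable_const)
      fix y assume y: "y \<in> space M"
      have "x(j := z, i := y) = (x(i := y))(j := z)"
        using j insert.hyps by (auto simp: fun_eq_iff)
      then show "\<bar>g (x(j := z, i := y)) - g (x(i := y))\<bar> \<le> c"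
        using insert.prems(3)[OF upd[OF x y], of j z] j z by (simp only: insertI2)
    qed
    finally show "\<bar>h (x(j := z)) - h x\<bar> \<le> c" by (simp add: prob_space)
  qed
  have e_bdd: "\<bar>exp (g x)\<bar> \<le> exp K" if "x \<in> space (iid M (insert i I))" for x
    using insert.prems(2)[OF that] by simp
  have "(\<integral>x. exp (g x) \<partial>iid M (insert i I)) = (\<integral>x. (\<integral>y. exp (g (x(i := y))) \<partial>M) \<partial>iid M I)"
    by (intro iid_integral_insert(1)[where K = "exp K"] insert.hyps e_bdd) auto
  also have "\<dots> \<le> (\<integral>x. exp (c\<^sup>2 / 8) * exp (h x) \<partial>iid M I)"
  proof (intro integral_mono step)
    have eb: "exp (h x) \<le> exp K" if "x \<in> space (iid M I)" for x
      using h_bdd[OF that] by simp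
    show int: "integrable (iid M I) (\<lambda>x. exp (c\<^sup>2 / 8) * exp (h x))"
      using eb by (intro P.integrable_bounded[where K = "exp (c\<^sup>2 / 8) * exp K"]) auto
    show "integrable (iid M I) (\<lambda>x. \<integral>y. exp (g (x(i := y))) \<partial>M)"
      by (rule Bochner_Integration.integrable_bound[OF int]) (use step in \<open>auto intro!: AE_I2 simp: abs_of_nonneg\<close>)
  qed
  also have "\<dots> = exp (c\<^sup>2 / 8) * (\<integral>x. exp (h x) \<partial>iid M I)" by simp
  also have "\<dots> \<le> exp (c\<^sup>2 / 8) * exp ((\<integral>x. h x \<partial>iid M I) + card I * c\<^sup>2 / 8)"
    using IH by simp
  also have "(\<integral>x. h x \<partial>iid M I) = (\<integral>x. g x \<partial>iid M (insert i I))"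
    unfolding h_def by (intro iid_integral_insert(1)[where K = K, symmetric] insert.hyps insert.prems(2)) auto
  also have "exp (c\<^sup>2 / 8) * exp ((\<integral>x. g x \<partial>iid M (insert i I)) + card I * c\<^sup>2 / 8)
      = exp ((\<integral>x. g x \<partial>iid M (insert i I)) + card (insert i I) * c\<^sup>2 / 8)"
    using insert.hyps by (simp add: exp_add[symmetric] field_simps)
  finally show ?case .
qed

lemma McDiarmid_tail:
  fixes g :: "('i \<Rightarrow> 'a) \<Rightarrow> real" and c :: real
  assumes I: "finite I" "I \<noteq> {}" and [measurable]: "g \<in> borel_measurable (iid M I)"
    and K: "\<And>x. x \<in> space (iid M I) \<Longrightarrow> \<bar>g x\<bar> \<le> K"
    and diff: "\<And>x i y. x \<in> space (iid M I) \<Longrightarrow> i \<in> I \<Longrightarrow> y \<in> space M \<Longrightarrow> \<bar>g (x(i := y)) - g x\<bar> \<le> c"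
    and c: "c > 0" and t: "t > 0"
  shows "measure (iid M I) {x \<in> space (iid M I). g x \<ge> (\<integral>x. g x \<partial>iid M I) + t}
     \<le> exp (- 2 * t\<^sup>2 / (card I * c\<^sup>2))"
proof -
  let ?P = "iid M I"
  interpret P: prob_space ?P by (rule prob_space_iid)
  define n where "n = real (card I)"
  have n: "n > 0" using I by (simp add: n_def card_gt_0_iff)
  \<comment> \<open>The minimizer of the exponent
    \<open>n * (s * c)\<^sup>2 / 8 - s * t\<close>.\<close>
  define s where "s = 4 * t / (n * c\<^sup>2)"
  define m where "m = (\<integral>x. g x \<partial>?P)"
  have s: "s > 0" using t n c by (simp add: s_def)
  have sK: "\<bar>s * g x\<bar> \<le> s * K" if "x \<in> space ?P" for x
    using s K[OF that] by (simp add: abs_mult)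
  have int: "integrable ?P (\<lambda>x. exp (s * g x))"
    by (rule P.integrable_bounded[where K = "exp (s * K)"]) (use sK abs_le_D1 in auto)
  have "measure ?P {x \<in> space ?P. g x \<ge> m + t} = measure ?P {x \<in> space ?P. exp (s * g x) \<ge> exp (s * (m + t))}"
    using s by simp
  also have "\<dots> \<le> (\<integral>x. exp (s * g x) \<partial>?P) / exp (s * (m + t))"
    by (intro integral_Markov_inequality_measure[where A = "space ?P", OF int]) auto
  also have "\<dots> \<le> exp ((\<integral>x. s * g x \<partial>?P) + card I * (s * c)\<^sup>2 / 8) / exp (s * (m + t))"
    by (intro divide_right_mono McDiarmid_mgf[where K = "s * K"] I sK)
       (use s diff in \<open>auto simp: abs_mult simp flip: right_diff_distrib\<close>)
  also have "\<dots> = exp (n * (s * c)\<^sup>2 / 8 - s * t)"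
    by (simp add: m_def n_def exp_diff[symmetric] algebra_simps)
  also have "n * (s * c)\<^sup>2 / 8 - s * t = - 2 * t\<^sup>2 / (n * c\<^sup>2)"
    using n c by (simp add: s_def field_simps power2_eq_square)
  finally show ?thesis by (simp add: m_def n_def)
qed

end

section \<open>Symmetrization and contraction\<close>

lemma Max_image_bounded:
  fixes f :: "'t \<Rightarrow> real"
  assumes T: "finite T" "T \<noteq> {}"
  shows "\<bar>MAX t\<in>T. f t\<bar> \<le> (\<Sum>t\<in>T. \<bar>f t\<bar>)"
proof -
  have "(MAX t\<in>T. f t) \<in> f ` T" using T by (intro Max_in) auto
  then obtain t where "t \<in> T" "(MAX t\<in>T. f t) = f t" by auto
  then show ?thesis using T by (auto intro: member_le_sum)
qed

section \<open>Exchanging one centred coordinate for a signed one\<close>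

context prob_space
begin

text \<open>Symmetrization and contraction are done at once for a single coordinate: its centred
  value under \<open>\<phi>\<close> is replaced by \<open>2 * h\<close> with a random sign, the
  right-hand side being the mean over the two signs. The function \<open>g\<close> stands for
  everything contributed by the other coordinates.\<close>

lemma symmetrization_step:
  fixes g :: "'t \<Rightarrow> real" and h :: "'t \<Rightarrow> 'a \<Rightarrow> real" and \<phi> :: "real \<Rightarrow> real"
  assumes T: "finite T" "T \<noteq> {}"
    and [measurable]: "\<And>t. h t \<in> borel_measurable M" "\<phi> \<in> borel_measurable borel"
    and h: "\<And>t x. t \<in> T \<Longrightarrow> x \<in> space M \<Longrightarrow> \<bar>h t x\<bar> \<le> K"
    and \<phi>: "\<And>x y. \<bar>\<phi> x - \<phi> y\<bar> \<le> \<bar>x - y\<bar>"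
  shows "(\<integral>x. (MAX t\<in>T. g t + (\<phi> (h t x) - (\<integral>y. \<phi> (h t y) \<partial>M))) \<partial>M)
     \<le> (\<integral>x. ((MAX t\<in>T. g t + 2 * h t x) + (MAX t\<in>T. g t - 2 * h t x)) / 2 \<partial>M)"
proof -
  interpret MM: pair_prob_space M M ..
  have \<phi>K: "\<bar>\<phi> (h t x)\<bar> \<le> \<bar>\<phi> 0\<bar> + K" if "t \<in> T" "x \<in> space M" for t x
    using \<phi>[of "h t x" 0] h[OF that] by linarith
  have int\<phi>: "integrable M (\<lambda>x. \<phi> (h t x))" if "t \<in> T" for t
    using \<phi>K[OF that] by (intro integrable_bounded) auto
  define m where "m t = (\<integral>y. \<phi> (h t y) \<partial>M)" for t
  define E where "E x y = (MAX t\<in>T. g t + (\<phi> (h t x) - \<phi> (h t y)))" for x y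
  define S where "S x = ((MAX t\<in>T. g t + 2 * h t x) + (MAX t\<in>T. g t - 2 * h t x)) / 2" for x
  have [measurable]: "case_prod E \<in> borel_measurable (M \<Otimes>\<^sub>M M)"
    unfolding E_def using T by measurable
  have [measurable]: "S \<in> borel_measurable M"
    unfolding S_def using T by measurable
  define B where "B = (\<Sum>t\<in>T. \<bar>g t\<bar> + 2 * (\<bar>\<phi> 0\<bar> + K))"
  have E_bdd: "\<bar>E x y\<bar> \<le> B" if "x \<in> space M" "y \<in> space M" for x y
    unfolding E_def B_def
    by (rule order.trans[OF Max_image_bounded[OF T]], rule sum_mono) (use \<phi>K that in \<open>smt (verit)\<close>)
  have E_int: "integrable (M \<Otimes>\<^sub>M M) (case_prod E)"
    using E_bdd by (intro MM.integrable_bounded[where K = B]) (auto simp: space_pair_measure)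
  have E_int': "integrable (M \<Otimes>\<^sub>M M) (\<lambda>(x, y). E y x)"
    using E_bdd by (intro MM.integrable_bounded[where K = B]) (auto simp: space_pair_measure)
  have E_int2: "integrable M (E x)" if "x \<in> space M" for x
    using E_bdd[OF that] that by (intro integrable_bounded[where K = B]) auto
  define B' where "B' = (\<Sum>t\<in>T. \<bar>g t\<bar> + 2 * K)"
  have S_bdd: "\<bar>S x\<bar> \<le> B'" if x: "x \<in> space M" for x
  proof -
    have "\<bar>MAX t\<in>T. g t + 2 * h t x\<bar> \<le> B'" "\<bar>MAX t\<in>T. g t - 2 * h t x\<bar> \<le> B'"
      unfolding B'_def by (rule order.trans[OF Max_image_bounded[OF T]], rule sum_mono, use h x in \<open>smt (verit)\<close>)+
    moreover have "\<bar>(a + b) / 2\<bar> \<le> B'" if "\<bar>a\<bar> \<le> B'" "\<bar>b\<bar> \<le> B'" for a b :: real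
      using that by (simp add: abs_le_iff)
    ultimately show "\<bar>S x\<bar> \<le> B'" unfolding S_def by blast
  qed
  then have S_int: "integrable M S"
    by (rule integrable_bounded[rotated]) simp_all
  have Max_int: "integrable M (\<lambda>x. MAX t\<in>T. g t + (\<phi> (h t x) - m t))"
  proof (rule integrable_bounded)
    fix x assume x: "x \<in> space M"
    show "\<bar>MAX t\<in>T. g t + (\<phi> (h t x) - m t)\<bar> \<le> (\<Sum>t\<in>T. \<bar>g t\<bar> + (\<bar>\<phi> 0\<bar> + K) + \<bar>m t\<bar>)"
      by (rule order.trans[OF Max_image_bounded[OF T]], rule sum_mono) (use \<phi>K x in \<open>smt (verit)\<close>)
  qed (use T in measurable)
  \<comment> \<open>Jensen's inequality: the mean of \<open>\<phi> (h t y)\<close> is taken over an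
    independent copy \<open>y\<close> and pulled out of the maximum.\<close>
  have "(\<integral>x. (MAX t\<in>T. g t + (\<phi> (h t x) - m t)) \<partial>M) \<le> (\<integral>x. (\<integral>y. E x y \<partial>M) \<partial>M)"
  proof (rule integral_mono[OF Max_int])
    show "integrable M (\<lambda>x. \<integral>y. E x y \<partial>M)"
      using MM.integrable_fst'[OF E_int] by simp
    fix x assume x: "x \<in> space M"
    show "(MAX t\<in>T. g t + (\<phi> (h t x) - m t)) \<le> (\<integral>y. E x y \<partial>M)"
    proof (subst Max_le_iff)
      show "\<forall>a\<in>(\<lambda>t. g t + (\<phi> (h t x) - m t)) ` T. a \<le> (\<integral>y. E x y \<partial>M)"
      proof safe
        fix t assume t: "t \<in> T"
        have "g t + (\<phi> (h t x) - m t) = (\<integral>y. g t + (\<phi> (h t x) - \<phi> (h t y)) \<partial>M)"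
          using int\<phi>[OF t] by (simp add: m_def prob_space)
        also have "\<dots> \<le> (\<integral>y. E x y \<partial>M)"
        proof (rule integral_mono)
          show "g t + (\<phi> (h t x) - \<phi> (h t y)) \<le> E x y" for y
            unfolding E_def using T t by (intro Max_ge) auto
        qed (use int\<phi>[OF t] E_int2[OF x] in simp_all)
        finally show "g t + (\<phi> (h t x) - m t) \<le> (\<integral>y. E x y \<partial>M)" .
      qed
    qed (use T in auto)
  qed
  \<comment> \<open>Renaming \<open>x\<close> and \<open>y\<close> symmetrizes the integrand, so
    that the two maximizers can be compared at the same points.\<close>
  also have "(\<integral>x. (\<integral>y. E x y \<partial>M) \<partial>M) = ((\<integral>x. (\<integral>y. E x y \<partial>M) \<partial>M) + (\<integral>x. (\<integral>y. E y x \<partial>M) \<partial>M)) / 2"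
    using MM.Fubini_integral[OF E_int] by simp
  also have "\<dots> = (\<integral>x. (\<integral>y. (E x y + E y x) / 2 \<partial>M) \<partial>M)"
    using MM.integral_fst'[OF E_int] MM.integral_fst'[OF E_int']
      MM.integral_fst'[of "\<lambda>(x, y). (E x y + E y x) / 2"] E_int E_int'
    by (simp add: split_beta')
  also have "\<dots> \<le> (\<integral>x. (\<integral>y. (S x + S y) / 2 \<partial>M) \<partial>M)"
  proof -
    \<comment> \<open>The two maxima in \<open>S\<close> carry opposite signs; using the pair of
      indices in both orders produces the absolute value.\<close>
    have dev: "g t + g t' + 2 * \<bar>h t x - h t' x\<bar> \<le> 2 * S x" if t: "t \<in> T" "t' \<in> T" for t t' x
    proof -
      have "g u + 2 * h u x + (g v - 2 * h v x) \<le> 2 * S x" if "u \<in> T" "v \<in> T" for u v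
      proof -
        have "g u + 2 * h u x \<le> (MAX t\<in>T. g t + 2 * h t x)" "g v - 2 * h v x \<le> (MAX t\<in>T. g t - 2 * h t x)"
          using that T by (auto intro!: Max_ge)
        then show ?thesis unfolding S_def by simp
      qed
      from this[OF t] this[OF t(2,1)] show ?thesis by (auto simp: abs_if field_simps)
    qed
    \<comment> \<open>With maximizers \<open>t\<close> and \<open>u\<close>, the terms are regrouped
      by point instead of by index: \<open>\<phi> (h t x) - \<phi> (h u x)\<close> and
      \<open>\<phi> (h u y) - \<phi> (h t y)\<close>, each bounded by the Lipschitz condition. Each
      point pays for one half of \<open>g t + g u\<close>, which is why \<open>h\<close> is doubled
      in \<open>S\<close>.\<close>
    have le: "E x y + E y x \<le> S x + S y" for x y
    proof -
      have att: "\<exists>t\<in>T. (MAX t\<in>T. f t) = f t" for f :: "'t \<Rightarrow> real"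
      proof -
        have "(MAX t\<in>T. f t) \<in> f ` T" using T by (intro Max_in) auto
        then show ?thesis by auto
      qed
      obtain t where t: "t \<in> T" "E x y = g t + (\<phi> (h t x) - \<phi> (h t y))"
        using att[of "\<lambda>t. g t + (\<phi> (h t x) - \<phi> (h t y))"] by (auto simp: E_def)
      obtain u where u: "u \<in> T" "E y x = g u + (\<phi> (h u y) - \<phi> (h u x))"
        using att[of "\<lambda>t. g t + (\<phi> (h t y) - \<phi> (h t x))"] by (auto simp: E_def)
      show ?thesis
        using dev[OF t(1) u(1), of x] dev[OF t(1) u(1), of y] t(2) u(2)
          \<phi>[of "h t x" "h u x"] \<phi>[of "h t y" "h u y"] by (auto simp: abs_le_iff)
    qed
    have i1: "integrable (M \<Otimes>\<^sub>M M) (\<lambda>(x, y). (E x y + E y x) / 2)"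
      using E_int E_int' by (simp add: split_beta')
    have i2: "integrable (M \<Otimes>\<^sub>M M) (\<lambda>(x, y). (S x + S y) / 2)"
    proof (rule MM.integrable_bounded)
      show "\<bar>case z of (x, y) \<Rightarrow> (S x + S y) / 2\<bar> \<le> B'" if "z \<in> space (M \<Otimes>\<^sub>M M)" for z
        using S_bdd[of "fst z"] S_bdd[of "snd z"] that
        by (auto simp: space_pair_measure abs_le_iff split_beta')
    qed measurable
    have "(\<integral>z. (\<lambda>(x, y). (E x y + E y x) / 2) z \<partial>(M \<Otimes>\<^sub>M M)) \<le> (\<integral>z. (\<lambda>(x, y). (S x + S y) / 2) z \<partial>(M \<Otimes>\<^sub>M M))"
      by (intro integral_mono i1 i2) (use le in \<open>auto intro!: divide_right_mono simp del: divide_le_cancel\<close>)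
    then show ?thesis
      using MM.integral_fst'[OF i1] MM.integral_fst'[OF i2] by simp
  qed
  also have "\<dots> = (\<integral>x. S x \<partial>M)"
    using S_int by (simp add: prob_space add_divide_distrib)
  finally show ?thesis by (simp add: S_def m_def)
qed

end

section \<open>Random signs and second moments of signed sums\<close>

abbreviation coin :: "bool measure" where
  "coin \<equiv> measure_pmf (bernoulli_pmf (1 / 2))"

abbreviation signed_measure :: "'a measure \<Rightarrow> ('a \<times> bool) measure" where
  "signed_measure M \<equiv> M \<Otimes>\<^sub>M coin"

text \<open>Independent random signs are attached to the sample points, so that sums with Rademacher signs
  are again sums over an i.i.d. sample, from \<open>M \<Otimes>\<^sub>M coin\<close>.\<close>

definition signed :: "('a \<Rightarrow> real) \<Rightarrow> 'a \<times> bool \<Rightarrow> real" where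
  "signed h z = (if snd z then h (fst z) else - h (fst z))"

lemma measurable_signed [measurable (raw)]:
  assumes [measurable]: "f \<in> N \<rightarrow>\<^sub>M signed_measure M" "h \<in> borel_measurable M"
  shows "(\<lambda>x. signed h (f x)) \<in> borel_measurable N"
proof -
  have [measurable]: "Measurable.pred (signed_measure M) snd"
    using measurable_snd[of M coin] by simp
  have "(\<lambda>z. signed h z) \<in> borel_measurable (signed_measure M)"
    unfolding signed_def by measurable
  then show ?thesis by measurable
qed

lemma abs_signed: "\<bar>signed h z\<bar> = \<bar>h (fst z)\<bar>"
  by (simp add: signed_def)

lemma abs_power2_le:
  fixes a b :: real
  shows "\<bar>a\<bar> \<le> b \<Longrightarrow> \<bar>a\<^sup>2\<bar> \<le> b\<^sup>2"
  using power_mono[of "\<bar>a\<bar>" b 2] by simp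

text \<open>Used instead of the Cauchy--Schwarz inequality: the right-hand side is linear in \<open>a\<^sup>2\<close>, so it can be
  integrated over further variables without square roots, and \<open>l\<close> is chosen only at the end.\<close>

lemma abs_le_AM_GM:
  fixes a l :: real
  assumes "l > 0"
  shows "\<bar>a\<bar> \<le> (a\<^sup>2 / l + l) / 2"
proof -
  have "0 \<le> (\<bar>a\<bar> - l)\<^sup>2" by simp
  then have "2 * \<bar>a\<bar> * l \<le> a\<^sup>2 + l\<^sup>2" by (simp add: power2_diff)
  with assms show ?thesis by (simp add: field_simps power2_eq_square)
qed

context prob_space
begin

lemma iid_component_space: "x \<in> space (iid M I) \<Longrightarrow> i \<in> I \<Longrightarrow> x i \<in> space M"
  by (auto simp: space_PiM)

lemma iid_sum_bounded:
  fixes w :: "'a \<Rightarrow> real" and K :: real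
  assumes "\<And>x. x \<in> space M \<Longrightarrow> \<bar>w x\<bar> \<le> K" "x \<in> space (iid M I)"
  shows "\<bar>\<Sum>i\<in>I. w (x i)\<bar> \<le> card I * K"
  using assms by (intro order.trans[OF sum_abs] sum_bounded_above) (auto simp: iid_component_space)

lemma prob_space_signed: "prob_space (signed_measure M)"
  by (intro prob_space_pair prob_space_axioms measure_pmf.prob_space_axioms)

lemma integral_pair_coin:
  fixes f :: "'a \<times> bool \<Rightarrow> real"
  assumes [measurable]: "f \<in> borel_measurable (signed_measure M)"
    and bdd: "\<And>z. z \<in> space (signed_measure M) \<Longrightarrow> \<bar>f z\<bar> \<le> K"
  shows "(\<integral>z. f z \<partial>(signed_measure M)) = (\<integral>x. (f (x, True) + f (x, False)) / 2 \<partial>M)"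
proof -
  interpret C: prob_space coin by (rule measure_pmf.prob_space_axioms)
  interpret MC: pair_prob_space M coin ..
  have "integrable (signed_measure M) f"
    using bdd by (intro MC.integrable_bounded[where K = K]) auto
  then have "(\<integral>z. f z \<partial>(signed_measure M)) = (\<integral>x. (\<integral>b. f (x, b) \<partial>coin) \<partial>M)"
    by (rule MC.integral_fst'[symmetric])
  then show ?thesis by (simp add: field_simps)
qed

text \<open>The cross terms vanish, because the last summand is centred and independent of the
  others.\<close>

lemma iid_sum_square:
  fixes w :: "'a \<Rightarrow> real" and K :: real
  assumes "finite I" and [measurable]: "w \<in> borel_measurable M"
    and w: "\<And>x. x \<in> space M \<Longrightarrow> \<bar>w x\<bar> \<le> K" and w0: "(\<integral>x. w x \<partial>M) = 0"
  shows "(\<integral>x. (\<Sum>i\<in>I. w (x i))\<^sup>2 \<partial>iid M I) = card I * (\<integral>x. (w x)\<^sup>2 \<partial>M)"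
  using assms(1)
proof (induction I rule: finite_induct)
  case empty
  then show ?case by simp
next
  case (insert i I)
  interpret P: prob_space "iid M I" by (rule prob_space_iid)
  have [simp]: "integrable M w" using w by (intro integrable_bounded) auto
  have w2: "\<bar>(w x)\<^sup>2\<bar> \<le> K\<^sup>2" if "x \<in> space M" for x
    by (rule abs_power2_le[OF w[OF that]])
  have [simp]: "integrable M (\<lambda>x. (w x)\<^sup>2)"
    by (rule integrable_bounded[OF _ w2]) measurable
  have bdd: "\<bar>(\<Sum>i\<in>insert i I. w (x i))\<^sup>2\<bar> \<le> (card (insert i I) * K)\<^sup>2"
    if "x \<in> space (iid M (insert i I))" for x
    by (rule abs_power2_le[OF iid_sum_bounded[OF w that]])
  have int: "integrable (iid M I) (\<lambda>x. (\<Sum>i\<in>I. w (x i))\<^sup>2)"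
  proof (rule P.integrable_bounded)
    show "\<bar>(\<Sum>i\<in>I. w (x i))\<^sup>2\<bar> \<le> (card I * K)\<^sup>2" if "x \<in> space (iid M I)" for x
      by (rule abs_power2_le[OF iid_sum_bounded[OF w that]])
  qed measurable
  have "(\<integral>x. (\<Sum>i\<in>insert i I. w (x i))\<^sup>2 \<partial>iid M (insert i I))
    = (\<integral>x. (\<integral>y. (\<Sum>j\<in>insert i I. w ((x(i := y)) j))\<^sup>2 \<partial>M) \<partial>iid M I)"
    by (rule iid_integral_insert(1)[OF insert.hyps _ bdd]) measurable
  also have "\<dots> = (\<integral>x. (\<integral>y. (w y)\<^sup>2 + 2 * w y * (\<Sum>j\<in>I. w (x j)) + (\<Sum>j\<in>I. w (x j))\<^sup>2 \<partial>M) \<partial>iid M I)"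
  proof (intro Bochner_Integration.integral_cong refl)
    fix x :: "_ \<Rightarrow> 'a" and y
    have "(\<Sum>j\<in>I. w ((x(i := y)) j)) = (\<Sum>j\<in>I. w (x j))"
      using insert.hyps by (intro sum.cong) auto
    then show "(\<Sum>j\<in>insert i I. w ((x(i := y)) j))\<^sup>2 = (w y)\<^sup>2 + 2 * w y * (\<Sum>j\<in>I. w (x j)) + (\<Sum>j\<in>I. w (x j))\<^sup>2"
      using insert.hyps by (simp add: power2_sum)
  qed
  also have "\<dots> = (\<integral>x. (\<integral>y. (w y)\<^sup>2 \<partial>M) + (\<Sum>j\<in>I. w (x j))\<^sup>2 \<partial>iid M I)"
    by (simp add: w0 prob_space)
  also have "\<dots> = card (insert i I) * (\<integral>x. (w x)\<^sup>2 \<partial>M)"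
    using insert int by (simp add: P.prob_space algebra_simps)
  finally show ?case .
qed

text \<open>The signs centre the summands whatever \<open>u\<close> is, so the second moment of the
  sum is \<open>card I\<close> times that of \<open>u\<close>; \<open>abs_le_AM_GM\<close> turns it
  into a bound for the absolute value.\<close>

lemma signed_sum_abs_le:
  fixes u :: "'a \<Rightarrow> real" and K l :: real
  assumes I: "finite I" and [measurable]: "u \<in> borel_measurable M"
    and u: "\<And>x. x \<in> space M \<Longrightarrow> \<bar>u x\<bar> \<le> K" and l: "l > 0"
  shows "(\<integral>z. \<bar>\<Sum>i\<in>I. signed u (z i)\<bar> \<partial>iid (signed_measure M) I) \<le> (card I * (\<integral>x. (u x)\<^sup>2 \<partial>M) / l + l) / 2"
proof -
  interpret R: prob_space "signed_measure M" by (rule prob_space_signed)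
  interpret P: prob_space "iid (signed_measure M) I" by (rule R.prob_space_iid)
  have sK: "\<bar>signed u z\<bar> \<le> K" if "z \<in> space (signed_measure M)" for z
    using that u by (auto simp: abs_signed space_pair_measure)
  have s2K: "\<bar>(signed u z)\<^sup>2\<bar> \<le> K\<^sup>2" if "z \<in> space (signed_measure M)" for z
    by (rule abs_power2_le[OF sK[OF that]])
  have bdd: "\<bar>\<Sum>i\<in>I. signed u (z i)\<bar> \<le> card I * K" if "z \<in> space (iid (signed_measure M) I)" for z
    by (rule R.iid_sum_bounded[OF sK that])
  have int: "integrable (iid (signed_measure M) I) (\<lambda>z. \<bar>\<Sum>i\<in>I. signed u (z i)\<bar>)"
    using bdd by (intro P.integrable_bounded) auto
  have int2: "integrable (iid (signed_measure M) I) (\<lambda>z. (\<Sum>i\<in>I. signed u (z i))\<^sup>2)"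
  proof (rule P.integrable_bounded)
    show "\<bar>(\<Sum>i\<in>I. signed u (z i))\<^sup>2\<bar> \<le> (card I * K)\<^sup>2" if "z \<in> space (iid (signed_measure M) I)" for z
      by (rule abs_power2_le[OF bdd[OF that]])
  qed measurable
  have "(\<integral>z. \<bar>\<Sum>i\<in>I. signed u (z i)\<bar> \<partial>iid (signed_measure M) I)
      \<le> (\<integral>z. ((\<Sum>i\<in>I. signed u (z i))\<^sup>2 / l + l) / 2 \<partial>iid (signed_measure M) I)"
    using int int2 l by (intro integral_mono abs_le_AM_GM) auto
  also have "\<dots> = ((\<integral>z. (\<Sum>i\<in>I. signed u (z i))\<^sup>2 \<partial>iid (signed_measure M) I) / l + l) / 2"
    using int2 by (simp add: P.prob_space)
  also have "(\<integral>z. (\<Sum>i\<in>I. signed u (z i))\<^sup>2 \<partial>iid (signed_measure M) I) = card I * (\<integral>x. (u x)\<^sup>2 \<partial>M)"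
  proof (subst R.iid_sum_square[OF I _ sK])
    show "(\<integral>z. signed u z \<partial>(signed_measure M)) = 0"
      by (subst integral_pair_coin[OF _ sK]) (auto simp: signed_def)
    show "card I * (\<integral>z. (signed u z)\<^sup>2 \<partial>(signed_measure M)) = card I * (\<integral>x. (u x)\<^sup>2 \<partial>M)"
      by (subst integral_pair_coin[OF _ s2K]) (auto simp: signed_def)
  qed auto
  finally show ?thesis .
qed

text \<open>The coordinates are exchanged one after another. The induction works because
  \<open>g\<close> is arbitrary: it stores the new coordinate while the induction hypothesis is
  applied to the old ones, and then the signed sums while the new coordinate is exchanged by
  \<open>symmetrization_step\<close>.\<close>

lemma symmetrization:
  fixes g :: "'t \<Rightarrow> real" and h :: "'t \<Rightarrow> 'a \<Rightarrow> real" and \<phi> :: "real \<Rightarrow> real" and K :: real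
  assumes "finite I" and T: "finite T" "T \<noteq> {}"
    and [measurable]: "\<And>t. h t \<in> borel_measurable M" "\<phi> \<in> borel_measurable borel"
    and h: "\<And>t x. t \<in> T \<Longrightarrow> x \<in> space M \<Longrightarrow> \<bar>h t x\<bar> \<le> K"
    and \<phi>: "\<And>x y. \<bar>\<phi> x - \<phi> y\<bar> \<le> \<bar>x - y\<bar>"
  shows "(\<integral>x. (MAX t\<in>T. g t + (\<Sum>i\<in>I. \<phi> (h t (x i)) - (\<integral>y. \<phi> (h t y) \<partial>M))) \<partial>iid M I)
     \<le> (\<integral>z. (MAX t\<in>T. g t + (\<Sum>i\<in>I. 2 * signed (h t) (z i))) \<partial>iid (signed_measure M) I)"
  using assms(1)
proof (induction I arbitrary: g rule: finite_induct)
  case empty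
  interpret R: prob_space "signed_measure M" by (rule prob_space_signed)
  show ?case by (simp add: PiM_empty lebesgue_integral_count_space_finite)
next
  case (insert i I)
  let ?R = "signed_measure M"
  interpret R: prob_space ?R by (rule prob_space_signed)
  interpret P: prob_space "iid M I" by (rule prob_space_iid)
  interpret PR: prob_space "iid ?R I" by (rule R.prob_space_iid)
  interpret MPR: pair_prob_space M "iid ?R I" ..
  define v where "v t y = \<phi> (h t y) - (\<integral>y. \<phi> (h t y) \<partial>M)" for t y
  have [measurable]: "v t \<in> borel_measurable M" for t
    unfolding v_def by measurable
  define V where "V = (\<Sum>t\<in>T. \<bar>\<phi> 0\<bar> + K + \<bar>\<integral>y. \<phi> (h t y) \<partial>M\<bar>)"
  have K0: "K \<ge> 0" using T h not_empty by (metis abs_ge_zero equals0I order.trans)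
  have vV: "\<bar>v t y\<bar> \<le> V" if "t \<in> T" "y \<in> space M" for t y
  proof -
    have "\<bar>v t y\<bar> \<le> \<bar>\<phi> 0\<bar> + K + \<bar>\<integral>y. \<phi> (h t y) \<partial>M\<bar>"
      using \<phi>[of "h t y" 0] h[OF that] unfolding v_def by linarith
    also have "\<dots> \<le> V" unfolding V_def using that T K0 by (intro member_le_sum) auto
    finally show ?thesis .
  qed
  have sK: "\<bar>2 * signed (h t) z\<bar> \<le> 2 * K" if "t \<in> T" "z \<in> space ?R" for t z
    using that h by (auto simp: abs_signed abs_mult space_pair_measure)
  have sum_vV: "\<bar>\<Sum>i\<in>J. v t (x i)\<bar> \<le> card J * V" if "t \<in> T" "x \<in> space (iid M J)" for t x and J :: "'b set"
    by (rule iid_sum_bounded[OF vV[OF that(1)] that(2)])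
  have sum_sK: "\<bar>\<Sum>i\<in>J. 2 * signed (h t) (z i)\<bar> \<le> card J * (2 * K)" if "t \<in> T" "z \<in> space (iid ?R J)" for t z and J :: "'b set"
    by (rule R.iid_sum_bounded[OF sK[OF that(1)] that(2)])
  have Max_le: "\<bar>MAX t\<in>T. f t\<bar> \<le> (\<Sum>t\<in>T. a t)" if "\<And>t. t \<in> T \<Longrightarrow> \<bar>f t\<bar> \<le> a t" for f a :: "'t \<Rightarrow> real"
    using Max_image_bounded[OF T, of f] sum_mono[of T "\<lambda>t. \<bar>f t\<bar>" a] that by force
  have upd: "(\<Sum>j\<in>insert i I. F ((x(i := y)) j)) = F y + (\<Sum>j\<in>I. F (x j))" for F :: "'c \<Rightarrow> real" and x y
  proof -
    have "(\<Sum>j\<in>I. F ((x(i := y)) j)) = (\<Sum>j\<in>I. F (x j))"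
      using insert.hyps by (intro sum.cong) auto
    then show ?thesis using insert.hyps by simp
  qed
  define E where "E y z = (MAX t\<in>T. (g t + (\<Sum>j\<in>I. 2 * signed (h t) (z j))) + v t y)" for y z
  have [measurable]: "case_prod E \<in> borel_measurable (M \<Otimes>\<^sub>M iid ?R I)"
    unfolding E_def using T by measurable
  have E_int: "integrable (M \<Otimes>\<^sub>M iid ?R I) (case_prod E)"
  proof (rule MPR.integrable_bounded)
    fix w assume w: "w \<in> space (M \<Otimes>\<^sub>M iid ?R I)"
    show "\<bar>case_prod E w\<bar> \<le> (\<Sum>t\<in>T. (\<bar>g t\<bar> + card I * (2 * K)) + V)"
      unfolding E_def split_beta using w sum_sK[of _ "snd w" I] vV
      by (intro Max_le) (auto simp: space_pair_measure intro!: order.trans[OF abs_triangle_ineq] add_mono)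
  qed measurable
  have "(\<integral>x. (MAX t\<in>T. g t + (\<Sum>j\<in>insert i I. v t (x j))) \<partial>iid M (insert i I))
    = (\<integral>y. (\<integral>x. (MAX t\<in>T. g t + (\<Sum>j\<in>insert i I. v t ((x(i := y)) j))) \<partial>iid M I) \<partial>M)"
  proof (rule iid_integral_insert(2)[OF insert.hyps])
    show "\<bar>MAX t\<in>T. g t + (\<Sum>j\<in>insert i I. v t (x j))\<bar> \<le> (\<Sum>t\<in>T. \<bar>g t\<bar> + card (insert i I) * V)"
      if "x \<in> space (iid M (insert i I))" for x
      by (intro Max_le order.trans[OF abs_triangle_ineq] add_mono order.refl sum_vV that)
  qed (use T in measurable)
  also have "\<dots> = (\<integral>y. (\<integral>x. (MAX t\<in>T. (g t + v t y) + (\<Sum>j\<in>I. v t (x j))) \<partial>iid M I) \<partial>M)"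
    by (simp only: upd add.assoc)
  also have "\<dots> \<le> (\<integral>y. (\<integral>z. E y z \<partial>iid ?R I) \<partial>M)"
  proof (rule integral_mono)
    show "integrable M (\<lambda>y. \<integral>z. E y z \<partial>iid ?R I)"
      using MPR.integrable_fst'[OF E_int] by simp
    show "(\<integral>x. (MAX t\<in>T. (g t + v t y) + (\<Sum>j\<in>I. v t (x j))) \<partial>iid M I) \<le> (\<integral>z. E y z \<partial>iid ?R I)" for y
      using insert.IH[of "\<lambda>t. g t + v t y"] by (simp add: E_def v_def add_ac)
    show "integrable M (\<lambda>y. \<integral>x. (MAX t\<in>T. (g t + v t y) + (\<Sum>j\<in>I. v t (x j))) \<partial>iid M I)"
    proof -
      interpret MP: pair_prob_space M "iid M I" ..
      have "integrable (M \<Otimes>\<^sub>M iid M I) (\<lambda>(y, x). MAX t\<in>T. (g t + v t y) + (\<Sum>j\<in>I. v t (x j)))"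
      proof (rule MP.integrable_bounded)
        fix w assume w: "w \<in> space (M \<Otimes>\<^sub>M iid M I)"
        show "\<bar>case w of (y, x) \<Rightarrow> MAX t\<in>T. (g t + v t y) + (\<Sum>j\<in>I. v t (x j))\<bar> \<le> (\<Sum>t\<in>T. (\<bar>g t\<bar> + V) + card I * V)"
          unfolding split_beta using w sum_vV[of _ "snd w" I] vV
          by (intro Max_le) (auto simp: space_pair_measure intro!: order.trans[OF abs_triangle_ineq] add_mono)
      qed (use T in measurable)
      then show ?thesis using MP.integrable_fst' by fastforce
    qed
  qed
  also have "\<dots> = (\<integral>z. (\<integral>y. E y z \<partial>M) \<partial>iid ?R I)"
    by (rule MPR.Fubini_integral[OF E_int, symmetric])
  also have "\<dots> \<le> (\<integral>z. (\<integral>w. (MAX t\<in>T. g t + (\<Sum>j\<in>insert i I. 2 * signed (h t) ((z(i := w)) j))) \<partial>?R) \<partial>iid ?R I)"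
  proof (rule integral_mono)
    show "integrable (iid ?R I) (\<lambda>z. \<integral>y. E y z \<partial>M)"
      using MPR.integrable_snd[OF E_int] by simp
    interpret PRR: pair_prob_space "iid ?R I" ?R ..
    define F where "F z w = (MAX t\<in>T. g t + (\<Sum>j\<in>insert i I. 2 * signed (h t) ((z(i := w)) j)))" for z w
    have F_alt: "F z w = (MAX t\<in>T. (g t + (\<Sum>j\<in>I. 2 * signed (h t) (z j))) + 2 * signed (h t) w)" for z w
      unfolding F_def using upd[of "\<lambda>w. 2 * signed (h t) w" z w for t] by (simp only: add_ac)
    have [measurable]: "case_prod F \<in> borel_measurable (iid ?R I \<Otimes>\<^sub>M ?R)"
      unfolding F_alt using T by measurable
    have F_bdd: "\<bar>F z w\<bar> \<le> (\<Sum>t\<in>T. (\<bar>g t\<bar> + card I * (2 * K)) + 2 * K)"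
      if "z \<in> space (iid ?R I)" "w \<in> space ?R" for z w
      unfolding F_alt using that
      by (intro Max_le order.trans[OF abs_triangle_ineq] add_mono order.refl sum_sK sK)
    have "integrable (iid ?R I \<Otimes>\<^sub>M ?R) (case_prod F)"
      using F_bdd by (intro PRR.integrable_bounded) (auto simp: space_pair_measure)
    from PRR.integrable_fst'[OF this]
    show "integrable (iid ?R I) (\<lambda>z. \<integral>w. (MAX t\<in>T. g t + (\<Sum>j\<in>insert i I. 2 * signed (h t) ((z(i := w)) j))) \<partial>?R)"
      by (simp add: F_def)
    fix z assume z: "z \<in> space (iid ?R I)"
    have "(\<integral>y. E y z \<partial>M) \<le> (\<integral>y. (F z (y, True) + F z (y, False)) / 2 \<partial>M)"
      using symmetrization_step[of T h \<phi> K "\<lambda>t. g t + (\<Sum>j\<in>I. 2 * signed (h t) (z j))"] T h \<phi>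
      unfolding E_def F_alt v_def by (simp add: signed_def)
    also have "\<dots> = (\<integral>w. F z w \<partial>?R)"
      using z by (intro integral_pair_coin[symmetric, OF _ F_bdd[OF z]]) auto
    finally show "(\<integral>y. E y z \<partial>M) \<le> (\<integral>w. (MAX t\<in>T. g t + (\<Sum>j\<in>insert i I. 2 * signed (h t) ((z(i := w)) j))) \<partial>?R)"
      by (simp add: F_def)
  qed
  also have "\<dots> = (\<integral>z. (MAX t\<in>T. g t + (\<Sum>j\<in>insert i I. 2 * signed (h t) (z j))) \<partial>iid ?R (insert i I))"
  proof (rule R.iid_integral_insert(1)[OF insert.hyps, symmetric])
    show "\<bar>MAX t\<in>T. g t + (\<Sum>j\<in>insert i I. 2 * signed (h t) (z j))\<bar> \<le> (\<Sum>t\<in>T. \<bar>g t\<bar> + card (insert i I) * (2 * K))"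
      if "z \<in> space (iid ?R (insert i I))" for z
      by (intro Max_le order.trans[OF abs_triangle_ineq] add_mono order.refl sum_sK that)
  qed (use T in measurable)
  finally show ?case by (simp only: v_def)
qed

end

lemma signed_add_mult:
  "signed (\<lambda>x. c * h x) z = c * signed h z"
  "signed (\<lambda>x. \<Sum>j\<in>B. u j x) z = (\<Sum>j\<in>B. signed (u j) z)"
  by (simp_all add: signed_def sum_negf)

section \<open>Maximal sums of positive parts over two classes of functions\<close>

context prob_space
begin

text \<open>Each positive part is split into its mean, at most \<open>m\<close>, and a centred
  remainder. The maximum of the centred sums is symmetrized with the contraction
  \<open>max 0\<close>. A single \<open>D\<close> dominates the signed sums for all
  \<open>t\<close>, so the size of \<open>T\<close> does not enter the bound.\<close>

lemma contraction_bound: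
  fixes h :: "'t \<Rightarrow> 'a \<Rightarrow> real" and m K :: real
  assumes I: "finite I" and T: "finite T" "T \<noteq> {}"
    and [measurable]: "\<And>t. h t \<in> borel_measurable M"
    and h: "\<And>t x. t \<in> T \<Longrightarrow> x \<in> space M \<Longrightarrow> \<bar>h t x\<bar> \<le> K"
    and m: "\<And>t. t \<in> T \<Longrightarrow> (\<integral>x. max 0 (h t x) \<partial>M) \<le> m"
    and D: "integrable (iid (signed_measure M) I) D"
    and le: "\<And>z t. t \<in> T \<Longrightarrow> z \<in> space (iid (signed_measure M) I) \<Longrightarrow> (\<Sum>i\<in>I. signed (h t) (z i)) \<le> D z"
  shows "(\<integral>x. (MAX t\<in>T. \<Sum>i\<in>I. max 0 (h t (x i))) \<partial>iid M I)
    \<le> card I * m + 2 * (\<integral>z. D z \<partial>iid (signed_measure M) I)"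
proof -
  interpret P: prob_space "iid M I" by (rule prob_space_iid)
  interpret R: prob_space "signed_measure M" by (rule prob_space_signed)
  interpret PR: prob_space "iid (signed_measure M) I" by (rule R.prob_space_iid)
  define e where "e t = (\<integral>x. max 0 (h t x) \<partial>M)" for t
  have K0: "K \<ge> 0" using T h not_empty by (metis abs_ge_zero equals0I order.trans)
  have Max_int: "integrable (iid M I) (\<lambda>x. MAX t\<in>T. (\<Sum>i\<in>I. w t (x i)))"
    if [measurable]: "\<And>t. w t \<in> borel_measurable M" and w: "\<And>t x. t \<in> T \<Longrightarrow> x \<in> space M \<Longrightarrow> \<bar>w t x\<bar> \<le> k t"
    for w :: "'t \<Rightarrow> 'a \<Rightarrow> real" and k :: "'t \<Rightarrow> real"
  proof (rule P.integrable_bounded)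
    fix x assume x: "x \<in> space (iid M I)"
    show "\<bar>MAX t\<in>T. (\<Sum>i\<in>I. w t (x i))\<bar> \<le> (\<Sum>t\<in>T. card I * k t)"
      by (rule order.trans[OF Max_image_bounded[OF T] sum_mono]) (rule iid_sum_bounded[OF w x])
  qed (use T in measurable)
  have int1: "integrable (iid M I) (\<lambda>x. MAX t\<in>T. (\<Sum>i\<in>I. max 0 (h t (x i))))"
  proof (rule Max_int)
    show "\<bar>max 0 (h t x)\<bar> \<le> K" if "t \<in> T" "x \<in> space M" for t x
      using h[OF that] by linarith
  qed measurable
  have int2: "integrable (iid M I) (\<lambda>x. MAX t\<in>T. (\<Sum>i\<in>I. max 0 (h t (x i)) - e t))"
  proof (rule Max_int)
    show "\<bar>max 0 (h t x) - e t\<bar> \<le> K + \<bar>e t\<bar>" if "t \<in> T" "x \<in> space M" for t x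
      using h[OF that] by linarith
  qed measurable
  have "(\<integral>x. (MAX t\<in>T. \<Sum>i\<in>I. max 0 (h t (x i))) \<partial>iid M I)
     \<le> (\<integral>x. card I * m + (MAX t\<in>T. \<Sum>i\<in>I. max 0 (h t (x i)) - e t) \<partial>iid M I)"
  proof (intro integral_mono int1 Bochner_Integration.integrable_add P.integrable_const int2)
    fix x
    show "(MAX t\<in>T. \<Sum>i\<in>I. max 0 (h t (x i))) \<le> card I * m + (MAX t\<in>T. \<Sum>i\<in>I. max 0 (h t (x i)) - e t)"
    proof (rule Max.boundedI; (elim imageE, clarify)?)
      fix t assume t: "t \<in> T"
      have "(\<Sum>i\<in>I. max 0 (h t (x i))) = card I * e t + (\<Sum>i\<in>I. max 0 (h t (x i)) - e t)"
        by (simp add: sum_subtractf)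
      also have "\<dots> \<le> card I * m + (MAX t\<in>T. \<Sum>i\<in>I. max 0 (h t (x i)) - e t)"
        using m[OF t] T t by (intro add_mono mult_left_mono Max_ge) (auto simp: e_def)
      finally show "(\<Sum>i\<in>I. max 0 (h t (x i))) \<le> card I * m + (MAX t\<in>T. \<Sum>i\<in>I. max 0 (h t (x i)) - e t)" .
    qed (use T in simp_all)
  qed
  also have "\<dots> = card I * m + (\<integral>x. (MAX t\<in>T. 0 + (\<Sum>i\<in>I. max 0 (h t (x i)) - e t)) \<partial>iid M I)"
    using int2 by (simp add: P.prob_space)
  also have "(\<integral>x. (MAX t\<in>T. 0 + (\<Sum>i\<in>I. max 0 (h t (x i)) - e t)) \<partial>iid M I)
      \<le> (\<integral>z. (MAX t\<in>T. 0 + (\<Sum>i\<in>I. 2 * signed (h t) (z i))) \<partial>iid (signed_measure M) I)"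
    unfolding e_def using h by (intro symmetrization[where K = K] I T) auto
  also have "\<dots> \<le> (\<integral>z. 2 * D z \<partial>iid (signed_measure M) I)"
  proof (rule integral_mono)
    show "integrable (iid (signed_measure M) I) (\<lambda>z. MAX t\<in>T. 0 + (\<Sum>i\<in>I. 2 * signed (h t) (z i)))"
    proof (rule PR.integrable_bounded)
      fix z assume z: "z \<in> space (iid (signed_measure M) I)"
      have b: "\<bar>2 * signed (h t) y\<bar> \<le> 2 * K" if "t \<in> T" "y \<in> space (signed_measure M)" for t y
        using that h by (auto simp: abs_signed abs_mult space_pair_measure)
      show "\<bar>MAX t\<in>T. 0 + (\<Sum>i\<in>I. 2 * signed (h t) (z i))\<bar> \<le> (\<Sum>t\<in>T. card I * (2 * K))"
        unfolding add_0 by (rule order.trans[OF Max_image_bounded[OF T] sum_mono]) (rule R.iid_sum_bounded[OF b z])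
    qed (use T in measurable)
    show "(MAX t\<in>T. 0 + (\<Sum>i\<in>I. 2 * signed (h t) (z i))) \<le> 2 * D z"
      if z: "z \<in> space (iid (signed_measure M) I)" for z
      using T le[OF _ z] by (subst Max_le_iff) (auto simp: sum_distrib_left[symmetric])
  qed (use D in simp)
  finally show ?thesis by simp
qed

text \<open>For subset sums of the \<open>u j\<close>, with either sign in front, the sum over
  \<open>j\<close> of the absolute signed sums is a common majorant. Each \<open>j\<close> is then
  estimated by its second moment, and the exponentially many sets \<open>B\<close> cost
  nothing.\<close>

lemma contraction_finite_combinations:
  fixes u :: "'j \<Rightarrow> 'a \<Rightarrow> real" and m K l :: real
  assumes I: "finite I" and J: "finite J" and l: "l > 0"
    and [measurable]: "\<And>j. u j \<in> borel_measurable M"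
    and u: "\<And>j x. j \<in> J \<Longrightarrow> x \<in> space M \<Longrightarrow> \<bar>u j x\<bar> \<le> K"
    and m: "\<And>s B. s \<in> {- 1, 1} \<Longrightarrow> B \<subseteq> J \<Longrightarrow> (\<integral>x. max 0 (s * (\<Sum>j\<in>B. u j x)) \<partial>M) \<le> m"
  shows "(\<integral>x. (MAX (s, B)\<in>{- 1, 1} \<times> Pow J. \<Sum>i\<in>I. max 0 (s * (\<Sum>j\<in>B. u j (x i)))) \<partial>iid M I)
    \<le> card I * m + (\<Sum>j\<in>J. card I * (\<integral>x. (u j x)\<^sup>2 \<partial>M) / l + l)"
proof -
  interpret R: prob_space "signed_measure M" by (rule prob_space_signed)
  interpret PR: prob_space "iid (signed_measure M) I" by (rule R.prob_space_iid)
  let ?PR = "iid (signed_measure M) I"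
  define h where "h t x = fst t * (\<Sum>j\<in>snd t. u j x)" for t x
  define D where "D z = (\<Sum>j\<in>J. \<bar>\<Sum>i\<in>I. signed (u j) (z i)\<bar>)" for z
  have [measurable]: "h t \<in> borel_measurable M" for t
    unfolding h_def by measurable
  have sK: "\<bar>signed (u j) z\<bar> \<le> K" if "j \<in> J" "z \<in> space (signed_measure M)" for j z
    using that u by (auto simp: abs_signed space_pair_measure)
  have int: "integrable ?PR (\<lambda>z. \<bar>\<Sum>i\<in>I. signed (u j) (z i)\<bar>)" if j: "j \<in> J" for j
    using R.iid_sum_bounded[OF sK[OF j]] by (intro PR.integrable_bounded[where K = "card I * K"]) auto
  have "(\<integral>x. (MAX t\<in>{- 1, 1} \<times> Pow J. \<Sum>i\<in>I. max 0 (h t (x i))) \<partial>iid M I)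
      \<le> card I * m + 2 * (\<integral>z. D z \<partial>?PR)"
  proof (rule contraction_bound[OF I])
    show "\<bar>h t x\<bar> \<le> (\<Sum>j\<in>J. \<bar>K\<bar>)" if "t \<in> {- 1, 1} \<times> Pow J" "x \<in> space M" for t x
    proof -
      have "\<bar>h t x\<bar> = \<bar>\<Sum>j\<in>snd t. u j x\<bar>" using that by (auto simp: h_def)
      also have "\<dots> \<le> (\<Sum>j\<in>snd t. \<bar>u j x\<bar>)" by (rule sum_abs)
      also have "\<dots> \<le> (\<Sum>j\<in>J. \<bar>u j x\<bar>)" using that J by (intro sum_mono2) auto
      also have "\<dots> \<le> (\<Sum>j\<in>J. \<bar>K\<bar>)" using that(2) by (intro sum_mono order.trans[OF u abs_ge_self])
      finally show ?thesis .
    qed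
    show "(\<integral>x. max 0 (h t x) \<partial>M) \<le> m" if "t \<in> {- 1, 1} \<times> Pow J" for t
      using that m[of "fst t" "snd t"] by (auto simp: h_def)
    show "integrable ?PR D"
      unfolding D_def using int by auto
    fix z and t :: "real \<times> 'j set" assume t: "t \<in> {- 1, 1} \<times> Pow J"
    have "(\<Sum>i\<in>I. signed (h t) (z i)) = fst t * (\<Sum>j\<in>snd t. \<Sum>i\<in>I. signed (u j) (z i))"
      unfolding h_def signed_add_mult sum_distrib_left[symmetric] by (simp only: sum.swap[of _ "snd t"])
    also have "\<dots> \<le> \<bar>\<Sum>j\<in>snd t. \<Sum>i\<in>I. signed (u j) (z i)\<bar>" using t by auto
    also have "\<dots> \<le> (\<Sum>j\<in>snd t. \<bar>\<Sum>i\<in>I. signed (u j) (z i)\<bar>)" by (rule sum_abs)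
    also have "\<dots> \<le> D z" unfolding D_def using t J by (intro sum_mono2) auto
    finally show "(\<Sum>i\<in>I. signed (h t) (z i)) \<le> D z" .
  qed (use J in \<open>simp_all add: Pow_not_empty\<close>)
  moreover have "2 * (\<integral>z. D z \<partial>?PR) \<le> (\<Sum>j\<in>J. card I * (\<integral>x. (u j x)\<^sup>2 \<partial>M) / l + l)"
  proof -
    have "2 * (\<integral>z. D z \<partial>?PR) = (\<Sum>j\<in>J. 2 * (\<integral>z. \<bar>\<Sum>i\<in>I. signed (u j) (z i)\<bar> \<partial>?PR))"
      unfolding D_def using int by (simp add: sum_distrib_left)
    also have "\<dots> \<le> (\<Sum>j\<in>J. card I * (\<integral>x. (u j x)\<^sup>2 \<partial>M) / l + l)"
    proof (rule sum_mono)
      fix j assume "j \<in> J"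
      show "2 * (\<integral>z. \<bar>\<Sum>i\<in>I. signed (u j) (z i)\<bar> \<partial>?PR) \<le> card I * (\<integral>x. (u j x)\<^sup>2 \<partial>M) / l + l"
        using signed_sum_abs_le[of I "u j" K l] I l u[OF \<open>j \<in> J\<close>] by simp
    qed
    finally show ?thesis .
  qed
  ultimately show ?thesis
    by (simp add: h_def case_prod_unfold)
qed

lemma bounded_kernel_integrable:
  fixes V :: "'a \<times> 'a \<Rightarrow> real" and K :: real
  assumes [measurable]: "V \<in> borel_measurable (M \<Otimes>\<^sub>M M)"
    and V: "\<And>x y. x \<in> space M \<Longrightarrow> y \<in> space M \<Longrightarrow> \<bar>V (x, y)\<bar> \<le> K"
  shows "integrable (M \<Otimes>\<^sub>M M) V" "integrable (M \<Otimes>\<^sub>M M) (\<lambda>z. (V z)\<^sup>2)"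
proof -
  interpret MM: pair_prob_space M M ..
  have K: "\<bar>V z\<bar> \<le> K" if "z \<in> space (M \<Otimes>\<^sub>M M)" for z
    using that V by (auto simp: space_pair_measure)
  show "integrable (M \<Otimes>\<^sub>M M) V" "integrable (M \<Otimes>\<^sub>M M) (\<lambda>z. (V z)\<^sup>2)"
    by (rule MM.integrable_bounded[OF _ K], measurable)
       (rule MM.integrable_bounded[OF _ abs_power2_le[OF K]], measurable)
qed

text \<open>The analogue with an integral over a set in place of a subset sum: the integral over
  \<open>x\<close> of the absolute signed sums of the sections of \<open>V\<close> dominates the
  signed sums for all \<open>S\<close>. The bound does not involve \<open>C\<close>, so
  \<open>C\<close> may be chosen after an approximation of arbitrary precision.\<close>

lemma contraction_integrals:
  fixes V :: "'a \<times> 'a \<Rightarrow> real" and m K l :: real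
  assumes J: "finite J" and l: "l > 0" and C: "finite C" "C \<noteq> {}" "C \<subseteq> sets M"
    and [measurable]: "V \<in> borel_measurable (M \<Otimes>\<^sub>M M)"
    and V: "\<And>x y. x \<in> space M \<Longrightarrow> y \<in> space M \<Longrightarrow> \<bar>V (x, y)\<bar> \<le> K"
    and m: "\<And>s S. s \<in> {- 1, 1} \<Longrightarrow> S \<in> C \<Longrightarrow> (\<integral>y. max 0 (s * (\<integral>x. indicator S x * V (x, y) \<partial>M)) \<partial>M) \<le> m"
  shows "(\<integral>y. (MAX (s, S)\<in>{- 1, 1} \<times> C. \<Sum>j\<in>J. max 0 (s * (\<integral>x. indicator S x * V (x, y j) \<partial>M))) \<partial>iid M J)
    \<le> card J * m + (card J * (\<integral>x. (\<integral>y. (V (x, y))\<^sup>2 \<partial>M) \<partial>M) / l + l)"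
proof -
  let ?PR = "iid (signed_measure M) J"
  interpret R: prob_space "signed_measure M" by (rule prob_space_signed)
  interpret PR: prob_space ?PR by (rule R.prob_space_iid)
  interpret MP: pair_prob_space M ?PR ..
  interpret MM: pair_prob_space M M ..
  \<comment> \<open>The default 0 makes \<open>h t\<close> measurable for every \<open>t\<close>, as
    \<open>contraction_bound\<close> demands, even when \<open>snd t\<close> is not a measurable
    set.\<close>
  define h where "h t y = (if snd t \<in> C then fst t * (\<integral>x. indicator (snd t) x * V (x, y) \<partial>M) else 0)" for t y
  define D where "D z = (\<integral>x. \<bar>\<Sum>j\<in>J. signed (\<lambda>y. V (x, y)) (z j)\<bar> \<partial>M)" for z
  have [measurable]: "h t \<in> borel_measurable M" for t
  proof (cases "snd t \<in> C")
    case True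
    then have [measurable]: "snd t \<in> sets M" using C by auto
    from True show ?thesis unfolding h_def by simp
  next
    case False
    then have "h t = (\<lambda>_. 0)" by (auto simp: h_def)
    then show ?thesis by simp
  qed
  have K0: "K \<ge> 0" using V not_empty by (metis abs_ge_zero equals0I order.trans)
  have iV: "integrable M (\<lambda>x. indicator S x * V (x, y))" if [measurable]: "S \<in> sets M" "y \<in> space M" for S y
    using V[OF _ that(2)] K0 by (intro integrable_bounded[where K = K]) (auto simp: indicator_def)
  have sK: "\<bar>signed (\<lambda>y. V (x, y)) z\<bar> \<le> K" if "x \<in> space M" "z \<in> space (signed_measure M)" for x z
    using that V by (auto simp: abs_signed space_pair_measure)
  have [measurable]: "(\<lambda>w. signed (\<lambda>y. V (fst w, y)) (snd w j)) \<in> borel_measurable (M \<Otimes>\<^sub>M ?PR)" if "j \<in> J" for j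
  proof -
    have [measurable]: "Measurable.pred (signed_measure M) snd"
      using measurable_snd[of M coin] by simp
    have "(\<lambda>w. snd w j) \<in> (M \<Otimes>\<^sub>M ?PR) \<rightarrow>\<^sub>M (signed_measure M)"
      using that by measurable
    then show ?thesis
      unfolding signed_def by measurable
  qed
  have bd: "\<bar>\<bar>\<Sum>j\<in>J. signed (\<lambda>y. V (x, y)) (z j)\<bar>\<bar> \<le> card J * K" if "x \<in> space M" "z \<in> space ?PR" for x z
    using R.iid_sum_bounded[OF sK[OF that(1)] that(2)] by simp
  have intD: "integrable (M \<Otimes>\<^sub>M ?PR) (\<lambda>(x, z). \<bar>\<Sum>j\<in>J. signed (\<lambda>y. V (x, y)) (z j)\<bar>)"
    using bd by (intro MP.integrable_bounded[where K = "card J * K"]) (auto simp: space_pair_measure split_beta')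
  have "(\<integral>y. (MAX t\<in>{- 1, 1} \<times> C. \<Sum>j\<in>J. max 0 (h t (y j))) \<partial>iid M J)
      \<le> card J * m + 2 * (\<integral>z. D z \<partial>?PR)"
  proof (rule contraction_bound[OF J])
    show "\<bar>h t y\<bar> \<le> K" if t: "t \<in> {- 1, 1} \<times> C" and y: "y \<in> space M" for t y
    proof -
      have S [measurable]: "snd t \<in> sets M" using t C by auto
      have "\<bar>h t y\<bar> = \<bar>\<integral>x. indicator (snd t) x * V (x, y) \<partial>M\<bar>" using t by (auto simp: h_def)
      also have "\<dots> \<le> (\<integral>x. \<bar>indicator (snd t) x * V (x, y)\<bar> \<partial>M)" by (rule integral_abs_bound)
      also have "\<dots> \<le> (\<integral>x. K \<partial>M)"
        using V[OF _ y] K0 iV[OF S y] by (intro integral_mono) (auto simp: indicator_def)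
      finally show ?thesis by (simp add: prob_space)
    qed
    show "(\<integral>y. max 0 (h t y) \<partial>M) \<le> m" if "t \<in> {- 1, 1} \<times> C" for t
      using that m[of "fst t" "snd t"] by (auto simp: h_def)
    show "integrable ?PR D"
      unfolding D_def using MP.integrable_snd[OF intD] by simp
    fix z and t :: "real \<times> 'a set" assume t: "t \<in> {- 1, 1} \<times> C" and z: "z \<in> space ?PR"
    have S [measurable]: "snd t \<in> sets M" using t C by auto
    have zj: "fst (z j) \<in> space M" if "j \<in> J" for j
      using R.iid_component_space[OF z that] by (auto simp: space_pair_measure)
    have sw: "signed (h t) (z j) = (\<integral>x. fst t * (indicator (snd t) x * signed (\<lambda>y. V (x, y)) (z j)) \<partial>M)" for j
      using t by (auto simp: signed_def h_def)
    have isw: "integrable M (\<lambda>x. fst t * (indicator (snd t) x * signed (\<lambda>y. V (x, y)) (z j)))" if "j \<in> J" for j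
      using iV[OF S zj[OF that]] by (cases "snd (z j)") (auto simp: signed_def)
    have isg: "integrable M (\<lambda>x. signed (\<lambda>y. V (x, y)) (z j))" if "j \<in> J" for j
      using iV[OF sets.top zj[OF that]] by (cases "snd (z j)")
        (auto simp: signed_def cong: Bochner_Integration.integrable_cong)
    have "(\<Sum>j\<in>J. signed (h t) (z j)) = (\<integral>x. fst t * (indicator (snd t) x * (\<Sum>j\<in>J. signed (\<lambda>y. V (x, y)) (z j))) \<partial>M)"
      unfolding sw sum_distrib_left by (rule Bochner_Integration.integral_sum[OF isw, symmetric])
    also have "\<dots> \<le> D z"
      unfolding D_def
    proof (rule integral_mono)
      show "integrable M (\<lambda>x. fst t * (indicator (snd t) x * (\<Sum>j\<in>J. signed (\<lambda>y. V (x, y)) (z j))))"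
        unfolding sum_distrib_left using isw by auto
      show "integrable M (\<lambda>x. \<bar>\<Sum>j\<in>J. signed (\<lambda>y. V (x, y)) (z j)\<bar>)"
        using isg by auto
    qed (use t in \<open>auto simp: indicator_def\<close>)
    finally show "(\<Sum>j\<in>J. signed (h t) (z j)) \<le> D z" .
  qed (use C in simp_all)
  moreover have "2 * (\<integral>z. D z \<partial>?PR) \<le> card J * (\<integral>x. (\<integral>y. (V (x, y))\<^sup>2 \<partial>M) \<partial>M) / l + l"
  proof -
    note V2 = bounded_kernel_integrable(2)[OF assms(6) V]
    have iV2: "integrable M (\<lambda>x. \<integral>y. (V (x, y))\<^sup>2 \<partial>M)"
      using MM.integrable_fst'[OF V2] .
    have "(\<integral>z. D z \<partial>?PR) = (\<integral>x. (\<integral>z. \<bar>\<Sum>j\<in>J. signed (\<lambda>y. V (x, y)) (z j)\<bar> \<partial>?PR) \<partial>M)"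
      unfolding D_def by (rule MP.Fubini_integral[OF intD])
    also have "\<dots> \<le> (\<integral>x. (card J * (\<integral>y. (V (x, y))\<^sup>2 \<partial>M) / l + l) / 2 \<partial>M)"
    proof (rule integral_mono)
      show "integrable M (\<lambda>x. \<integral>z. \<bar>\<Sum>j\<in>J. signed (\<lambda>y. V (x, y)) (z j)\<bar> \<partial>?PR)"
        using MP.integrable_fst'[OF intD] by simp
      show "integrable M (\<lambda>x. (card J * (\<integral>y. (V (x, y))\<^sup>2 \<partial>M) / l + l) / 2)"
        using iV2 by simp
      show "(\<integral>z. \<bar>\<Sum>j\<in>J. signed (\<lambda>y. V (x, y)) (z j)\<bar> \<partial>?PR) \<le> (card J * (\<integral>y. (V (x, y))\<^sup>2 \<partial>M) / l + l) / 2"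
        if "x \<in> space M" for x
        using V that by (intro signed_sum_abs_le J l) auto
    qed
    also have "\<dots> = (card J * (\<integral>x. (\<integral>y. (V (x, y))\<^sup>2 \<partial>M) \<partial>M) / l + l) / 2"
      using iV2 by (simp add: prob_space)
    finally show ?thesis by simp
  qed
  ultimately have "(\<integral>y. (MAX t\<in>{- 1, 1} \<times> C. \<Sum>j\<in>J. max 0 (h t (y j))) \<partial>iid M J)
      \<le> card J * m + (card J * (\<integral>x. (\<integral>y. (V (x, y))\<^sup>2 \<partial>M) \<partial>M) / l + l)"
    by simp
  moreover have "(MAX t\<in>{- 1, 1} \<times> C. \<Sum>j\<in>J. max 0 (h t (y j)))
      = (MAX (s, S)\<in>{- 1, 1} \<times> C. \<Sum>j\<in>J. max 0 (s * (\<integral>x. indicator S x * V (x, y j) \<partial>M)))" for y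
    by (intro arg_cong[where f = Max] image_cong) (auto simp: h_def)
  ultimately show ?thesis by simp
qed

end

section \<open>Approximation by kernels that are simple in the first variable\<close>

text \<open>Only the first variable is discretized, through the finite partition that
  \<open>A\<close> generates; the dependence on \<open>y\<close> is unrestricted. Rectangles have
  this form, and it survives linear combinations.\<close>

definition simple_in_first :: "'a measure \<Rightarrow> ('a \<times> 'a \<Rightarrow> real) \<Rightarrow> bool" where
  "simple_in_first M W \<longleftrightarrow> W \<in> borel_measurable (M \<Otimes>\<^sub>M M) \<and> (\<exists>K. \<forall>z. \<bar>W z\<bar> \<le> K) \<and>
     (\<exists>A. finite A \<and> A \<subseteq> sets M \<and> (\<forall>x x' y. (\<forall>S\<in>A. x \<in> S \<longleftrightarrow> x' \<in> S) \<longrightarrow> W (x, y) = W (x', y)))"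

lemma simple_in_first_const: "simple_in_first M (\<lambda>_. c)"
  unfolding simple_in_first_def by (auto intro!: exI[of _ "\<bar>c\<bar>"] exI[of _ "{}"])

lemma simple_in_first_Times:
  assumes "A \<in> sets M" "B \<in> sets M"
  shows "simple_in_first M (indicator (A \<times> B))"
  unfolding simple_in_first_def
proof (intro conjI)
  show "indicator (A \<times> B) \<in> borel_measurable (M \<Otimes>\<^sub>M M)"
    using assms by simp
  show "\<exists>K. \<forall>z. \<bar>indicator (A \<times> B) z :: real\<bar> \<le> K"
    by (intro exI[of _ 1]) (simp add: indicator_def)
  show "\<exists>\<A>. finite \<A> \<and> \<A> \<subseteq> sets M \<and> (\<forall>x x' y. (\<forall>S\<in>\<A>. x \<in> S \<longleftrightarrow> x' \<in> S) \<longrightarrow>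
      (indicator (A \<times> B) (x, y) :: real) = indicator (A \<times> B) (x', y))"
    using assms by (intro exI[of _ "{A}"]) (auto simp: indicator_def)
qed

lemma simple_in_first_combination:
  assumes "simple_in_first M V" "simple_in_first M W"
  shows "simple_in_first M (\<lambda>z. V z + c * W z)"
proof -
  obtain K A where V: "V \<in> borel_measurable (M \<Otimes>\<^sub>M M)" "\<forall>z. \<bar>V z\<bar> \<le> K" "finite A" "A \<subseteq> sets M"
    "\<forall>x x' y. (\<forall>S\<in>A. x \<in> S \<longleftrightarrow> x' \<in> S) \<longrightarrow> V (x, y) = V (x', y)"
    using assms(1) unfolding simple_in_first_def by blast
  obtain L B where W: "W \<in> borel_measurable (M \<Otimes>\<^sub>M M)" "\<forall>z. \<bar>W z\<bar> \<le> L" "finite B" "B \<subseteq> sets M"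
    "\<forall>x x' y. (\<forall>S\<in>B. x \<in> S \<longleftrightarrow> x' \<in> S) \<longrightarrow> W (x, y) = W (x', y)"
    using assms(2) unfolding simple_in_first_def by blast
  show ?thesis
    unfolding simple_in_first_def
  proof (intro conjI)
    show "(\<lambda>z. V z + c * W z) \<in> borel_measurable (M \<Otimes>\<^sub>M M)"
      using V(1) W(1) by simp
    have "\<bar>V z + c * W z\<bar> \<le> K + \<bar>c\<bar> * L" for z
      using V(2)[rule_format, of z] W(2)[rule_format, of z]
      by (intro order.trans[OF abs_triangle_ineq] add_mono) (auto simp: abs_mult intro: mult_left_mono)
    then show "\<exists>K. \<forall>z. \<bar>V z + c * W z\<bar> \<le> K" by blast
    show "\<exists>A. finite A \<and> A \<subseteq> sets M \<and> (\<forall>x x' y. (\<forall>S\<in>A. x \<in> S \<longleftrightarrow> x' \<in> S) \<longrightarrow>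
        V (x, y) + c * W (x, y) = V (x', y) + c * W (x', y))"
    proof (intro exI[of _ "A \<union> B"] conjI allI impI)
      fix x x' y assume "\<forall>S\<in>A \<union> B. x \<in> S \<longleftrightarrow> x' \<in> S"
      then show "V (x, y) + c * W (x, y) = V (x', y) + c * W (x', y)"
        using V(5)[rule_format, of x x' y] W(5)[rule_format, of x x' y] by auto
    qed (use V W in auto)
  qed
qed

lemma (in prob_space) simple_in_first_integrable:
  assumes "simple_in_first M W"
  shows "integrable (M \<Otimes>\<^sub>M M) W"
proof -
  interpret MM: pair_prob_space M M ..
  obtain K where "W \<in> borel_measurable (M \<Otimes>\<^sub>M M)" "\<forall>z. \<bar>W z\<bar> \<le> K"
    using assms unfolding simple_in_first_def by blast
  then show ?thesis
    by (intro MM.integrable_bounded[where K = K]) auto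
qed

definition approximable_in_first :: "'a measure \<Rightarrow> ('a \<times> 'a \<Rightarrow> real) \<Rightarrow> bool" where
  "approximable_in_first M V \<longleftrightarrow> integrable (M \<Otimes>\<^sub>M M) V \<and>
     (\<forall>\<delta>>0. \<exists>W. simple_in_first M W \<and> (\<integral>z. \<bar>V z - W z\<bar> \<partial>(M \<Otimes>\<^sub>M M)) < \<delta>)"

lemma (in prob_space) approximable_in_first_simple:
  "simple_in_first M W \<Longrightarrow> approximable_in_first M W"
  unfolding approximable_in_first_def using simple_in_first_integrable by auto

lemma (in prob_space) approximable_in_first_limit:
  assumes V: "integrable (M \<Otimes>\<^sub>M M) V"
    and app: "\<And>n. approximable_in_first M (s n)"
    and lim: "(\<lambda>n. \<integral>z. \<bar>V z - s n z\<bar> \<partial>(M \<Otimes>\<^sub>M M)) \<longlonglongrightarrow> 0"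
  shows "approximable_in_first M V"
  unfolding approximable_in_first_def
proof (intro conjI V allI impI)
  fix \<delta> :: real assume "\<delta> > 0"
  then have "\<forall>\<^sub>F n in sequentially. (\<integral>z. \<bar>V z - s n z\<bar> \<partial>(M \<Otimes>\<^sub>M M)) < \<delta> / 2"
    by (intro order_tendstoD[OF lim]) simp
  then obtain n where n: "(\<integral>z. \<bar>V z - s n z\<bar> \<partial>(M \<Otimes>\<^sub>M M)) < \<delta> / 2"
    by (auto simp: eventually_sequentially)
  obtain W where W: "simple_in_first M W" "(\<integral>z. \<bar>s n z - W z\<bar> \<partial>(M \<Otimes>\<^sub>M M)) < \<delta> / 2"
    using app[of n] \<open>\<delta> > 0\<close> half_gt_zero unfolding approximable_in_first_def by blast
  note [simp] = V simple_in_first_integrable[OF W(1)]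
  have [simp]: "integrable (M \<Otimes>\<^sub>M M) (s n)"
    using app[of n] by (simp add: approximable_in_first_def)
  have "(\<integral>z. \<bar>V z - W z\<bar> \<partial>(M \<Otimes>\<^sub>M M)) \<le> (\<integral>z. \<bar>V z - s n z\<bar> + \<bar>s n z - W z\<bar> \<partial>(M \<Otimes>\<^sub>M M))"
    by (intro integral_mono) auto
  also have "\<dots> = (\<integral>z. \<bar>V z - s n z\<bar> \<partial>(M \<Otimes>\<^sub>M M)) + (\<integral>z. \<bar>s n z - W z\<bar> \<partial>(M \<Otimes>\<^sub>M M))"
    by simp
  also have "\<dots> < \<delta>" using n W(2) by simp
  finally show "\<exists>W. simple_in_first M W \<and> (\<integral>z. \<bar>V z - W z\<bar> \<partial>(M \<Otimes>\<^sub>M M)) < \<delta>"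
    using W(1) by blast
qed

lemma (in prob_space) approximable_in_first_combination:
  assumes V: "approximable_in_first M V" and V': "approximable_in_first M V'"
  shows "approximable_in_first M (\<lambda>z. V z + c * V' z)"
  unfolding approximable_in_first_def
proof (intro conjI allI impI)
  have [simp]: "integrable (M \<Otimes>\<^sub>M M) V" "integrable (M \<Otimes>\<^sub>M M) V'"
    using V V' by (simp_all add: approximable_in_first_def)
  show "integrable (M \<Otimes>\<^sub>M M) (\<lambda>z. V z + c * V' z)" by simp
  fix \<delta> :: real assume \<delta>: "\<delta> > 0"
  define \<eta> where "\<eta> = \<delta> / (1 + \<bar>c\<bar>)"
  have \<eta>: "\<eta> > 0" using \<delta> by (simp add: \<eta>_def add_pos_nonneg)
  obtain W where W: "simple_in_first M W" "(\<integral>z. \<bar>V z - W z\<bar> \<partial>(M \<Otimes>\<^sub>M M)) < \<eta>"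
    using V \<eta> unfolding approximable_in_first_def by blast
  obtain W' where W': "simple_in_first M W'" "(\<integral>z. \<bar>V' z - W' z\<bar> \<partial>(M \<Otimes>\<^sub>M M)) < \<eta>"
    using V' \<eta> unfolding approximable_in_first_def by blast
  note [simp] = simple_in_first_integrable[OF W(1)] simple_in_first_integrable[OF W'(1)]
  have "(\<integral>z. \<bar>(V z + c * V' z) - (W z + c * W' z)\<bar> \<partial>(M \<Otimes>\<^sub>M M))
      \<le> (\<integral>z. \<bar>V z - W z\<bar> + \<bar>c\<bar> * \<bar>V' z - W' z\<bar> \<partial>(M \<Otimes>\<^sub>M M))"
  proof (rule integral_mono)
    fix z
    have "(V z + c * V' z) - (W z + c * W' z) = (V z - W z) + c * (V' z - W' z)"
      by (simp add: algebra_simps)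
    then show "\<bar>(V z + c * V' z) - (W z + c * W' z)\<bar> \<le> \<bar>V z - W z\<bar> + \<bar>c\<bar> * \<bar>V' z - W' z\<bar>"
      by (metis abs_mult abs_triangle_ineq)
  qed auto
  also have "\<dots> = (\<integral>z. \<bar>V z - W z\<bar> \<partial>(M \<Otimes>\<^sub>M M)) + \<bar>c\<bar> * (\<integral>z. \<bar>V' z - W' z\<bar> \<partial>(M \<Otimes>\<^sub>M M))"
    by simp
  also have "\<dots> < \<eta> + \<bar>c\<bar> * \<eta>"
    using W(2) W'(2) by (intro add_less_le_mono mult_left_mono) auto
  also have "\<dots> = \<delta>"
    by (simp add: \<eta>_def field_simps add_pos_nonneg[THEN less_imp_neq, symmetric])
  finally show "\<exists>W. simple_in_first M W \<and> (\<integral>z. \<bar>V z + c * V' z - W z\<bar> \<partial>(M \<Otimes>\<^sub>M M)) < \<delta>"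
    using simple_in_first_combination[OF W(1) W'(1)] by blast
qed

text \<open>Dynkin's argument from measurable rectangles: complements are linear combinations, and
  the indicator of a countable disjoint union is the L1 limit of its partial sums by dominated
  convergence.\<close>

lemma (in prob_space) approximable_in_first_indicator:
  assumes "E \<in> sets (M \<Otimes>\<^sub>M M)"
  shows "approximable_in_first M (indicator E)"
proof -
  interpret MM: pair_prob_space M M ..
  have "E \<in> sigma_sets (space M \<times> space M) {a \<times> b | a b. a \<in> sets M \<and> b \<in> sets M}"
    using assms by (simp add: sets_pair_measure)
  from Int_stable_pair_measure_generator pair_measure_closed this show ?thesis
  proof (induction rule: sigma_sets_induct_disjoint)
    case (basic A)
    then show ?case by (auto intro!: approximable_in_first_simple simple_in_first_Times)
  next
    case empty
    then show ?case using approximable_in_first_simple[OF simple_in_first_const[of M 0]] by simp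
  next
    case (compl A)
    have "A \<subseteq> space M \<times> space M"
      using sigma_sets_into_sp[OF pair_measure_closed compl(1)] by auto
    then have "(indicator (space M \<times> space M - A) :: _ \<Rightarrow> real)
        = (\<lambda>z. indicator (space M \<times> space M) z + (- 1) * indicator A z)"
      by (auto simp: fun_eq_iff indicator_def)
    then show ?case
      using approximable_in_first_combination[OF approximable_in_first_simple[OF simple_in_first_Times] compl(2),
          of "space M" "space M" "- 1"] by simp
  next
    case (union A)
    have A [measurable]: "A i \<in> sets (M \<Otimes>\<^sub>M M)" for i
      using union(2) by (auto simp: sets_pair_measure)
    have fin: "approximable_in_first M (\<lambda>z. \<Sum>i<n. indicator (A i) z)" for n
    proof (induction n)
      case 0
      then show ?case using approximable_in_first_simple[OF simple_in_first_const[of M 0]] by simp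
    next
      case (Suc n)
      show ?case using approximable_in_first_combination[OF Suc union(3)[of n], of 1] by simp
    qed
    have sums: "(\<lambda>i. indicator (A i) z :: real) sums indicator (\<Union>i. A i) z" for z
    proof (cases "z \<in> (\<Union>i. A i)")
      case True
      then obtain k where k: "z \<in> A k" by auto
      have "z \<notin> A i" if "i \<noteq> k" for i
        using union(1) k that by (auto simp: disjoint_family_on_def)
      then have "(\<lambda>i. indicator (A i) z :: real) = (\<lambda>i. if i = k then 1 else 0)"
        using k by (auto simp: fun_eq_iff)
      with True show ?thesis using sums_single[of k "\<lambda>_. 1 :: real"] by simp
    qed simp
    \<comment> \<open>By disjointness the partial sums stay below the indicator of the union, which
      makes the constant 1 a dominating function.\<close>
    have le: "(\<Sum>i<n. indicator (A i) z :: real) \<le> indicator (\<Union>i. A i) z" for n :: nat and z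
      using sum_le_suminf[OF sums_summable[OF sums[of z]], of "{..<n}"] sums_unique[OF sums[of z]] by simp
    have "(\<lambda>n. \<integral>z. \<bar>(indicator (\<Union>i. A i) z :: real) - (\<Sum>i<n. indicator (A i) z)\<bar> \<partial>(M \<Otimes>\<^sub>M M))
        \<longlonglongrightarrow> (\<integral>z. 0 \<partial>(M \<Otimes>\<^sub>M M))"
    proof (rule integral_dominated_convergence[where w = "\<lambda>_. 1"])
      show "AE z in M \<Otimes>\<^sub>M M. (\<lambda>n. \<bar>indicator (\<Union>i. A i) z - (\<Sum>i<n. indicator (A i) z)\<bar>) \<longlonglongrightarrow> (0::real)"
      proof (rule AE_I2)
        fix z
        show "(\<lambda>n. \<bar>indicator (\<Union>i. A i) z - (\<Sum>i<n. indicator (A i) z)\<bar>) \<longlonglongrightarrow> (0::real)"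
          using tendsto_rabs[OF tendsto_diff[OF tendsto_const[of "indicator (\<Union>i. A i) z :: real"] sums[of z, unfolded sums_def]]]
          by simp
      qed
      have "0 \<le> (\<Sum>i<n. indicator (A i) z :: real)" for n z by (intro sum_nonneg) auto
      moreover have "indicator (\<Union>i. A i) z \<le> (1 :: real)" for z by (rule indicator_le_1)
      ultimately have "\<bar>indicator (\<Union>i. A i) z - (\<Sum>i<n. indicator (A i) z)\<bar> \<le> (1::real)" for n z
        using le by (simp add: abs_le_iff add_increasing2 diff_le_eq)
      then show "AE z in M \<Otimes>\<^sub>M M. norm \<bar>(indicator (\<Union>i. A i) z :: real) - (\<Sum>i<n. indicator (A i) z)\<bar> \<le> (1::real)" for n
        by simp
    qed auto
    moreover have "integrable (M \<Otimes>\<^sub>M M) (indicator (\<Union>i. A i) :: _ \<Rightarrow> real)"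
      by (intro MM.integrable_bounded[where K = 1]) (auto split: split_indicator)
    ultimately show ?case
      by (intro approximable_in_first_limit[OF _ fin]) auto
  qed
qed

lemma (in prob_space) approximable_in_first_integrable:
  assumes "integrable (M \<Otimes>\<^sub>M M) V"
  shows "approximable_in_first M V"
  using assms
proof (induction rule: integrable_induct)
  case (base A c)
  show ?case
    using approximable_in_first_combination[OF approximable_in_first_simple[OF simple_in_first_const[of M 0]]
        approximable_in_first_indicator[OF base(1)], of c]
    by (simp add: mult.commute)
next
  case (add f g)
  then show ?case using approximable_in_first_combination[of f g 1] by simp
next
  case (lim f s)
  have conv: "(\<lambda>n. s n z) \<longlonglongrightarrow> f z" if "z \<in> space (M \<Otimes>\<^sub>M M)" for z
    using that by (rule lim)
  have bound: "norm (s n z) \<le> 2 * norm (f z)" if "z \<in> space (M \<Otimes>\<^sub>M M)" for n z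
    using that by (rule lim)
  have "(\<lambda>n. \<integral>z. \<bar>f z - s n z\<bar> \<partial>(M \<Otimes>\<^sub>M M)) \<longlonglongrightarrow> (\<integral>z. 0 \<partial>(M \<Otimes>\<^sub>M M))"
  \<comment> \<open>The approximants are bounded by twice the absolute value of the limit, whence
    the factor 3.\<close>
  proof (rule integral_dominated_convergence[where w = "\<lambda>z. 3 * \<bar>f z\<bar>"])
    show "AE z in M \<Otimes>\<^sub>M M. (\<lambda>n. \<bar>f z - s n z\<bar>) \<longlonglongrightarrow> 0"
    proof (rule AE_I2)
      fix z assume z: "z \<in> space (M \<Otimes>\<^sub>M M)"
      show "(\<lambda>n. \<bar>f z - s n z\<bar>) \<longlonglongrightarrow> 0"
        using tendsto_rabs[OF tendsto_diff[OF tendsto_const[of "f z"] conv[OF z]]] by simp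
    qed
    show "AE z in M \<Otimes>\<^sub>M M. norm \<bar>f z - s n z\<bar> \<le> 3 * \<bar>f z\<bar>" for n
      using bound[of _ n] by (intro AE_I2) force
  qed (use lim in auto)
  then show ?case
    using lim by (intro approximable_in_first_limit[of f s]) auto
qed

section \<open>Cuts of a bipartite sample\<close>

lemma abs_eq_sign_mult: "\<exists>s\<in>{- 1, 1}. \<bar>a\<bar> = s * (a :: real)"
  by (cases "a \<ge> 0") auto

context prob_space
begin

lemma iid_component_integral:
  fixes f :: "'a \<Rightarrow> real"
  assumes "j \<in> J" and [measurable]: "f \<in> borel_measurable M"
  shows "(\<integral>x. f (x j) \<partial>iid M J) = (\<integral>x. f x \<partial>M)"
proof -
  have "(\<integral>x. f (x j) \<partial>iid M J) = (\<integral>x. f x \<partial>distr (iid M J) M (\<lambda>x. x j))"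
    using assms by (subst integral_distr) auto
  also have "distr (iid M J) M (\<lambda>x. x j) = M"
    using assms(1) by (intro distr_PiM_component prob_space_axioms)
  finally show ?thesis .
qed

lemma iid_component_integrable:
  fixes f :: "'a \<Rightarrow> real"
  assumes "j \<in> J" and f: "integrable M f"
  shows "integrable (iid M J) (\<lambda>x. f (x j))"
proof -
  have "distr (iid M J) M (\<lambda>x. x j) = M"
    using assms(1) by (intro distr_PiM_component prob_space_axioms)
  with f have "integrable (distr (iid M J) M (\<lambda>x. x j)) f" by simp
  then show ?thesis
    using assms(1) borel_measurable_integrable[OF f] by (subst (asm) integrable_distr_eq) auto
qed

text \<open>The set where a linear combination of sections \<open>W (_, y j)\<close> is positive is a union of atoms of the
  finitely many sets on which \<open>W\<close> depends; these unions form the class \<open>C\<close>.\<close>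

lemma finite_class_positive_part:
  fixes V :: "'a \<times> 'a \<Rightarrow> real" and K :: real
  assumes W: "simple_in_first M W" and [measurable]: "V \<in> borel_measurable (M \<Otimes>\<^sub>M M)"
    and V: "\<And>x y. x \<in> space M \<Longrightarrow> y \<in> space M \<Longrightarrow> \<bar>V (x, y)\<bar> \<le> K"
  obtains C where "finite C" "C \<noteq> {}" "C \<subseteq> sets M"
    "\<And>s B y. s \<in> {- 1, 1} \<Longrightarrow> finite B \<Longrightarrow> (\<And>j. j \<in> B \<Longrightarrow> y j \<in> space M) \<Longrightarrow>
      \<exists>S\<in>C. (\<integral>x. max 0 (s * (\<Sum>j\<in>B. V (x, y j))) \<partial>M)
        \<le> s * (\<Sum>j\<in>B. \<integral>x. indicator S x * V (x, y j) \<partial>M) + (\<Sum>j\<in>B. \<integral>x. \<bar>V (x, y j) - W (x, y j)\<bar> \<partial>M)"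
proof -
  obtain L A where [measurable]: "W \<in> borel_measurable (M \<Otimes>\<^sub>M M)" and WL: "\<forall>z. \<bar>W z\<bar> \<le> L" and A: "finite A" "A \<subseteq> sets M"
    and WA: "\<forall>x x' y. (\<forall>S\<in>A. x \<in> S \<longleftrightarrow> x' \<in> S) \<longrightarrow> W (x, y) = W (x', y)"
    using W unfolding simple_in_first_def by blast
  define cell where "cell F = {x \<in> space M. {S \<in> A. x \<in> S} \<in> F}" for F
  define C where "C = cell ` Pow (Pow A)"
  have cell_sets: "cell F \<in> sets M" if F: "F \<subseteq> Pow A" for F
  proof -
    have "{x \<in> space M. {S \<in> A. x \<in> S} = G} \<in> sets M" if "G \<in> F" for G
    proof -
      have "{x \<in> space M. {S \<in> A. x \<in> S} = G} = {x \<in> space M. \<forall>S\<in>A. x \<in> S \<longleftrightarrow> S \<in> G}"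
        using F that by auto
      also have "\<dots> \<in> sets M"
        using A by (intro sets.sets_Collect_finite_All sets.sets_Collect) auto
      finally show ?thesis .
    qed
    moreover have "cell F = (\<Union>G\<in>F. {x \<in> space M. {S \<in> A. x \<in> S} = G})"
      by (auto simp: cell_def)
    moreover have "finite F" using F A(1) finite_subset by blast
    ultimately show ?thesis by auto
  qed
  show ?thesis
  proof
    show "finite C" "C \<noteq> {}" using A by (auto simp: C_def)
    show "C \<subseteq> sets M" using cell_sets by (auto simp: C_def)
    fix s :: real and B :: "'b set" and y :: "'b \<Rightarrow> 'a"
    assume s: "s \<in> {- 1, 1}" and B: "finite B" and y: "\<And>j. j \<in> B \<Longrightarrow> y j \<in> space M"
    \<comment> \<open>The positivity set of the combination of sections of \<open>W\<close>, not of
      \<open>V\<close>: the former is a union of cells and hence a member of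
      \<open>C\<close>.\<close>
    define S where "S = {x \<in> space M. s * (\<Sum>j\<in>B. W (x, y j)) > 0}"
    have "S = cell ((\<lambda>x. {S \<in> A. x \<in> S}) ` S)"
    proof (intro equalityI subsetI)
      fix x assume "x \<in> cell ((\<lambda>x. {S \<in> A. x \<in> S}) ` S)"
      then obtain x' where x': "x \<in> space M" "x' \<in> S" "{S \<in> A. x \<in> S} = {S \<in> A. x' \<in> S}"
        by (auto simp: cell_def)
      then have "W (x, y j) = W (x', y j)" for j
        using WA[rule_format, of x x' "y j"] by blast
      with x' show "x \<in> S" by (simp add: S_def)
    qed (auto simp: cell_def S_def)
    then have SC: "S \<in> C" unfolding C_def by (intro image_eqI) auto
    then have [measurable]: "S \<in> sets M" using cell_sets by (auto simp: C_def)
    have iV: "integrable M (\<lambda>x. V (x, y j))" if "j \<in> B" for j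
      using V y[OF that] by (intro integrable_bounded[where K = K]) auto
    have iW: "integrable M (\<lambda>x. W (x, y j))" if "j \<in> B" for j
      using WL y[OF that] by (intro integrable_bounded[where K = L]) auto
    have iSV: "integrable M (\<lambda>x. indicator S x * V (x, y j))" if "j \<in> B" for j
      using integrable_mult_indicator[OF \<open>S \<in> sets M\<close> iV[OF that]] by simp
    have imax: "integrable M (\<lambda>x. max 0 (s * (\<Sum>j\<in>B. V (x, y j))))"
      using iV by (intro integrable_max integrable_const integrable_mult_right Bochner_Integration.integrable_sum) auto
    have "(\<integral>x. max 0 (s * (\<Sum>j\<in>B. V (x, y j))) \<partial>M)
        \<le> (\<integral>x. s * (\<Sum>j\<in>B. indicator S x * V (x, y j)) + (\<Sum>j\<in>B. \<bar>V (x, y j) - W (x, y j)\<bar>) \<partial>M)"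
    proof (rule integral_mono[OF imax])
      show "integrable M (\<lambda>x. s * (\<Sum>j\<in>B. indicator S x * V (x, y j)) + (\<Sum>j\<in>B. \<bar>V (x, y j) - W (x, y j)\<bar>))"
        using iV iW iSV by auto
      fix x assume x: "x \<in> space M"
      have "\<bar>s * (\<Sum>j\<in>B. V (x, y j)) - s * (\<Sum>j\<in>B. W (x, y j))\<bar> = \<bar>\<Sum>j\<in>B. V (x, y j) - W (x, y j)\<bar>"
        using s by (auto simp: sum_subtractf abs_minus_commute)
      also have "\<dots> \<le> (\<Sum>j\<in>B. \<bar>V (x, y j) - W (x, y j)\<bar>)" by (rule sum_abs)
      finally have d: "\<bar>s * (\<Sum>j\<in>B. V (x, y j)) - s * (\<Sum>j\<in>B. W (x, y j))\<bar> \<le> (\<Sum>j\<in>B. \<bar>V (x, y j) - W (x, y j)\<bar>)" .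
      show "max 0 (s * (\<Sum>j\<in>B. V (x, y j)))
          \<le> s * (\<Sum>j\<in>B. indicator S x * V (x, y j)) + (\<Sum>j\<in>B. \<bar>V (x, y j) - W (x, y j)\<bar>)"
      \<comment> \<open>Where the signs of the two combinations disagree, the one with
        \<open>V\<close> is at most their difference in absolute value, which \<open>d\<close>
        controls.\<close>
      proof (cases "x \<in> S")
        case True
        then have "s * (\<Sum>j\<in>B. W (x, y j)) > 0" by (simp add: S_def)
        with d True show ?thesis by (simp add: abs_le_iff)
      next
        case False
        then have "s * (\<Sum>j\<in>B. W (x, y j)) \<le> 0" using x by (simp add: S_def)
        with d False show ?thesis by (simp add: abs_le_iff)
      qed
    qed
    also have "\<dots> = s * (\<Sum>j\<in>B. \<integral>x. indicator S x * V (x, y j) \<partial>M) + (\<Sum>j\<in>B. \<integral>x. \<bar>V (x, y j) - W (x, y j)\<bar> \<partial>M)"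
      using iV iW iSV by (subst Bochner_Integration.integral_add) auto
    finally show "\<exists>S\<in>C. (\<integral>x. max 0 (s * (\<Sum>j\<in>B. V (x, y j))) \<partial>M)
        \<le> s * (\<Sum>j\<in>B. \<integral>x. indicator S x * V (x, y j) \<partial>M) + (\<Sum>j\<in>B. \<integral>x. \<bar>V (x, y j) - W (x, y j)\<bar> \<partial>M)"
      using SC by blast
  qed
qed

section \<open>Mean of the maximal rectangle sum over disjoint rows and columns\<close>

lemma max_rectangle_sum_integrable:
  fixes V :: "'a \<times> 'a \<Rightarrow> real" and K :: real
  assumes L: "finite L" "I \<subseteq> L" "J \<subseteq> L" and [measurable]: "V \<in> borel_measurable (M \<Otimes>\<^sub>M M)"
    and V: "\<And>x y. x \<in> space M \<Longrightarrow> y \<in> space M \<Longrightarrow> \<bar>V (x, y)\<bar> \<le> K"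
  shows "integrable (iid M L) (\<lambda>x. MAX (A, B)\<in>Pow I \<times> Pow J. \<bar>\<Sum>i\<in>A. \<Sum>j\<in>B. V (x i, x j)\<bar>)"
proof -
  let ?P = "iid M L"
  interpret P: prob_space ?P by (rule prob_space_iid)
  have fin: "finite (Pow I \<times> Pow J)" "Pow I \<times> Pow J \<noteq> {}"
    using finite_subset[OF L(2,1)] finite_subset[OF L(3,1)] by (auto simp: Pow_not_empty)
  show ?thesis
    unfolding case_prod_unfold
  proof (rule P.integrable_bounded)
    have "(\<lambda>x. \<bar>\<Sum>i\<in>fst t. \<Sum>j\<in>snd t. V (x i, x j)\<bar>) \<in> borel_measurable ?P" if t: "t \<in> Pow I \<times> Pow J" for t
    proof -
      have [measurable]: "(\<lambda>x. x j) \<in> ?P \<rightarrow>\<^sub>M M" if "j \<in> fst t \<or> j \<in> snd t" for j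
        using t L that by (intro measurable_component_singleton) auto
      show ?thesis by measurable
    qed
    then show "(\<lambda>x. MAX t\<in>Pow I \<times> Pow J. \<bar>\<Sum>i\<in>fst t. \<Sum>j\<in>snd t. V (x i, x j)\<bar>) \<in> borel_measurable ?P"
      using fin by (intro borel_measurable_Max) auto
    fix x assume x: "x \<in> space ?P"
    have "\<bar>\<bar>\<Sum>i\<in>fst t. \<Sum>j\<in>snd t. V (x i, x j)\<bar>\<bar> \<le> (\<Sum>i\<in>fst t. \<Sum>j\<in>snd t. K)" if t: "t \<in> Pow I \<times> Pow J" for t
      unfolding abs_abs
    proof (intro order.trans[OF sum_abs] sum_mono)
      fix i j assume "i \<in> fst t" "j \<in> snd t"
      then show "\<bar>V (x i, x j)\<bar> \<le> K" using t L by (intro V iid_component_space[OF x]) auto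
    qed
    then show "\<bar>MAX t\<in>Pow I \<times> Pow J. \<bar>\<Sum>i\<in>fst t. \<Sum>j\<in>snd t. V (x i, x j)\<bar>\<bar>
        \<le> (\<Sum>t\<in>Pow I \<times> Pow J. \<Sum>i\<in>fst t. \<Sum>j\<in>snd t. K)"
      using fin by (intro order.trans[OF Max_image_bounded] sum_mono) auto
  qed
qed

text \<open>The positive part selects the set \<open>T\<close> of those \<open>y\<close> for which
  the integral over \<open>S\<close> has the sign \<open>s\<close>; the left-hand side is then
  \<open>s\<close> times the integral of \<open>V\<close> over the rectangle
  \<open>S \<times> T\<close>.\<close>

lemma mean_positive_part_le_cut:
  fixes V :: "'a \<times> 'a \<Rightarrow> real" and K s c :: real
  assumes s: "s \<in> {- 1, 1}" and [measurable]: "S \<in> sets M" "V \<in> borel_measurable (M \<Otimes>\<^sub>M M)"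
    and V: "\<And>x y. x \<in> space M \<Longrightarrow> y \<in> space M \<Longrightarrow> \<bar>V (x, y)\<bar> \<le> K"
    and cut: "\<And>T. T \<in> sets M \<Longrightarrow> \<bar>\<integral>z. indicator (S \<times> T) z * V z \<partial>(M \<Otimes>\<^sub>M M)\<bar> \<le> c"
  shows "(\<integral>y. max 0 (s * (\<integral>x. indicator S x * V (x, y) \<partial>M)) \<partial>M) \<le> c"
proof -
  interpret MM: pair_prob_space M M ..
  define w where "w y = (\<integral>x. indicator S x * V (x, y) \<partial>M)" for y
  have [measurable]: "w \<in> borel_measurable M" unfolding w_def by measurable
  define T where "T = {y \<in> space M. s * w y > 0}"
  have [measurable]: "T \<in> sets M" unfolding T_def by measurable
  have "integrable (M \<Otimes>\<^sub>M M) V"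
    by (rule bounded_kernel_integrable(1)[OF assms(3) V])
  then have int: "integrable (M \<Otimes>\<^sub>M M) (\<lambda>z. indicator (S \<times> T) z * V z)"
    using integrable_mult_indicator[of "S \<times> T" "M \<Otimes>\<^sub>M M" V] by simp
  have "(\<integral>y. max 0 (s * w y) \<partial>M) = (\<integral>y. s * (\<integral>x. indicator (S \<times> T) (x, y) * V (x, y) \<partial>M) \<partial>M)"
  proof (intro Bochner_Integration.integral_cong refl)
    fix y assume "y \<in> space M"
    then show "max 0 (s * w y) = s * (\<integral>x. indicator (S \<times> T) (x, y) * V (x, y) \<partial>M)"
      by (cases "y \<in> T") (auto simp: T_def w_def indicator_times)
  qed
  also have "\<dots> = s * (\<integral>z. indicator (S \<times> T) z * V z \<partial>(M \<Otimes>\<^sub>M M))"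
    using MM.integral_snd[of "\<lambda>x y. indicator (S \<times> T) (x, y) * V (x, y)"] int by (simp add: split_beta')
  also have "\<dots> \<le> c"
    using s cut[of T] by auto
  finally show ?thesis by (simp add: w_def)
qed

text \<open>This removes the randomness of the columns. For given columns, the optimal set of points
  \<open>x\<close> is found in a finite class \<open>C\<close> up to an approximation error;
  bounding the subset sum over \<open>B\<close> by positive parts leads to
  \<open>contraction_integrals\<close>, with means at most \<open>c\<close>. As that bound is free
  of \<open>C\<close>, the error can be made smaller than any \<open>e\<close>.\<close>

lemma mean_max_positive_part:
  fixes V :: "'a \<times> 'a \<Rightarrow> real" and J :: "'j set" and K l c :: real
  assumes J: "finite J" and l: "l > 0" and [measurable]: "V \<in> borel_measurable (M \<Otimes>\<^sub>M M)"
    and V: "\<And>x y. x \<in> space M \<Longrightarrow> y \<in> space M \<Longrightarrow> \<bar>V (x, y)\<bar> \<le> K"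
    and cut: "\<And>S T. S \<in> sets M \<Longrightarrow> T \<in> sets M \<Longrightarrow> \<bar>\<integral>z. indicator (S \<times> T) z * V z \<partial>(M \<Otimes>\<^sub>M M)\<bar> \<le> c"
  shows "(\<integral>y. (MAX (s, B)\<in>{- 1, 1} \<times> Pow J. \<integral>x. max 0 (s * (\<Sum>j\<in>B. V (x, y j))) \<partial>M) \<partial>iid M J)
    \<le> card J * c + (card J * (\<integral>x. (\<integral>y. (V (x, y))\<^sup>2 \<partial>M) \<partial>M) / l + l)"
proof (rule field_le_epsilon)
  fix e :: real assume e: "e > 0"
  let ?P = "iid M J"
  interpret P: prob_space ?P by (rule prob_space_iid)
  interpret MM: pair_prob_space M M ..
  note V_int = bounded_kernel_integrable(1)[OF assms(3) V]
  have K0: "K \<ge> 0" using V not_empty by (metis abs_ge_zero equals0I order.trans)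
  \<comment> \<open>The error occurs once for each column; the summand 1 covers the case of an empty
    \<open>J\<close>.\<close>
  define \<delta> where "\<delta> = e / (card J + 1)"
  have "\<delta> > 0" using e by (simp add: \<delta>_def)
  then obtain W where W: "simple_in_first M W" "(\<integral>z. \<bar>V z - W z\<bar> \<partial>(M \<Otimes>\<^sub>M M)) < \<delta>"
    using approximable_in_first_integrable[OF V_int] unfolding approximable_in_first_def by blast
  obtain L where [measurable]: "W \<in> borel_measurable (M \<Otimes>\<^sub>M M)" and WL: "\<forall>z. \<bar>W z\<bar> \<le> L"
    using W(1) unfolding simple_in_first_def by blast
  have VW_int: "integrable (M \<Otimes>\<^sub>M M) (\<lambda>z. \<bar>V z - W z\<bar>)"
    using V_int simple_in_first_integrable[OF W(1)] by simp
  obtain C where C: "finite C" "C \<noteq> {}" "C \<subseteq> sets M"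
    and CV: "\<And>s B y. s \<in> {- 1, 1} \<Longrightarrow> finite B \<Longrightarrow> (\<And>j::'j. j \<in> B \<Longrightarrow> y j \<in> space M) \<Longrightarrow>
      \<exists>S\<in>C. (\<integral>x. max 0 (s * (\<Sum>j\<in>B. V (x, y j))) \<partial>M)
        \<le> s * (\<Sum>j\<in>B. \<integral>x. indicator S x * V (x, y j) \<partial>M) + (\<Sum>j\<in>B. \<integral>x. \<bar>V (x, y j) - W (x, y j)\<bar> \<partial>M)"
    using finite_class_positive_part[where V = V, OF W(1) _ V] by auto
  define d where "d y = (\<integral>x. \<bar>V (x, y) - W (x, y)\<bar> \<partial>M)" for y
  have d_int: "integrable M d"
    unfolding d_def using MM.integrable_snd[of "\<lambda>x y. \<bar>V (x, y) - W (x, y)\<bar>"] VW_int by (simp add: split_beta')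
  have d_le: "(\<integral>y. d y \<partial>M) < \<delta>"
    unfolding d_def using MM.integral_snd[of "\<lambda>x y. \<bar>V (x, y) - W (x, y)\<bar>"] VW_int W(2) by (simp add: split_beta')
  define h where "h S y = (\<integral>x. indicator S x * V (x, y) \<partial>M)" for S y
  have h_meas: "h S \<in> borel_measurable M" if "S \<in> C" for S
  proof -
    have [measurable]: "S \<in> sets M" using that C by auto
    show ?thesis unfolding h_def by measurable
  qed
  have h_bdd: "\<bar>h S y\<bar> \<le> K" if "S \<in> C" "y \<in> space M" for S y
  proof -
    have [measurable]: "S \<in> sets M" using that C by auto
    have iV: "integrable M (\<lambda>x. V (x, y))"
      using V that(2) by (intro integrable_bounded[where K = K]) auto
    have "\<bar>h S y\<bar> \<le> (\<integral>x. \<bar>indicator S x * V (x, y)\<bar> \<partial>M)" unfolding h_def by (rule integral_abs_bound)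
    also have "\<dots> \<le> (\<integral>x. K \<partial>M)"
      using V[OF _ that(2)] K0 integrable_mult_indicator[OF \<open>S \<in> sets M\<close> iV]
      by (intro integral_mono) (auto simp: indicator_def)
    finally show ?thesis by (simp add: prob_space)
  qed
  define G where "G y = (MAX (s, S)\<in>{- 1, 1} \<times> C. \<Sum>j\<in>J. max 0 (s * h S (y j)))" for y
  define F where "F y = (MAX (s, B)\<in>{- 1, 1} \<times> Pow J. \<integral>x. max 0 (s * (\<Sum>j\<in>B. V (x, y j))) \<partial>M)" for y
  have G_int: "integrable ?P G"
  proof (rule P.integrable_bounded)
    show "G \<in> borel_measurable ?P"
    proof -
      have "(\<lambda>y. \<Sum>j\<in>J. max 0 (fst t * h (snd t) (y j))) \<in> borel_measurable ?P" if "t \<in> {- 1, 1} \<times> C" for t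
        using that h_meas by (auto intro!: borel_measurable_sum borel_measurable_max borel_measurable_times measurable_compose[OF measurable_component_singleton])
      then show ?thesis unfolding G_def case_prod_unfold using C by (intro borel_measurable_Max) auto
    qed
    fix y assume y: "y \<in> space ?P"
    have "\<bar>\<Sum>j\<in>J. max 0 (fst t * h (snd t) (y j))\<bar> \<le> card J * K" if t: "t \<in> {- 1, 1} \<times> C" for t
    proof (rule iid_sum_bounded[OF _ y])
      show "\<bar>max 0 (fst t * h (snd t) x)\<bar> \<le> K" if "x \<in> space M" for x
        using h_bdd[OF _ that, of "snd t"] t by auto
    qed
    then show "\<bar>G y\<bar> \<le> (\<Sum>t\<in>{- 1, 1 :: real} \<times> C. card J * K)"
      unfolding G_def case_prod_unfold using C
      by (intro order.trans[OF Max_image_bounded] sum_mono) auto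
  qed
  have "(\<integral>y. F y \<partial>?P) \<le> (\<integral>y. G y + (\<Sum>j\<in>J. d (y j)) \<partial>?P)"
  proof (rule integral_mono)
    have dj: "integrable ?P (\<lambda>y. d (y j))" if "j \<in> J" for j
      by (rule iid_component_integrable[OF that d_int])
    show GD: "integrable ?P (\<lambda>y. G y + (\<Sum>j\<in>J. d (y j)))"
      using G_int dj by auto
    show le: "F y \<le> G y + (\<Sum>j\<in>J. d (y j))" if y: "y \<in> space ?P" for y
      unfolding F_def
    proof (rule Max.boundedI; (elim imageE, clarify)?)
      fix s :: real and B assume s: "s \<in> {- 1, 1}" and B: "B \<subseteq> J"
      have yj: "y j \<in> space M" if "j \<in> J" for j
        by (rule iid_component_space[OF y that])
      obtain S where S: "S \<in> C" "(\<integral>x. max 0 (s * (\<Sum>j\<in>B. V (x, y j))) \<partial>M) \<le> s * (\<Sum>j\<in>B. h S (y j)) + (\<Sum>j\<in>B. d (y j))"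
        unfolding h_def d_def using CV[OF s, of B y] finite_subset[OF B J] B yj by blast
      \<comment> \<open>The roles are now exchanged: with \<open>S\<close> fixed, omitting the
        columns of negative contribution replaces the set \<open>B\<close> by positive
        parts.\<close>
      have "s * (\<Sum>j\<in>B. h S (y j)) \<le> (\<Sum>j\<in>B. max 0 (s * h S (y j)))"
        unfolding sum_distrib_left by (intro sum_mono) auto
      also have "\<dots> \<le> (\<Sum>j\<in>J. max 0 (s * h S (y j)))"
        using J B by (intro sum_mono2) auto
      also have "\<dots> \<le> G y"
        unfolding G_def using s S C by (intro Max_ge image_eqI[of _ _ "(s, S)"]) auto
      finally have "s * (\<Sum>j\<in>B. h S (y j)) \<le> G y" .
      moreover have "(\<Sum>j\<in>B. d (y j)) \<le> (\<Sum>j\<in>J. d (y j))"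
        using J B by (intro sum_mono2) (auto simp: d_def)
      ultimately show "(\<integral>x. max 0 (s * (\<Sum>j\<in>B. V (x, y j))) \<partial>M) \<le> G y + (\<Sum>j\<in>J. d (y j))"
        using S(2) by linarith
    qed (use J in \<open>simp_all add: Pow_not_empty\<close>)
    show "integrable ?P F"
    proof (rule Bochner_Integration.integrable_bound[OF GD])
      show "F \<in> borel_measurable ?P"
      proof -
        have "(\<lambda>y. \<integral>x. max 0 (fst t * (\<Sum>j\<in>snd t. V (x, y j))) \<partial>M) \<in> borel_measurable ?P"
          if t: "t \<in> {- 1, 1} \<times> Pow J" for t :: "real \<times> _"
        proof -
          have [measurable]: "(\<lambda>y. y j) \<in> ?P \<rightarrow>\<^sub>M M" if "j \<in> snd t" for j
            using t that by (intro measurable_component_singleton) auto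
          show ?thesis by measurable
        qed
        then show ?thesis unfolding F_def case_prod_unfold using J by (intro borel_measurable_Max) auto
      qed
      have F0: "0 \<le> F y" for y
        unfolding F_def using J by (intro Max_ge_iff[THEN iffD2]) (auto simp: Pow_not_empty intro!: bexI[of _ "(1, {})"])
      show "AE y in ?P. norm (F y) \<le> norm (G y + (\<Sum>j\<in>J. d (y j)))"
        using le F0 by (intro AE_I2) (smt (verit) real_norm_def)
    qed
  qed
  also have "\<dots> = (\<integral>y. G y \<partial>?P) + card J * (\<integral>y. d y \<partial>M)"
  proof -
    have dj: "integrable ?P (\<lambda>y. d (y j))" "(\<integral>y. d (y j) \<partial>?P) = (\<integral>y. d y \<partial>M)" if "j \<in> J" for j
      using that iid_component_integrable[OF that d_int] iid_component_integral[OF that borel_measurable_integrable[OF d_int]]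
      by auto
    have "(\<integral>y. G y + (\<Sum>j\<in>J. d (y j)) \<partial>?P) = (\<integral>y. G y \<partial>?P) + (\<integral>y. (\<Sum>j\<in>J. d (y j)) \<partial>?P)"
      using G_int dj(1) by (intro Bochner_Integration.integral_add) auto
    also have "(\<integral>y. (\<Sum>j\<in>J. d (y j)) \<partial>?P) = card J * (\<integral>y. d y \<partial>M)"
      using dj by (subst Bochner_Integration.integral_sum) auto
    finally show ?thesis .
  qed
  also have "(\<integral>y. G y \<partial>?P) \<le> card J * c + (card J * (\<integral>x. (\<integral>y. (V (x, y))\<^sup>2 \<partial>M) \<partial>M) / l + l)"
    unfolding G_def h_def
  proof (rule contraction_integrals[where V = V, OF J l C _ V])
    show "(\<integral>y. max 0 (s * (\<integral>x. indicator S x * V (x, y) \<partial>M)) \<partial>M) \<le> c" if "s \<in> {- 1, 1}" "S \<in> C" for s S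
      using that C by (intro mean_positive_part_le_cut[where V = V, OF _ _ _ V cut]) auto
  qed auto
  also have "card J * (\<integral>y. d y \<partial>M) \<le> card J * \<delta>"
    using d_le by (intro mult_left_mono) auto
  also have "card J * \<delta> \<le> e"
    using e by (simp add: \<delta>_def field_simps)
  finally show "(\<integral>y. (MAX (s, B)\<in>{- 1, 1} \<times> Pow J. \<integral>x. max 0 (s * (\<Sum>j\<in>B. V (x, y j))) \<partial>M) \<partial>?P)
    \<le> card J * c + (card J * (\<integral>x. (\<integral>y. (V (x, y))\<^sup>2 \<partial>M) \<partial>M) / l + l) + e"
    by (simp add: F_def)
qed

text \<open>With the columns frozen, the row points are treated by
  \<open>contraction_finite_combinations\<close>, which leaves the largest mean positive part
  \<open>F y\<close> as main term; \<open>mean_max_positive_part\<close> then integrates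
  \<open>F\<close> over the columns. Each of the two steps contributes one second-moment term,
  whence the factor 2, and the remainders are \<open>card J * l\<close> and
  \<open>card I * l\<close>.\<close>

lemma mean_bipartite_cut_le:
  fixes V :: "'a \<times> 'a \<Rightarrow> real" and I J :: "'i set" and K l c :: real
  assumes I: "finite I" and J: "finite J" and IJ: "I \<inter> J = {}" and l: "l > 0"
    and [measurable]: "V \<in> borel_measurable (M \<Otimes>\<^sub>M M)"
    and V: "\<And>x y. x \<in> space M \<Longrightarrow> y \<in> space M \<Longrightarrow> \<bar>V (x, y)\<bar> \<le> K"
    and cut: "\<And>S T. S \<in> sets M \<Longrightarrow> T \<in> sets M \<Longrightarrow> \<bar>\<integral>z. indicator (S \<times> T) z * V z \<partial>(M \<Otimes>\<^sub>M M)\<bar> \<le> c"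
  shows "(\<integral>x. (MAX (A, B)\<in>Pow I \<times> Pow J. \<bar>\<Sum>i\<in>A. \<Sum>j\<in>B. V (x i, x j)\<bar>) \<partial>iid M (I \<union> J))
    \<le> card I * card J * c + 2 * card I * card J * (\<integral>x. (\<integral>y. (V (x, y))\<^sup>2 \<partial>M) \<partial>M) / l + (card I + card J) * l"
proof -
  let ?PI = "iid M I" and ?PJ = "iid M J" and ?P = "iid M (I \<union> J)"
  interpret MM: pair_prob_space M M ..
  interpret PI: prob_space ?PI by (rule prob_space_iid)
  interpret PJ: prob_space ?PJ by (rule prob_space_iid)
  interpret P: prob_space ?P by (rule prob_space_iid)
  interpret PJI: pair_prob_space ?PJ ?PI ..
  interpret product_sigma_finite "\<lambda>_::'i. M" by unfold_locales
  define Q where "Q = (\<integral>x. (\<integral>y. (V (x, y))\<^sup>2 \<partial>M) \<partial>M)"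
  have K0: "K \<ge> 0" using V not_empty by (metis abs_ge_zero equals0I order.trans)
  define f where "f x = (MAX (A, B)\<in>Pow I \<times> Pow J. \<bar>\<Sum>i\<in>A. \<Sum>j\<in>B. V (x i, x j)\<bar>)" for x
  \<comment> \<open>Outside \<open>J\<close> the value \<open>y j\<close> need not lie in
    \<open>space M\<close>; the default 0 keeps \<open>u y j\<close> measurable and bounded for
    every \<open>j\<close>.\<close>
  define u where "u y j x = (if j \<in> J then V (x, y j) else 0)" for y j x
  define G where "G y x = (MAX (s, B)\<in>{- 1, 1} \<times> Pow J. \<Sum>i\<in>I. max 0 (s * (\<Sum>j\<in>B. u y j (x i))))" for y and x :: "'i \<Rightarrow> 'a"
  define F where "F y = (MAX (s, B)\<in>{- 1, 1} \<times> Pow J. \<integral>x. max 0 (s * (\<Sum>j\<in>B. V (x, y j))) \<partial>M)" for y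
  have fin: "finite ({- 1, 1 :: real} \<times> Pow J)" "{- 1, 1 :: real} \<times> Pow J \<noteq> {}"
    using J by (simp_all add: Pow_not_empty)
  have u_meas [measurable]: "(\<lambda>w. u (fst w) j (snd w i)) \<in> borel_measurable (?PJ \<Otimes>\<^sub>M ?PI)" if "i \<in> I" for i j
    using that unfolding u_def by (cases "j \<in> J") simp_all
  have u_meas2 [measurable]: "(\<lambda>w. u (fst w) j (snd w)) \<in> borel_measurable (?PJ \<Otimes>\<^sub>M M)" for j
    unfolding u_def by (cases "j \<in> J") simp_all
  have u_bdd: "\<bar>u y j x\<bar> \<le> K" if "y \<in> space ?PJ" "x \<in> space M" for y j x
    using V[OF that(2) iid_component_space[OF that(1)]] K0 by (auto simp: u_def)
  have usum_bdd: "\<bar>max 0 (s * (\<Sum>j\<in>B. u y j x))\<bar> \<le> card J * K"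
    if "s \<in> {- 1, 1}" "B \<subseteq> J" "y \<in> space ?PJ" "x \<in> space M" for s B y x
  proof -
    have "\<bar>max 0 (s * (\<Sum>j\<in>B. u y j x))\<bar> \<le> \<bar>\<Sum>j\<in>B. u y j x\<bar>" using that(1) by auto
    also have "\<dots> \<le> (\<Sum>j\<in>B. \<bar>u y j x\<bar>)" by (rule sum_abs)
    also have "\<dots> \<le> (\<Sum>j\<in>J. \<bar>u y j x\<bar>)" using J that(2) by (intro sum_mono2) auto
    also have "\<dots> \<le> card J * K" using u_bdd[OF that(3,4)] by (intro sum_bounded_above) auto
    finally show ?thesis .
  qed
  have f_int: "integrable ?P f"
    unfolding f_def using I J V by (intro max_rectangle_sum_integrable[where V = V]) auto
  have G_meas [measurable]: "case_prod G \<in> borel_measurable (?PJ \<Otimes>\<^sub>M ?PI)"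
    unfolding G_def case_prod_unfold using fin by measurable
  have G_bdd: "\<bar>G y x\<bar> \<le> (\<Sum>t\<in>{- 1, 1 :: real} \<times> Pow J. card I * (card J * K))"
    if "y \<in> space ?PJ" "x \<in> space ?PI" for y x
  proof -
    have "\<bar>\<Sum>i\<in>I. max 0 (fst t * (\<Sum>j\<in>snd t. u y j (x i)))\<bar> \<le> card I * (card J * K)" if "t \<in> {- 1, 1} \<times> Pow J" for t
      using that usum_bdd[of "fst t" "snd t", OF _ _ \<open>y \<in> space ?PJ\<close>]
      by (intro iid_sum_bounded[OF _ \<open>x \<in> space ?PI\<close>]) auto
    then show ?thesis
      unfolding G_def case_prod_unfold using fin
      by (intro order.trans[OF Max_image_bounded] sum_mono) auto
  qed
  have G_int: "integrable (?PJ \<Otimes>\<^sub>M ?PI) (case_prod G)"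
    using G_bdd by (intro PJI.integrable_bounded) (auto simp: space_pair_measure)
  have F_meas: "F \<in> borel_measurable ?PJ"
  proof -
    have "(\<lambda>y. \<integral>x. max 0 (fst t * (\<Sum>j\<in>snd t. V (x, y j))) \<partial>M) \<in> borel_measurable ?PJ"
      if t: "t \<in> {- 1, 1} \<times> Pow J" for t :: "real \<times> _"
    proof -
      have [measurable]: "(\<lambda>y. y j) \<in> ?PJ \<rightarrow>\<^sub>M M" if "j \<in> snd t" for j
        using t that by (intro measurable_component_singleton) auto
      show ?thesis by measurable
    qed
    then show ?thesis unfolding F_def case_prod_unfold using fin by (intro borel_measurable_Max) auto
  qed
  have uV: "(\<Sum>j\<in>B. u y j x) = (\<Sum>j\<in>B. V (x, y j))" if "B \<subseteq> J" for B y x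
    using that by (intro sum.cong) (auto simp: u_def)
  have mx_int: "integrable M (\<lambda>x. max 0 (s * (\<Sum>j\<in>B. u y j x)))"
    if "s \<in> {- 1, 1}" "B \<subseteq> J" "y \<in> space ?PJ" for s B y
  proof (rule integrable_bounded[where K = "card J * K"])
    show "(\<lambda>x. max 0 (s * (\<Sum>j\<in>B. u y j x))) \<in> borel_measurable M"
      using measurable_compose[OF measurable_Pair1' u_meas2] that(3) by simp
  qed (rule usum_bdd[OF that])
  have F_bdd: "\<bar>F y\<bar> \<le> (\<Sum>t\<in>{- 1, 1 :: real} \<times> Pow J. card J * K)" if y: "y \<in> space ?PJ" for y
  proof -
    have "\<bar>\<integral>x. max 0 (fst t * (\<Sum>j\<in>snd t. V (x, y j))) \<partial>M\<bar> \<le> card J * K" if t: "t \<in> {- 1, 1} \<times> Pow J" for t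
    proof -
      have "\<bar>\<integral>x. max 0 (fst t * (\<Sum>j\<in>snd t. V (x, y j))) \<partial>M\<bar> = \<bar>\<integral>x. max 0 (fst t * (\<Sum>j\<in>snd t. u y j x)) \<partial>M\<bar>"
        using t by (subst uV) auto
      also have "\<dots> \<le> (\<integral>x. \<bar>max 0 (fst t * (\<Sum>j\<in>snd t. u y j x))\<bar> \<partial>M)" by (rule integral_abs_bound)
      also have "\<dots> \<le> (\<integral>x. card J * K \<partial>M)"
        using t y by (intro integral_mono integrable_abs mx_int usum_bdd integrable_const) auto
      finally show ?thesis by (simp add: prob_space)
    qed
    then show ?thesis
      unfolding F_def case_prod_unfold using fin
      by (intro order.trans[OF Max_image_bounded] sum_mono) auto
  qed
  have F_int: "integrable ?PJ F"
    by (rule PJ.integrable_bounded[OF F_meas F_bdd])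
  define q where "q y = (\<integral>x. (V (x, y))\<^sup>2 \<partial>M)" for y
  note V2 = bounded_kernel_integrable(2)[OF assms(5) V]
  have q_int: "integrable M q"
    unfolding q_def using MM.integrable_snd[of "\<lambda>x y. (V (x, y))\<^sup>2"] V2 by (simp add: split_beta')
  have q_Q: "(\<integral>y. q y \<partial>M) = Q"
    unfolding q_def Q_def using MM.Fubini_integral[of "\<lambda>x y. (V (x, y))\<^sup>2"] V2 by (simp add: split_beta')
  \<comment> \<open>Since \<open>I\<close> and \<open>J\<close> are disjoint, rows and columns are
    independent, and the rows can be integrated first.\<close>
  have "(\<integral>x. f x \<partial>?P) = (\<integral>y. (\<integral>x. f (merge J I (y, x)) \<partial>?PI) \<partial>?PJ)"
    using product_integral_fold[of J I f] I J IJ f_int by (simp add: Un_commute Int_commute)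
  also have "\<dots> \<le> (\<integral>y. card I * F y + (\<Sum>j\<in>J. card I * q (y j) / l + l) \<partial>?PJ)"
  proof (rule integral_mono)
    have merge_int: "integrable (?PJ \<Otimes>\<^sub>M ?PI) (\<lambda>w. f (merge J I w))"
      using integrable_distr[OF measurable_merge[of J I "\<lambda>_. M"], of f] distr_merge[of J I] I J IJ f_int
      by (simp add: Un_commute Int_commute)
    then show "integrable ?PJ (\<lambda>y. \<integral>x. f (merge J I (y, x)) \<partial>?PI)"
      by (rule PJI.integrable_fst')
    show "integrable ?PJ (\<lambda>y. card I * F y + (\<Sum>j\<in>J. card I * q (y j) / l + l))"
      using F_int iid_component_integrable[OF _ q_int]
      by (intro Bochner_Integration.integrable_add integrable_mult_right Bochner_Integration.integrable_sum integrable_divide) auto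
    fix y assume y: "y \<in> space ?PJ"
    have Gx: "integrable ?PI (G y)"
      using G_bdd[OF y] measurable_compose[OF measurable_Pair1'[OF y] G_meas] by (intro PI.integrable_bounded) auto
    have le: "f (merge J I (y, x)) \<le> G y x" for x
      unfolding f_def
    proof (rule Max.boundedI; (elim imageE, clarify)?)
      fix A B assume A: "A \<subseteq> I" and B: "B \<subseteq> J"
      let ?m = "merge J I (y, x)"
      have m: "(\<Sum>i\<in>A. \<Sum>j\<in>B. V (?m i, ?m j)) = (\<Sum>i\<in>A. \<Sum>j\<in>B. u y j (x i))"
        using A B IJ by (intro sum.cong refl) (auto simp: merge_def u_def)
      obtain s :: real where s: "s \<in> {- 1, 1}" "\<bar>\<Sum>i\<in>A. \<Sum>j\<in>B. u y j (x i)\<bar> = s * (\<Sum>i\<in>A. \<Sum>j\<in>B. u y j (x i))"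
        using abs_eq_sign_mult by blast
      have "\<bar>\<Sum>i\<in>A. \<Sum>j\<in>B. V (?m i, ?m j)\<bar> = (\<Sum>i\<in>A. s * (\<Sum>j\<in>B. u y j (x i)))"
        by (simp only: m s(2) sum_distrib_left)
      also have "\<dots> \<le> (\<Sum>i\<in>A. max 0 (s * (\<Sum>j\<in>B. u y j (x i))))"
        by (intro sum_mono) auto
      also have "\<dots> \<le> (\<Sum>i\<in>I. max 0 (s * (\<Sum>j\<in>B. u y j (x i))))"
        using I A by (intro sum_mono2) auto
      also have "\<dots> \<le> G y x"
        unfolding G_def using s(1) B fin by (intro Max_ge image_eqI[of _ _ "(s, B)"]) auto
      finally show "\<bar>\<Sum>i\<in>A. \<Sum>j\<in>B. V (?m i, ?m j)\<bar> \<le> G y x" .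
    qed (use I J in \<open>simp_all add: Pow_not_empty\<close>)
    have "(\<integral>x. f (merge J I (y, x)) \<partial>?PI) \<le> (\<integral>x. G y x \<partial>?PI)"
    proof (rule integral_mono[OF _ Gx le])
      show "integrable ?PI (\<lambda>x. f (merge J I (y, x)))"
      proof (rule Bochner_Integration.integrable_bound[OF Gx])
        show "(\<lambda>x. f (merge J I (y, x))) \<in> borel_measurable ?PI"
          using measurable_compose[OF measurable_Pair1'[OF y] borel_measurable_integrable[OF merge_int]] by simp
        have f0: "0 \<le> f x" for x
          unfolding f_def using I J by (intro Max_ge_iff[THEN iffD2]) (auto simp: Pow_not_empty)
        show "AE x in ?PI. norm (f (merge J I (y, x))) \<le> norm (G y x)"
          using le f0 by (intro AE_I2) (smt (verit) real_norm_def)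
      qed
    qed
    also have "\<dots> \<le> card I * F y + (\<Sum>j\<in>J. card I * (\<integral>x. (u y j x)\<^sup>2 \<partial>M) / l + l)"
      unfolding G_def
    proof (rule contraction_finite_combinations[OF I J l])
      show "u y j \<in> borel_measurable M" for j
        using measurable_compose[OF measurable_Pair1'[OF y] u_meas2[of j]] by simp
      show "\<bar>u y j x\<bar> \<le> K" if "x \<in> space M" for j x
        by (rule u_bdd[OF y that])
      fix s :: real and B assume s: "s \<in> {- 1, 1}" and B: "B \<subseteq> J"
      show "(\<integral>x. max 0 (s * (\<Sum>j\<in>B. u y j x)) \<partial>M) \<le> F y"
        unfolding F_def uV[OF B] using s B fin by (intro Max_ge image_eqI[of _ _ "(s, B)"]) auto
    qed
    also have "(\<Sum>j\<in>J. card I * (\<integral>x. (u y j x)\<^sup>2 \<partial>M) / l + l) = (\<Sum>j\<in>J. card I * q (y j) / l + l)"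
      by (intro sum.cong refl) (simp add: u_def q_def)
    finally show "(\<integral>x. f (merge J I (y, x)) \<partial>?PI) \<le> card I * F y + (\<Sum>j\<in>J. card I * q (y j) / l + l)" .
  qed
  also have "\<dots> = card I * (\<integral>y. F y \<partial>?PJ) + card J * (card I * Q / l + l)"
  proof -
    have qj: "integrable ?PJ (\<lambda>y. q (y j))" "(\<integral>y. q (y j) \<partial>?PJ) = Q" if "j \<in> J" for j
      using that iid_component_integrable[OF that q_int] iid_component_integral[OF that borel_measurable_integrable[OF q_int]] q_Q
      by auto
    have qj': "integrable ?PJ (\<lambda>y. card I * q (y j) / l + l)" if "j \<in> J" for j
      using qj(1)[OF that] by auto
    have "(\<integral>y. card I * F y + (\<Sum>j\<in>J. card I * q (y j) / l + l) \<partial>?PJ)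
        = (\<integral>y. card I * F y \<partial>?PJ) + (\<integral>y. (\<Sum>j\<in>J. card I * q (y j) / l + l) \<partial>?PJ)"
      using F_int qj' by (intro Bochner_Integration.integral_add) auto
    also have "(\<integral>y. (\<Sum>j\<in>J. card I * q (y j) / l + l) \<partial>?PJ) = (\<Sum>j\<in>J. \<integral>y. card I * q (y j) / l + l \<partial>?PJ)"
      using qj' by (intro Bochner_Integration.integral_sum) auto
    also have "\<dots> = (\<Sum>j\<in>J. card I * Q / l + l)"
      using qj by (intro sum.cong refl) (simp add: PJ.prob_space)
    finally show ?thesis by simp
  qed
  also have "card I * (\<integral>y. F y \<partial>?PJ) \<le> card I * (card J * c + (card J * Q / l + l))"
    unfolding F_def Q_def by (intro mult_left_mono mean_max_positive_part[where V = V, OF J l _ V cut]) auto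
  finally show ?thesis
    by (simp add: f_def Q_def algebra_simps add_divide_distrib)
qed

end

section \<open>Maximal cuts of matrices\<close>

definition cut_max :: "'i set \<Rightarrow> ('i \<Rightarrow> 'i \<Rightarrow> real) \<Rightarrow> real" where
  "cut_max K a = (MAX (A, B)\<in>Pow K \<times> Pow K. \<bar>\<Sum>i\<in>A. \<Sum>j\<in>B. a i j\<bar>)"

lemma cut_max_upper: "finite K \<Longrightarrow> A \<subseteq> K \<Longrightarrow> B \<subseteq> K \<Longrightarrow> \<bar>\<Sum>i\<in>A. \<Sum>j\<in>B. a i j\<bar> \<le> cut_max K a"
  unfolding cut_max_def by (intro Max_ge image_eqI[of _ _ "(A, B)"]) auto

lemma cut_max_least:
  assumes "finite K" "\<And>A B. A \<subseteq> K \<Longrightarrow> B \<subseteq> K \<Longrightarrow> \<bar>\<Sum>i\<in>A. \<Sum>j\<in>B. a i j\<bar> \<le> c"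
  shows "cut_max K a \<le> c"
  unfolding cut_max_def using assms by (intro Max.boundedI) (auto simp: Pow_not_empty)

lemma cut_max_nonneg: "finite K \<Longrightarrow> 0 \<le> cut_max K a"
  using cut_max_upper[of K "{}" "{}" a] by simp

lemma cut_max_mono: "finite L \<Longrightarrow> K \<subseteq> L \<Longrightarrow> cut_max K a \<le> cut_max L a"
  by (meson cut_max_least cut_max_upper finite_subset order_trans)

lemma cut_max_empty [simp]: "cut_max {} a = 0"
  by (simp add: cut_max_def)

lemma cut_max_zero: "finite K \<Longrightarrow> cut_max K (\<lambda>_ _. 0) = 0"
  by (intro order.antisym cut_max_nonneg cut_max_least) auto

lemma cut_max_cong:
  assumes "\<And>i j. i \<in> K \<Longrightarrow> j \<in> K \<Longrightarrow> a i j = b i j"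
  shows "cut_max K a = cut_max K b"
proof -
  have "(\<Sum>i\<in>A. \<Sum>j\<in>B. a i j) = (\<Sum>i\<in>A. \<Sum>j\<in>B. b i j)" if "A \<subseteq> K" "B \<subseteq> K" for A B
    using assms that by (intro sum.cong) auto
  then show ?thesis
    unfolding cut_max_def by (intro arg_cong[where f = Max] image_cong) auto
qed

lemma cut_max_diff_le:
  assumes "finite K"
  shows "cut_max K a \<le> cut_max K b + (\<Sum>i\<in>K. \<Sum>j\<in>K. \<bar>a i j - b i j\<bar>)"
proof (rule cut_max_least[OF assms])
  fix A B assume AB: "A \<subseteq> K" "B \<subseteq> K"
  have "(\<Sum>i\<in>A. \<Sum>j\<in>B. a i j) = (\<Sum>i\<in>A. \<Sum>j\<in>B. b i j) + (\<Sum>i\<in>A. \<Sum>j\<in>B. a i j - b i j)"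
    by (simp add: sum_subtractf)
  then have "\<bar>\<Sum>i\<in>A. \<Sum>j\<in>B. a i j\<bar> \<le> \<bar>\<Sum>i\<in>A. \<Sum>j\<in>B. b i j\<bar> + \<bar>\<Sum>i\<in>A. \<Sum>j\<in>B. a i j - b i j\<bar>"
    by simp
  also have "\<bar>\<Sum>i\<in>A. \<Sum>j\<in>B. a i j - b i j\<bar> \<le> (\<Sum>i\<in>A. \<Sum>j\<in>B. \<bar>a i j - b i j\<bar>)"
    by (intro order.trans[OF sum_abs] sum_mono sum_abs)
  also have "\<dots> \<le> (\<Sum>i\<in>A. \<Sum>j\<in>K. \<bar>a i j - b i j\<bar>)"
    using assms AB by (intro sum_mono sum_mono2) auto
  also have "\<dots> \<le> (\<Sum>i\<in>K. \<Sum>j\<in>K. \<bar>a i j - b i j\<bar>)"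
    using assms AB by (intro sum_mono2 sum_nonneg) auto
  also have "\<bar>\<Sum>i\<in>A. \<Sum>j\<in>B. b i j\<bar> \<le> cut_max K b"
    using assms AB by (rule cut_max_upper)
  finally show "\<bar>\<Sum>i\<in>A. \<Sum>j\<in>B. a i j\<bar> \<le> cut_max K b + (\<Sum>i\<in>K. \<Sum>j\<in>K. \<bar>a i j - b i j\<bar>)"
    by simp
qed

text \<open>Erasing all entries that meet \<open>D\<close> changes a rectangle sum by at most their
  absolute sum. Entries with both indices in \<open>D\<close> are counted twice on the right-hand
  side.\<close>

lemma cut_max_remove_le:
  assumes K: "finite K" and D: "D \<subseteq> K"
  shows "cut_max K a \<le> cut_max (K - D) a + (\<Sum>i\<in>D. \<Sum>j\<in>K. \<bar>a i j\<bar> + \<bar>a j i\<bar>)"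
proof -
  define b where "b i j = (if i \<in> D \<or> j \<in> D then 0 else a i j)" for i j
  have "cut_max K a \<le> cut_max K b + (\<Sum>i\<in>K. \<Sum>j\<in>K. \<bar>a i j - b i j\<bar>)"
    by (rule cut_max_diff_le[OF K])
  also have "(\<Sum>i\<in>K. \<Sum>j\<in>K. \<bar>a i j - b i j\<bar>)
      \<le> (\<Sum>i\<in>K. \<Sum>j\<in>K. (if i \<in> D then \<bar>a i j\<bar> else 0) + (if j \<in> D then \<bar>a i j\<bar> else 0))"
    by (intro sum_mono) (auto simp: b_def)
  also have "\<dots> = (\<Sum>i\<in>D. \<Sum>j\<in>K. \<bar>a i j\<bar>) + (\<Sum>j\<in>D. \<Sum>i\<in>K. \<bar>a i j\<bar>)"
  proof -
    have "(\<Sum>i\<in>K. \<Sum>j\<in>K. if i \<in> D then \<bar>a i j\<bar> else 0) = (\<Sum>i\<in>K. if i \<in> D then \<Sum>j\<in>K. \<bar>a i j\<bar> else 0)"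
      by (intro sum.cong) auto
    also have "\<dots> = (\<Sum>i\<in>D. \<Sum>j\<in>K. \<bar>a i j\<bar>)"
      using D by (simp add: sum.inter_restrict[OF K, symmetric] Int_absorb1)
    finally have 1: "(\<Sum>i\<in>K. \<Sum>j\<in>K. if i \<in> D then \<bar>a i j\<bar> else 0) = (\<Sum>i\<in>D. \<Sum>j\<in>K. \<bar>a i j\<bar>)" .
    have "(\<Sum>i\<in>K. \<Sum>j\<in>K. if j \<in> D then \<bar>a i j\<bar> else 0) = (\<Sum>i\<in>K. \<Sum>j\<in>D. \<bar>a i j\<bar>)"
      using D by (simp add: sum.inter_restrict[OF K, symmetric] Int_absorb1)
    also have "\<dots> = (\<Sum>j\<in>D. \<Sum>i\<in>K. \<bar>a i j\<bar>)" by (rule sum.swap)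
    finally show ?thesis using 1 by (simp add: sum.distrib)
  qed
  also have "\<dots> = (\<Sum>i\<in>D. \<Sum>j\<in>K. \<bar>a i j\<bar> + \<bar>a j i\<bar>)"
    by (simp add: sum.distrib)
  also have "cut_max K b \<le> cut_max (K - D) a"
  proof (rule cut_max_least[OF K])
    fix A B assume AB: "A \<subseteq> K" "B \<subseteq> K"
    have fin: "finite A" "finite B" using AB K finite_subset by auto
    have "(\<Sum>i\<in>A. \<Sum>j\<in>B. b i j) = (\<Sum>i\<in>A - D. \<Sum>j\<in>B. b i j)"
      using fin by (intro sum.mono_neutral_right) (auto simp: b_def)
    also have "\<dots> = (\<Sum>i\<in>A - D. \<Sum>j\<in>B - D. b i j)"
      using fin by (intro sum.cong refl sum.mono_neutral_right) (auto simp: b_def)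
    also have "\<dots> = (\<Sum>i\<in>A - D. \<Sum>j\<in>B - D. a i j)"
      by (intro sum.cong refl) (auto simp: b_def)
    finally show "\<bar>\<Sum>i\<in>A. \<Sum>j\<in>B. b i j\<bar> \<le> cut_max (K - D) a"
      using cut_max_upper[of "K - D" "A - D" "B - D" a] K AB by auto
  qed
  finally show ?thesis by simp
qed

section \<open>Decoupling by averaging over bipartitions\<close>

lemma card_separating_subsets:
  assumes K: "finite K" and ij: "i \<in> K" "j \<in> K" "i \<noteq> j"
  shows "4 * card {I \<in> Pow K. i \<in> I \<and> j \<notin> I} = 2 ^ card K"
proof -
  \<comment> \<open>All indices other than \<open>i\<close> and \<open>j\<close> are free, which
    leaves a quarter of the subsets: the origin of the factor 4.\<close>
  have "{I \<in> Pow K. i \<in> I \<and> j \<notin> I} = insert i ` Pow (K - {i, j})"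
  proof (intro equalityI subsetI)
    fix I assume "I \<in> {I \<in> Pow K. i \<in> I \<and> j \<notin> I}"
    then show "I \<in> insert i ` Pow (K - {i, j})"
      by (intro image_eqI[of _ _ "I - {i}"]) auto
  qed (use ij in auto)
  moreover have "inj_on (insert i) (Pow (K - {i, j}))"
    by (auto simp: inj_on_def)
  ultimately have "card {I \<in> Pow K. i \<in> I \<and> j \<notin> I} = 2 ^ card (K - {i, j})"
    using K by (simp add: card_image card_Pow)
  moreover have "card K = 2 + card (K - {i, j})"
    using K ij by (subst card_Diff_subset) (auto simp: card_gt_0_iff Suc_le_eq[symmetric]
        intro: card_mono[of K "{i, j}", simplified] dest: card_mono[of K "{i, j}"])
  ultimately show ?thesis by (simp add: power_add)
qed

text \<open>An off-diagonal pair is counted by exactly a quarter of the bipartitions. A diagonal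
  pair is never separated, which is why the diagonal has to vanish.\<close>

lemma decoupling_identity:
  fixes a :: "'i \<Rightarrow> 'i \<Rightarrow> real"
  assumes K: "finite K" and AB: "A \<subseteq> K" "B \<subseteq> K" and diag: "\<And>i. a i i = 0"
  shows "2 ^ card K * (\<Sum>i\<in>A. \<Sum>j\<in>B. a i j) = 4 * (\<Sum>I\<in>Pow K. \<Sum>i\<in>A \<inter> I. \<Sum>j\<in>B - I. a i j)"
proof -
  have fin: "finite A" "finite B" using AB K finite_subset by auto
  have "4 * (\<Sum>I\<in>Pow K. \<Sum>i\<in>A \<inter> I. \<Sum>j\<in>B - I. a i j)
      = 4 * (\<Sum>I\<in>Pow K. \<Sum>i\<in>A. \<Sum>j\<in>B. of_bool (i \<in> I \<and> j \<notin> I) * a i j)"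
  proof (rule arg_cong[where f = "(*) 4"], rule sum.cong[OF refl])
    fix I
    have "(\<Sum>i\<in>A. \<Sum>j\<in>B. of_bool (i \<in> I \<and> j \<notin> I) * a i j) = (\<Sum>i\<in>A \<inter> I. \<Sum>j\<in>B. of_bool (i \<in> I \<and> j \<notin> I) * a i j)"
      using fin by (intro sum.mono_neutral_right) auto
    also have "\<dots> = (\<Sum>i\<in>A \<inter> I. \<Sum>j\<in>B - I. of_bool (i \<in> I \<and> j \<notin> I) * a i j)"
      using fin by (intro sum.cong refl sum.mono_neutral_right) auto
    also have "\<dots> = (\<Sum>i\<in>A \<inter> I. \<Sum>j\<in>B - I. a i j)"
      by (intro sum.cong refl) auto
    finally show "(\<Sum>i\<in>A \<inter> I. \<Sum>j\<in>B - I. a i j) = (\<Sum>i\<in>A. \<Sum>j\<in>B. of_bool (i \<in> I \<and> j \<notin> I) * a i j)" ..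
  qed
  also have "(\<Sum>I\<in>Pow K. \<Sum>i\<in>A. \<Sum>j\<in>B. of_bool (i \<in> I \<and> j \<notin> I) * a i j)
      = (\<Sum>i\<in>A. \<Sum>I\<in>Pow K. \<Sum>j\<in>B. of_bool (i \<in> I \<and> j \<notin> I) * a i j)"
    by (rule sum.swap)
  also have "\<dots> = (\<Sum>i\<in>A. \<Sum>j\<in>B. \<Sum>I\<in>Pow K. of_bool (i \<in> I \<and> j \<notin> I) * a i j)"
    by (intro sum.cong refl sum.swap)
  also have "4 * \<dots> = (\<Sum>i\<in>A. \<Sum>j\<in>B. (4 * card {I \<in> Pow K. i \<in> I \<and> j \<notin> I}) * a i j)"
  proof -
    have "(\<Sum>I\<in>Pow K. of_bool (i \<in> I \<and> j \<notin> I) * a i j) = card {I \<in> Pow K. i \<in> I \<and> j \<notin> I} * a i j" for i j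
      using K by (simp add: sum_distrib_right[symmetric] Int_def)
    then show ?thesis by (simp add: sum_distrib_left mult.assoc)
  qed
  also have "\<dots> = (\<Sum>i\<in>A. \<Sum>j\<in>B. 2 ^ card K * a i j)"
  proof (intro sum.cong refl)
    fix i j assume "i \<in> A" "j \<in> B"
    then show "(4 * card {I \<in> Pow K. i \<in> I \<and> j \<notin> I}) * a i j = 2 ^ card K * a i j"
      using card_separating_subsets[OF K, of i j] AB diag by (cases "i = j") (auto simp: subset_eq simp flip: of_nat_mult)
  qed
  finally show ?thesis by (simp add: sum_distrib_left)
qed

lemma cut_max_decoupling:
  assumes K: "finite K" and diag: "\<And>i. a i i = 0"
  shows "2 ^ card K * cut_max K a \<le> 4 * (\<Sum>I\<in>Pow K. MAX (A, B)\<in>Pow I \<times> Pow (K - I). \<bar>\<Sum>i\<in>A. \<Sum>j\<in>B. a i j\<bar>)"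
proof -
  let ?S = "\<Sum>I\<in>Pow K. MAX (A, B)\<in>Pow I \<times> Pow (K - I). \<bar>\<Sum>i\<in>A. \<Sum>j\<in>B. a i j\<bar>"
  have "cut_max K a \<le> 4 * ?S / 2 ^ card K"
  proof (rule cut_max_least[OF K])
    fix A B assume AB: "A \<subseteq> K" "B \<subseteq> K"
    have "2 ^ card K * \<bar>\<Sum>i\<in>A. \<Sum>j\<in>B. a i j\<bar> = 4 * \<bar>\<Sum>I\<in>Pow K. \<Sum>i\<in>A \<inter> I. \<Sum>j\<in>B - I. a i j\<bar>"
      using arg_cong[OF decoupling_identity[where a = a, OF K AB diag], of abs]
      by (simp only: abs_mult abs_numeral power_abs)
    also have "\<dots> \<le> 4 * ?S"
    proof (rule mult_left_mono, rule order.trans[OF sum_abs sum_mono])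
      fix I assume I: "I \<in> Pow K"
      then have "finite I" using K finite_subset by auto
      then show "\<bar>\<Sum>i\<in>A \<inter> I. \<Sum>j\<in>B - I. a i j\<bar> \<le> (MAX (A, B)\<in>Pow I \<times> Pow (K - I). \<bar>\<Sum>i\<in>A. \<Sum>j\<in>B. a i j\<bar>)"
        using K AB by (intro Max_ge image_eqI[of _ _ "(A \<inter> I, B - I)"]) auto
    qed simp
    finally show "\<bar>\<Sum>i\<in>A. \<Sum>j\<in>B. a i j\<bar> \<le> 4 * ?S / 2 ^ card K"
      by (simp add: field_simps)
  qed
  then show ?thesis by (simp add: field_simps)
qed

text \<open>The decoupling identity for the matrix with ones off the diagonal. It compensates the
  factor 4 of \<open>cut_max_decoupling\<close>, so that the main term of the mean keeps the
  constant 1.\<close>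

lemma sum_card_bipartitions:
  assumes K: "finite K"
  shows "4 * (\<Sum>I\<in>Pow K. real (card I * card (K - I))) \<le> 2 ^ card K * (card K)\<^sup>2"
proof -
  define a :: "'a \<Rightarrow> 'a \<Rightarrow> real" where "a i j = of_bool (i \<noteq> j)" for i j
  have "4 * (\<Sum>I\<in>Pow K. real (card I * card (K - I))) = 4 * (\<Sum>I\<in>Pow K. \<Sum>i\<in>K \<inter> I. \<Sum>j\<in>K - I. a i j)"
  proof (intro arg_cong[where f = "(*) 4"] sum.cong refl)
    fix I assume I: "I \<in> Pow K"
    have "(\<Sum>i\<in>K \<inter> I. \<Sum>j\<in>K - I. a i j) = (\<Sum>i\<in>K \<inter> I. \<Sum>j\<in>K - I. 1)"
      by (intro sum.cong refl) (auto simp: a_def)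
    also have "\<dots> = real (card I * card (K - I))"
      using I by (simp add: Int_absorb1)
    finally show "real (card I * card (K - I)) = (\<Sum>i\<in>K \<inter> I. \<Sum>j\<in>K - I. a i j)" ..
  qed
  also have "\<dots> = 2 ^ card K * (\<Sum>i\<in>K. \<Sum>j\<in>K. a i j)"
    using decoupling_identity[OF K order.refl order.refl, of a] by (simp add: a_def)
  also have "\<dots> \<le> 2 ^ card K * (\<Sum>i\<in>K. \<Sum>j\<in>K. 1)"
    by (intro mult_left_mono sum_mono) (auto simp: a_def)
  finally show ?thesis by (simp add: power2_eq_square)
qed

text \<open>The price \<open>c\<close> per deleted index makes this function insensitive to any single row and column;
  it coincides with \<^const>\<open>cut_max\<close> as long as all row sums are at most \<open>c\<close>.\<close>

definition regularized_cut_max :: "'i set \<Rightarrow> real \<Rightarrow> ('i \<Rightarrow> 'i \<Rightarrow> real) \<Rightarrow> real" where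
  "regularized_cut_max K c a = (MIN D\<in>Pow K. cut_max (K - D) a + c * card D)"

lemma regularized_cut_max_le: "finite K \<Longrightarrow> D \<subseteq> K \<Longrightarrow> regularized_cut_max K c a \<le> cut_max (K - D) a + c * card D"
  unfolding regularized_cut_max_def by (intro Min_le) auto

lemma regularized_cut_max_greatest:
  fixes b c :: real
  shows "finite K \<Longrightarrow> (\<And>D. D \<subseteq> K \<Longrightarrow> b \<le> cut_max (K - D) a + c * card D) \<Longrightarrow> b \<le> regularized_cut_max K c a"
  unfolding regularized_cut_max_def by (intro Min.boundedI) (auto simp: Pow_not_empty)

lemma regularized_cut_max_nonneg: "finite K \<Longrightarrow> 0 \<le> c \<Longrightarrow> 0 \<le> regularized_cut_max K c a"
  by (intro regularized_cut_max_greatest add_nonneg_nonneg cut_max_nonneg) auto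

text \<open>Whatever set \<open>D\<close> is deleted, the price falls short of the lost row and
  column sums by at most their total excess over \<open>c\<close>. This excess vanishes when all
  these sums are at most \<open>c\<close>, and in general its mean can be bounded by a
  moment.\<close>

lemma cut_max_le_regularized:
  assumes K: "finite K"
  shows "cut_max K a \<le> regularized_cut_max K c a + (\<Sum>i\<in>K. max 0 ((\<Sum>j\<in>K. \<bar>a i j\<bar> + \<bar>a j i\<bar>) - c))"
proof -
  let ?r = "\<lambda>i. \<Sum>j\<in>K. \<bar>a i j\<bar> + \<bar>a j i\<bar>"
  have "cut_max K a - (\<Sum>i\<in>K. max 0 (?r i - c)) \<le> regularized_cut_max K c a"
  proof (rule regularized_cut_max_greatest[OF K])
    fix D assume D: "D \<subseteq> K"
    have "(\<Sum>i\<in>D. ?r i) = (\<Sum>i\<in>D. ?r i - c) + c * card D"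
      by (simp add: sum_subtractf)
    also have "(\<Sum>i\<in>D. ?r i - c) \<le> (\<Sum>i\<in>D. max 0 (?r i - c))"
      by (intro sum_mono) auto
    also have "\<dots> \<le> (\<Sum>i\<in>K. max 0 (?r i - c))"
      using K D by (intro sum_mono2) auto
    finally show "cut_max K a - (\<Sum>i\<in>K. max 0 (?r i - c)) \<le> cut_max (K - D) a + c * card D"
      using cut_max_remove_le[OF K D, of a] by simp
  qed
  then show ?thesis by simp
qed

text \<open>A deleted set that competes for \<open>b\<close> is enlarged by \<open>i\<close>: on the
  remaining indices the two matrices agree, and the additional price is at most
  \<open>c\<close>.\<close>

lemma regularized_cut_max_Lipschitz:
  assumes K: "finite K" and c: "c \<ge> 0" and i: "i \<in> K"
    and eq: "\<And>j l. j \<noteq> i \<Longrightarrow> l \<noteq> i \<Longrightarrow> a j l = b j l"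
  shows "regularized_cut_max K c a \<le> regularized_cut_max K c b + c"
proof -
  have "regularized_cut_max K c a - c \<le> regularized_cut_max K c b"
  proof (rule regularized_cut_max_greatest[OF K])
    fix D assume D: "D \<subseteq> K"
    have "regularized_cut_max K c a \<le> cut_max (K - insert i D) a + c * card (insert i D)"
      using D i by (intro regularized_cut_max_le K) auto
    also have "cut_max (K - insert i D) a = cut_max (K - insert i D) b"
      by (intro cut_max_cong eq) auto
    also have "\<dots> \<le> cut_max (K - D) b"
      using K by (intro cut_max_mono) auto
    also have "c * card (insert i D) \<le> c * (card D + 1)"
      using c by (intro mult_left_mono) (auto simp: card_insert_le_m1 card_insert_if finite_subset[OF D K])
    finally show "regularized_cut_max K c a - c \<le> cut_max (K - D) b + c * card D"
      by (simp add: algebra_simps)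
  qed
  then show ?thesis by simp
qed

section \<open>Cuts of a sampled matrix\<close>

text \<open>The zero diagonal is that of the sample, and it is also the condition under which the
  matrix can be decoupled.\<close>

definition sample_matrix :: "('a \<times> 'a \<Rightarrow> real) \<Rightarrow> ('i \<Rightarrow> 'a) \<Rightarrow> 'i \<Rightarrow> 'i \<Rightarrow> real" where
  "sample_matrix V x i j = (if i = j then 0 else V (x i, x j))"

text \<open>Convexity on the positive half-line extends to 0, where the inequality reduces to
  \<open>t powr p \<le> t\<close>. The point 0 has to be included because entries of sampled
  matrices may vanish.\<close>

lemma convex_on_powr_nonneg:
  fixes p :: real
  assumes p: "p \<ge> 1"
  shows "convex_on {0..} (\<lambda>x. x powr p)"
proof (rule convex_on_linorderI)
  fix t x y :: real
  assume t: "0 < t" "t < 1" and xy: "x \<in> {0..}" "y \<in> {0..}" "x < y"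
  show "((1 - t) *\<^sub>R x + t *\<^sub>R y) powr p \<le> (1 - t) * x powr p + t * y powr p"
  proof (cases "x = 0")
    case True
    have "t powr p \<le> t" using p t powr_mono'[of 1 p t] by simp
    then show ?thesis using t xy unfolding True by (simp add: powr_mult)
  next
    case False
    show ?thesis using xy False t by (intro convex_onD[OF powr_convex[OF p]]) auto
  qed
qed (rule convex_real_interval)

lemma power_mean_le:
  fixes b :: "'i \<Rightarrow> real" and p :: real
  assumes "finite S" "S \<noteq> {}" "p \<ge> 1" "\<And>i. i \<in> S \<Longrightarrow> b i \<ge> 0"
  shows "((\<Sum>i\<in>S. b i) / card S) powr p \<le> (\<Sum>i\<in>S. b i powr p) / card S"
proof -
  have "(\<Sum>i\<in>S. (1 / card S) *\<^sub>R b i) powr p \<le> (\<Sum>i\<in>S. (1 / card S) * b i powr p)"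
    using assms by (intro convex_on_sum[OF _ _ convex_on_powr_nonneg]) auto
  then show ?thesis by (simp add: sum_divide_distrib)
qed

section \<open>Mean of the cut maximum of a sampled matrix\<close>

context prob_space
begin

lemma distr_iid_pair:
  assumes J: "i \<in> J" "j \<in> J" "i \<noteq> j"
  shows "distr (iid M J) (M \<Otimes>\<^sub>M M) (\<lambda>x. (x i, x j)) = M \<Otimes>\<^sub>M M"
proof (rule sym, rule pair_measure_eqI)
  interpret product_prob_space "\<lambda>_. M" J by unfold_locales
  fix A B assume AB: "A \<in> sets M" "B \<in> sets M"
  define E where "E l = (if l = i then A else B)" for l
  have "emeasure (iid M J) {x \<in> space (iid M J). \<forall>l\<in>{i, j}. x l \<in> E l} = (\<Prod>l\<in>{i, j}. emeasure M (E l))"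
    using J AB by (intro emeasure_PiM_Collect) (auto simp: E_def)
  moreover have "(\<lambda>x. (x i, x j)) -` (A \<times> B) \<inter> space (iid M J) = {x \<in> space (iid M J). \<forall>l\<in>{i, j}. x l \<in> E l}"
    using J by (auto simp: E_def)
  ultimately show "emeasure M A * emeasure M B = emeasure (distr (iid M J) (M \<Otimes>\<^sub>M M) (\<lambda>x. (x i, x j))) (A \<times> B)"
    using J AB by (subst emeasure_distr) (auto simp: E_def)
qed (auto intro: sigma_finite_measure_axioms)

lemma iid_pair_integral:
  fixes f :: "'a \<times> 'a \<Rightarrow> real"
  assumes J: "i \<in> J" "j \<in> J" "i \<noteq> j" and f: "integrable (M \<Otimes>\<^sub>M M) f"
  shows "integrable (iid M J) (\<lambda>x. f (x i, x j))"
    and "(\<integral>x. f (x i, x j) \<partial>iid M J) = (\<integral>z. f z \<partial>(M \<Otimes>\<^sub>M M))"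
proof -
  have [measurable]: "(\<lambda>x. x i) \<in> iid M J \<rightarrow>\<^sub>M M" "(\<lambda>x. x j) \<in> iid M J \<rightarrow>\<^sub>M M"
    using J by (auto intro: measurable_component_singleton)
  have fm [measurable]: "f \<in> borel_measurable (M \<Otimes>\<^sub>M M)"
    using f by (rule borel_measurable_integrable)
  have "integrable (distr (iid M J) (M \<Otimes>\<^sub>M M) (\<lambda>x. (x i, x j))) f"
    by (simp only: distr_iid_pair[OF J] f)
  then show "integrable (iid M J) (\<lambda>x. f (x i, x j))"
    by (subst (asm) integrable_distr_eq) auto
  have "(\<integral>z. f z \<partial>(M \<Otimes>\<^sub>M M)) = (\<integral>z. f z \<partial>distr (iid M J) (M \<Otimes>\<^sub>M M) (\<lambda>x. (x i, x j)))"
    by (simp only: distr_iid_pair[OF J])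
  also have "\<dots> = (\<integral>x. f (x i, x j) \<partial>iid M J)"
    by (subst integral_distr) auto
  finally show "(\<integral>x. f (x i, x j) \<partial>iid M J) = (\<integral>z. f z \<partial>(M \<Otimes>\<^sub>M M))" ..
qed

lemma sample_matrix_measurable [measurable]:
  assumes [measurable]: "V \<in> borel_measurable (M \<Otimes>\<^sub>M M)" and J: "i \<in> J" "j \<in> J"
  shows "(\<lambda>x. sample_matrix V x i j) \<in> borel_measurable (iid M J)"
proof -
  have [measurable]: "(\<lambda>x. x i) \<in> iid M J \<rightarrow>\<^sub>M M" "(\<lambda>x. x j) \<in> iid M J \<rightarrow>\<^sub>M M"
    using J by (auto intro: measurable_component_singleton)
  show ?thesis unfolding sample_matrix_def by measurable
qed

lemma sample_matrix_integrable:
  assumes "integrable (M \<Otimes>\<^sub>M M) V" "i \<in> J" "j \<in> J"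
  shows "integrable (iid M J) (\<lambda>x. sample_matrix V x i j)"
  using iid_pair_integral(1)[OF assms(2,3) _ assms(1)] by (cases "i = j") (auto simp: sample_matrix_def)

lemma cut_max_sample_measurable:
  assumes [measurable]: "V \<in> borel_measurable (M \<Otimes>\<^sub>M M)" and J: "finite J" "K \<subseteq> J"
  shows "(\<lambda>x. cut_max K (sample_matrix V x)) \<in> borel_measurable (iid M J)"
proof -
  have "(\<lambda>x. \<bar>\<Sum>i\<in>fst t. \<Sum>j\<in>snd t. sample_matrix V x i j\<bar>) \<in> borel_measurable (iid M J)"
    if t: "t \<in> Pow K \<times> Pow K" for t
    using t J by (intro borel_measurable_abs borel_measurable_sum sample_matrix_measurable) auto
  then show ?thesis
    unfolding cut_max_def case_prod_unfold using J finite_subset[OF J(2,1)] by (intro borel_measurable_Max) auto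
qed

lemma cut_max_sample_integrable:
  assumes V: "integrable (M \<Otimes>\<^sub>M M) V" and J: "finite J" "K \<subseteq> J"
  shows "integrable (iid M J) (\<lambda>x. cut_max K (sample_matrix V x))"
proof (rule Bochner_Integration.integrable_bound)
  show "integrable (iid M J) (\<lambda>x. \<Sum>i\<in>K. \<Sum>j\<in>K. \<bar>sample_matrix V x i j\<bar>)"
    using J by (intro Bochner_Integration.integrable_sum integrable_abs sample_matrix_integrable[OF V]) auto
  show "(\<lambda>x. cut_max K (sample_matrix V x)) \<in> borel_measurable (iid M J)"
    using V J by (intro cut_max_sample_measurable) auto
  have K: "finite K" using J finite_subset by auto
  have "cut_max K (sample_matrix V x) \<le> (\<Sum>i\<in>K. \<Sum>j\<in>K. \<bar>sample_matrix V x i j\<bar>)" for x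
    using cut_max_diff_le[OF K, of "sample_matrix V x" "\<lambda>_ _. 0"] by (simp add: cut_max_zero[OF K])
  then show "AE x in iid M J. norm (cut_max K (sample_matrix V x)) \<le> norm (\<Sum>i\<in>K. \<Sum>j\<in>K. \<bar>sample_matrix V x i j\<bar>)"
    using cut_max_nonneg[OF K] by (intro AE_I2) (simp add: sum_nonneg)
qed


text \<open>Decoupling reduces the mean to bipartite samples. The terms proportional to
  \<open>card I * card (J - I)\<close> regain the constant 1 by
  \<open>sum_card_bipartitions\<close>; the remainder \<open>card J * l\<close> is the same for
  every bipartition and keeps the factor 4.\<close>

lemma mean_cut_max_sample_bounded:
  fixes V :: "'a \<times> 'a \<Rightarrow> real" and J :: "'i set" and K l c :: real
  assumes J: "finite J" and l: "l > 0"
    and [measurable]: "V \<in> borel_measurable (M \<Otimes>\<^sub>M M)"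
    and V: "\<And>x y. x \<in> space M \<Longrightarrow> y \<in> space M \<Longrightarrow> \<bar>V (x, y)\<bar> \<le> K"
    and cut: "\<And>S T. S \<in> sets M \<Longrightarrow> T \<in> sets M \<Longrightarrow> \<bar>\<integral>z. indicator (S \<times> T) z * V z \<partial>(M \<Otimes>\<^sub>M M)\<bar> \<le> c"
  shows "(\<integral>x. cut_max J (sample_matrix V x) \<partial>iid M J)
    \<le> (card J)\<^sup>2 * (c + 2 * (\<integral>z. (V z)\<^sup>2 \<partial>(M \<Otimes>\<^sub>M M)) / l) + 4 * card J * l"
proof -
  let ?P = "iid M J"
  interpret P: prob_space ?P by (rule prob_space_iid)
  interpret MM: pair_prob_space M M ..
  have c0: "c \<ge> 0" using cut[of "{}" "{}"] by simp
  note V_int = bounded_kernel_integrable(1)[OF assms(3) V] and V2 = bounded_kernel_integrable(2)[OF assms(3) V]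
  define Q where "Q = (\<integral>z. (V z)\<^sup>2 \<partial>(M \<Otimes>\<^sub>M M))"
  have Q: "(\<integral>x. (\<integral>y. (V (x, y))\<^sup>2 \<partial>M) \<partial>M) = Q"
    unfolding Q_def using MM.integral_fst'[OF V2] .
  have Q0: "Q \<ge> 0" unfolding Q_def by simp
  define n where "n = card J"
  define f where "f I x = (MAX (A, B)\<in>Pow I \<times> Pow (J - I). \<bar>\<Sum>i\<in>A. \<Sum>j\<in>B. V (x i, x j)\<bar>)" for I x
  have f_int: "integrable ?P (f I)" if I: "I \<subseteq> J" for I
    unfolding f_def using J I V by (intro max_rectangle_sum_integrable[where V = V]) auto
  have cm_int: "integrable ?P (\<lambda>x. cut_max J (sample_matrix V x))"
    by (rule cut_max_sample_integrable[OF V_int J order.refl])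
  have "2 ^ n * (\<integral>x. cut_max J (sample_matrix V x) \<partial>?P) = (\<integral>x. 2 ^ n * cut_max J (sample_matrix V x) \<partial>?P)"
    by simp
  also have "\<dots> \<le> (\<integral>x. 4 * (\<Sum>I\<in>Pow J. f I x) \<partial>?P)"
  proof (rule integral_mono)
    show "integrable ?P (\<lambda>x. 2 ^ n * cut_max J (sample_matrix V x))"
      using cm_int by simp
    show "integrable ?P (\<lambda>x. 4 * (\<Sum>I\<in>Pow J. f I x))"
      using f_int by auto
    fix x
    have "(MAX (A, B)\<in>Pow I \<times> Pow (J - I). \<bar>\<Sum>i\<in>A. \<Sum>j\<in>B. sample_matrix V x i j\<bar>) = f I x" for I
    proof -
      have "(\<Sum>i\<in>A. \<Sum>j\<in>B. sample_matrix V x i j) = (\<Sum>i\<in>A. \<Sum>j\<in>B. V (x i, x j))" if "A \<subseteq> I" "B \<subseteq> J - I" for A B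
        using that by (intro sum.cong refl) (auto simp: sample_matrix_def)
      then show ?thesis
        unfolding f_def by (intro arg_cong[where f = Max] image_cong) auto
    qed
    then show "2 ^ n * cut_max J (sample_matrix V x) \<le> 4 * (\<Sum>I\<in>Pow J. f I x)"
      using cut_max_decoupling[OF J, of "sample_matrix V x"] by (simp add: n_def sample_matrix_def)
  qed
  also have "\<dots> = 4 * (\<Sum>I\<in>Pow J. \<integral>x. f I x \<partial>?P)"
    using f_int by simp
  also have "\<dots> \<le> 4 * (\<Sum>I\<in>Pow J. real (card I * card (J - I)) * (c + 2 * Q / l) + n * l)"
  proof (intro mult_left_mono sum_mono)
    fix I assume I: "I \<in> Pow J"
    then have fin: "finite I" "finite (J - I)" "I \<inter> (J - I) = {}" "I \<union> (J - I) = J"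
      using J finite_subset by auto
    have n: "real n = card I + card (J - I)"
      using fin unfolding n_def by (metis card_Un_disjoint of_nat_add)
    show "(\<integral>x. f I x \<partial>?P) \<le> real (card I * card (J - I)) * (c + 2 * Q / l) + n * l"
    proof -
      have "(\<integral>x. f I x \<partial>?P) \<le> card I * card (J - I) * c + 2 * card I * card (J - I) * Q / l + (card I + card (J - I)) * l"
        unfolding f_def using mean_bipartite_cut_le[where V = V, OF fin(1-3) l assms(3) V cut] by (simp only: fin(4) Q)
      also have "\<dots> = real (card I * card (J - I)) * (c + 2 * Q / l) + n * l"
        unfolding n by (simp add: algebra_simps)
      finally show ?thesis .
    qed
  qed simp
  also have "\<dots> = 4 * (\<Sum>I\<in>Pow J. real (card I * card (J - I))) * (c + 2 * Q / l) + 4 * (2 ^ n * (n * l))"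
  proof -
    have "(\<Sum>I\<in>Pow J. n * l) = 2 ^ n * (n * l)"
      using J by (simp add: n_def card_Pow)
    then show ?thesis
      by (simp only: sum.distrib sum_distrib_right[symmetric] distrib_left mult.assoc)
  qed
  also have "\<dots> \<le> 2 ^ n * n\<^sup>2 * (c + 2 * Q / l) + 4 * (2 ^ n * (n * l))"
    using sum_card_bipartitions[OF J] c0 Q0 l unfolding n_def by (intro add_mono mult_right_mono) auto
  also have "\<dots> = 2 ^ n * (n\<^sup>2 * (c + 2 * Q / l) + 4 * n * l)"
    by (simp add: algebra_simps)
  finally show ?thesis
    by (simp add: n_def Q_def)
qed


text \<open>Truncation at height \<open>m\<close> makes the kernel bounded. Its L1 error
  \<open>e m\<close> enters twice, through the rectangle integrals and through the sampled entries,
  and tends to 0, while the second moment does not increase.\<close>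

lemma mean_cut_max_sample_le:
  fixes V :: "'a \<times> 'a \<Rightarrow> real" and J :: "'i set" and l c :: real
  assumes J: "finite J" and l: "l > 0"
    and V: "integrable (M \<Otimes>\<^sub>M M) V" and V2: "integrable (M \<Otimes>\<^sub>M M) (\<lambda>z. (V z)\<^sup>2)"
    and cut: "\<And>S T. S \<in> sets M \<Longrightarrow> T \<in> sets M \<Longrightarrow> \<bar>\<integral>z. indicator (S \<times> T) z * V z \<partial>(M \<Otimes>\<^sub>M M)\<bar> \<le> c"
  shows "(\<integral>x. cut_max J (sample_matrix V x) \<partial>iid M J)
    \<le> (card J)\<^sup>2 * (c + 2 * (\<integral>z. (V z)\<^sup>2 \<partial>(M \<Otimes>\<^sub>M M)) / l) + 4 * card J * l"
proof -
  let ?P = "iid M J" and ?MM = "M \<Otimes>\<^sub>M M"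
  interpret P: prob_space ?P by (rule prob_space_iid)
  interpret MM: pair_prob_space M M ..
  have [measurable]: "V \<in> borel_measurable ?MM" using V by auto
  define W where "W m z = (if \<bar>V z\<bar> \<le> real m then V z else 0)" for m z
  define e where "e m = (\<integral>z. \<bar>V z - W m z\<bar> \<partial>?MM)" for m
  have [measurable]: "W m \<in> borel_measurable ?MM" for m unfolding W_def by measurable
  have W_int: "integrable ?MM (W m)" for m
    by (rule Bochner_Integration.integrable_bound[OF V]) (auto simp: W_def)
  have e_lim: "e \<longlonglongrightarrow> (\<integral>z. 0 \<partial>?MM)"
    unfolding e_def
  proof (rule integral_dominated_convergence[where w = "\<lambda>z. \<bar>V z\<bar>"])
    show "AE z in ?MM. (\<lambda>m. \<bar>V z - W m z\<bar>) \<longlonglongrightarrow> 0"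
    proof (rule AE_I2, rule tendsto_eventually)
      fix z
      show "\<forall>\<^sub>F m in sequentially. \<bar>V z - W m z\<bar> = 0"
        using eventually_ge_at_top[of "nat \<lceil>\<bar>V z\<bar>\<rceil>"] by eventually_elim (auto simp: W_def nat_le_iff ceiling_le_iff)
    qed
  qed (use V in \<open>auto simp: W_def\<close>)
  define Q where "Q = (\<integral>z. (V z)\<^sup>2 \<partial>?MM)"
  define n where "n = card J"
  have bound: "(\<integral>x. cut_max J (sample_matrix V x) \<partial>?P) \<le> n\<^sup>2 * (c + e m + 2 * Q / l) + 4 * n * l + n\<^sup>2 * e m" for m
  proof -
    have d_int: "integrable ?P (\<lambda>x. \<bar>sample_matrix V x i j - sample_matrix (W m) x i j\<bar>)" if "i \<in> J" "j \<in> J" for i j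
      using sample_matrix_integrable[OF V that] sample_matrix_integrable[OF W_int that] by auto
    have "(\<integral>x. cut_max J (sample_matrix V x) \<partial>?P)
        \<le> (\<integral>x. cut_max J (sample_matrix (W m) x) + (\<Sum>i\<in>J. \<Sum>j\<in>J. \<bar>sample_matrix V x i j - sample_matrix (W m) x i j\<bar>) \<partial>?P)"
      using d_int cut_max_sample_integrable[OF V J order.refl] cut_max_sample_integrable[OF W_int J order.refl]
      by (intro integral_mono cut_max_diff_le J) auto
    also have "\<dots> = (\<integral>x. cut_max J (sample_matrix (W m) x) \<partial>?P)
        + (\<Sum>i\<in>J. \<Sum>j\<in>J. \<integral>x. \<bar>sample_matrix V x i j - sample_matrix (W m) x i j\<bar> \<partial>?P)"
      using d_int cut_max_sample_integrable[OF W_int J order.refl]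
      by (subst Bochner_Integration.integral_add) auto
    also have "(\<Sum>i\<in>J. \<Sum>j\<in>J. \<integral>x. \<bar>sample_matrix V x i j - sample_matrix (W m) x i j\<bar> \<partial>?P) \<le> (\<Sum>i\<in>J. \<Sum>j\<in>J. e m)"
    proof (intro sum_mono)
      fix i j assume ij: "i \<in> J" "j \<in> J"
      show "(\<integral>x. \<bar>sample_matrix V x i j - sample_matrix (W m) x i j\<bar> \<partial>?P) \<le> e m"
      proof (cases "i = j")
        case True
        then show ?thesis by (simp add: sample_matrix_def e_def)
      next
        case False
        then show ?thesis
          using iid_pair_integral(2)[OF ij False, of "\<lambda>z. \<bar>V z - W m z\<bar>"] V W_int
          by (simp add: sample_matrix_def e_def)
      qed
    qed
    also have "(\<Sum>i\<in>J. \<Sum>j\<in>J. e m) = n\<^sup>2 * e m"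
      by (simp add: n_def power2_eq_square)
    also have "(\<integral>x. cut_max J (sample_matrix (W m) x) \<partial>?P)
        \<le> n\<^sup>2 * (c + e m + 2 * (\<integral>z. (W m z)\<^sup>2 \<partial>?MM) / l) + 4 * n * l"
      unfolding n_def
    proof (rule mean_cut_max_sample_bounded[where V = "W m" and K = "real m", OF J l])
      show "\<bar>W m (x, y)\<bar> \<le> real m" for x y by (simp add: W_def)
      fix S T assume [measurable]: "S \<in> sets M" "T \<in> sets M"
      have i: "integrable ?MM (\<lambda>z. indicator (S \<times> T) z * V z)" "integrable ?MM (\<lambda>z. indicator (S \<times> T) z * W m z)"
        using integrable_mult_indicator[OF _ V, of "S \<times> T"] integrable_mult_indicator[OF _ W_int, of "S \<times> T"] by auto
      have "\<bar>(\<integral>z. indicator (S \<times> T) z * W m z \<partial>?MM) - (\<integral>z. indicator (S \<times> T) z * V z \<partial>?MM)\<bar>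
          = \<bar>\<integral>z. indicator (S \<times> T) z * W m z - indicator (S \<times> T) z * V z \<partial>?MM\<bar>"
        using i by simp
      also have "\<dots> \<le> (\<integral>z. \<bar>indicator (S \<times> T) z * W m z - indicator (S \<times> T) z * V z\<bar> \<partial>?MM)"
        by (rule integral_abs_bound)
      also have "\<dots> \<le> e m"
        unfolding e_def using i V W_int by (intro integral_mono) (auto simp: indicator_def abs_minus_commute)
      finally show "\<bar>\<integral>z. indicator (S \<times> T) z * W m z \<partial>?MM\<bar> \<le> c + e m"
        using cut[of S T] by simp
    qed auto
    also have "(\<integral>z. (W m z)\<^sup>2 \<partial>?MM) \<le> Q"
      unfolding Q_def
    proof (rule integral_mono[OF _ V2])
      show "integrable ?MM (\<lambda>z. (W m z)\<^sup>2)"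
        by (rule Bochner_Integration.integrable_bound[OF V2]) (auto simp: W_def)
    qed (simp add: W_def)
    finally show ?thesis
      using l by (simp add: mult_left_mono divide_right_mono)
  qed
  have "(\<lambda>m. n\<^sup>2 * (c + e m + 2 * Q / l) + 4 * n * l + n\<^sup>2 * e m) \<longlonglongrightarrow> n\<^sup>2 * (c + 0 + 2 * Q / l) + 4 * n * l + real (n\<^sup>2) * 0"
  proof -
    have "e \<longlonglongrightarrow> 0" using e_lim by simp
    then show ?thesis by (intro tendsto_add tendsto_mult tendsto_const)
  qed
  then have "(\<integral>x. cut_max J (sample_matrix V x) \<partial>?P) \<le> n\<^sup>2 * (c + 0 + 2 * Q / l) + 4 * n * l + real (n\<^sup>2) * 0"
    using bound by (intro LIMSEQ_le_const) auto
  then show ?thesis by (simp add: n_def Q_def)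
qed


section \<open>Concentration through the regularized cut maximum\<close>

lemma regularized_cut_max_sample_measurable:
  assumes V: "V \<in> borel_measurable (M \<Otimes>\<^sub>M M)" and J: "finite J"
  shows "(\<lambda>x. regularized_cut_max J c (sample_matrix V x)) \<in> borel_measurable (iid M J)"
  unfolding regularized_cut_max_def using J V
  by (intro borel_measurable_Min borel_measurable_add borel_measurable_const cut_max_sample_measurable) auto

lemma regularized_cut_max_sample_bounded_difference:
  assumes J: "finite J" "i \<in> J" and c: "c \<ge> 0"
  shows "\<bar>regularized_cut_max J c (sample_matrix V (x(i := y))) - regularized_cut_max J c (sample_matrix V x)\<bar> \<le> c"
proof -
  have "sample_matrix V (x(i := y)) j l = sample_matrix V x j l" if "j \<noteq> i" "l \<noteq> i" for j l
    using that by (simp add: sample_matrix_def)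
  then show ?thesis
    using regularized_cut_max_Lipschitz[OF J(1) c J(2), of "sample_matrix V x" "sample_matrix V (x(i := y))"]
      regularized_cut_max_Lipschitz[OF J(1) c J(2), of "sample_matrix V (x(i := y))" "sample_matrix V x"]
    by (simp add: abs_le_iff)
qed

text \<open>Row and column of index \<open>i\<close> are taken together, since deleting an index
  removes both.\<close>

definition row_sum :: "'i set \<Rightarrow> ('a \<times> 'a \<Rightarrow> real) \<Rightarrow> ('i \<Rightarrow> 'a) \<Rightarrow> 'i \<Rightarrow> real" where
  "row_sum J V x i = (\<Sum>j\<in>J. \<bar>sample_matrix V x i j\<bar> + \<bar>sample_matrix V x j i\<bar>)"

lemma row_sum_nonneg: "0 \<le> row_sum J V x i"
  unfolding row_sum_def by (intro sum_nonneg) auto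

lemma row_sum_integrable:
  assumes "integrable (M \<Otimes>\<^sub>M M) V" "i \<in> J"
  shows "integrable (iid M J) (\<lambda>x. row_sum J V x i)"
  unfolding row_sum_def using assms
  by (intro Bochner_Integration.integrable_sum Bochner_Integration.integrable_add integrable_abs sample_matrix_integrable)

text \<open>McDiarmid's inequality applies to the regularized maximum \<open>g\<close>, which lies
  below \<open>f\<close>. In the upper tail the mean of \<open>g\<close> is at most
  \<open>m\<close>, and \<open>f\<close> exceeds \<open>g\<close> only when some row sum exceeds
  \<open>c\<close>; these events are added to the probability. In the lower tail the inequality
  \<open>g \<le> f\<close> holds everywhere, so no event is added, but the mean of \<open>g\<close>
  may fall below \<open>m\<close> by the expected excess of the row sums. Hence the different forms
  of the two bounds.\<close>

lemma cut_max_sample_tails: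
  fixes V :: "'a \<times> 'a \<Rightarrow> real" and J :: "'i set" and c t :: real
  assumes J: "finite J" "J \<noteq> {}" and c: "c > 0" and t: "t > 0" and V: "integrable (M \<Otimes>\<^sub>M M) V"
  defines "P \<equiv> iid M J" and "m \<equiv> (\<integral>x. cut_max J (sample_matrix V x) \<partial>iid M J)"
  shows "measure P {x \<in> space P. cut_max J (sample_matrix V x) > m + t}
      \<le> exp (- 2 * t\<^sup>2 / (card J * c\<^sup>2)) + (\<Sum>i\<in>J. measure P {x \<in> space P. row_sum J V x i > c})"
    and "measure P {x \<in> space P. cut_max J (sample_matrix V x) < m - (\<Sum>i\<in>J. \<integral>x. max 0 (row_sum J V x i - c) \<partial>P) - t}
      \<le> exp (- 2 * t\<^sup>2 / (card J * c\<^sup>2))"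
proof -
  interpret P: prob_space P unfolding P_def by (rule prob_space_iid)
  have Vm: "V \<in> borel_measurable (M \<Otimes>\<^sub>M M)" using V by auto
  define f where "f x = cut_max J (sample_matrix V x)" for x
  define g where "g x = regularized_cut_max J c (sample_matrix V x)" for x
  have f_int: "integrable P f"
    unfolding f_def P_def by (rule cut_max_sample_integrable[OF V J(1) order.refl])
  have g_meas: "g \<in> borel_measurable P"
    unfolding g_def P_def by (rule regularized_cut_max_sample_measurable[OF Vm J(1)])
  note [measurable] = borel_measurable_integrable[OF f_int] g_meas
  have r_int: "integrable P (\<lambda>x. row_sum J V x i)" if "i \<in> J" for i
    unfolding P_def by (rule row_sum_integrable[OF V that])
  note r_meas = borel_measurable_integrable[OF r_int]
  have fg: "g x \<le> f x" for x
    using regularized_cut_max_le[OF J(1), of "{}" c "sample_matrix V x"] by (simp add: f_def g_def)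
  have gf: "f x \<le> g x + (\<Sum>i\<in>J. max 0 (row_sum J V x i - c))" for x
    unfolding f_def g_def row_sum_def by (rule cut_max_le_regularized[OF J(1)])
  have g_bdd: "\<bar>g x\<bar> \<le> c * card J" for x
    using regularized_cut_max_le[OF J(1) order.refl, of c "sample_matrix V x"]
      regularized_cut_max_nonneg[OF J(1), of c "sample_matrix V x"] c by (simp add: g_def)
  have g_int: "integrable P g" using g_bdd by (intro P.integrable_bounded) auto
  have g_diff: "\<bar>g (x(i := y)) - g x\<bar> \<le> c" if "i \<in> J" for x i y
    unfolding g_def using c by (intro regularized_cut_max_sample_bounded_difference J(1) that) auto
  have max_int: "integrable P (\<lambda>x. max 0 (row_sum J V x i - c))" if "i \<in> J" for i
    using r_int[OF that] by (intro integrable_max) auto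
  have gm: "(\<integral>x. g x \<partial>P) \<le> m"
    unfolding m_def P_def[symmetric] f_def[symmetric] by (intro integral_mono g_int f_int fg)
  have "m \<le> (\<integral>x. g x + (\<Sum>i\<in>J. max 0 (row_sum J V x i - c)) \<partial>P)"
    unfolding m_def P_def[symmetric] f_def[symmetric] using max_int
    by (intro integral_mono gf f_int Bochner_Integration.integrable_add g_int Bochner_Integration.integrable_sum) auto
  also have "\<dots> = (\<integral>x. g x \<partial>P) + (\<Sum>i\<in>J. \<integral>x. max 0 (row_sum J V x i - c) \<partial>P)"
    using max_int g_int by (subst Bochner_Integration.integral_add) auto
  finally have mg: "m - (\<Sum>i\<in>J. \<integral>x. max 0 (row_sum J V x i - c) \<partial>P) \<le> (\<integral>x. g x \<partial>P)" by simp
  have up: "measure P {x \<in> space P. g x \<ge> (\<integral>x. g x \<partial>P) + t} \<le> exp (- 2 * t\<^sup>2 / (card J * c\<^sup>2))"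
    unfolding P_def using g_meas g_bdd g_diff c t unfolding P_def
    by (intro McDiarmid_tail[OF J, where K = "c * card J"]) auto
  have lo: "measure P {x \<in> space P. - g x \<ge> (\<integral>x. - g x \<partial>P) + t} \<le> exp (- 2 * t\<^sup>2 / (card J * c\<^sup>2))"
    unfolding P_def using g_meas g_bdd g_diff c t unfolding P_def
    by (intro McDiarmid_tail[OF J, where K = "c * card J"]) (auto simp: abs_minus_commute)
  have r_sets: "{x \<in> space P. row_sum J V x i > c} \<in> sets P" if "i \<in> J" for i
    using r_meas[OF that] by measurable
  have g_set: "{x \<in> space P. g x \<ge> (\<integral>x. g x \<partial>P) + t} \<in> sets P"
    by measurable
  have U_set: "(\<Union>i\<in>J. {x \<in> space P. row_sum J V x i > c}) \<in> sets P"
    using r_sets J(1) by (intro sets.finite_UN) auto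
  have "{x \<in> space P. f x > m + t} \<subseteq> {x \<in> space P. g x \<ge> (\<integral>x. g x \<partial>P) + t} \<union> (\<Union>i\<in>J. {x \<in> space P. row_sum J V x i > c})"
  proof (intro subsetI, rule ccontr)
    fix x assume x: "x \<in> {x \<in> space P. f x > m + t}"
      and "x \<notin> {x \<in> space P. g x \<ge> (\<integral>x. g x \<partial>P) + t} \<union> (\<Union>i\<in>J. {x \<in> space P. row_sum J V x i > c})"
    then have gx: "g x < (\<integral>x. g x \<partial>P) + t" and r: "\<And>i. i \<in> J \<Longrightarrow> row_sum J V x i \<le> c"
      by (auto simp: not_le not_less)
    have "(\<Sum>i\<in>J. max 0 (row_sum J V x i - c)) = 0"
      using r by (intro sum.neutral) auto
    with gf[of x] gx gm x show False by simp
  qed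
  then have "measure P {x \<in> space P. f x > m + t}
      \<le> measure P ({x \<in> space P. g x \<ge> (\<integral>x. g x \<partial>P) + t} \<union> (\<Union>i\<in>J. {x \<in> space P. row_sum J V x i > c}))"
    by (rule P.finite_measure_mono) (intro sets.Un g_set U_set)
  also have "\<dots> \<le> measure P {x \<in> space P. g x \<ge> (\<integral>x. g x \<partial>P) + t} + measure P (\<Union>i\<in>J. {x \<in> space P. row_sum J V x i > c})"
    by (intro measure_Un_le g_set U_set)
  also have "\<dots> \<le> exp (- 2 * t\<^sup>2 / (card J * c\<^sup>2)) + (\<Sum>i\<in>J. measure P {x \<in> space P. row_sum J V x i > c})"
    using r_sets J(1) up by (intro add_mono measure_UNION_le) auto
  finally show "measure P {x \<in> space P. cut_max J (sample_matrix V x) > m + t}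
      \<le> exp (- 2 * t\<^sup>2 / (card J * c\<^sup>2)) + (\<Sum>i\<in>J. measure P {x \<in> space P. row_sum J V x i > c})"
    by (simp add: f_def)
  have "{x \<in> space P. f x < m - (\<Sum>i\<in>J. \<integral>x. max 0 (row_sum J V x i - c) \<partial>P) - t}
      \<subseteq> {x \<in> space P. - g x \<ge> (\<integral>x. - g x \<partial>P) + t}"
  proof safe
    fix x assume "f x < m - (\<Sum>i\<in>J. \<integral>x. max 0 (row_sum J V x i - c) \<partial>P) - t"
    then show "(\<integral>x. - g x \<partial>P) + t \<le> - g x"
      using mg fg[of x] by simp
  qed
  then have "measure P {x \<in> space P. f x < m - (\<Sum>i\<in>J. \<integral>x. max 0 (row_sum J V x i - c) \<partial>P) - t}
      \<le> measure P {x \<in> space P. - g x \<ge> (\<integral>x. - g x \<partial>P) + t}"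
    by (intro P.finite_measure_mono) auto
  with lo show "measure P {x \<in> space P. cut_max J (sample_matrix V x) < m - (\<Sum>i\<in>J. \<integral>x. max 0 (row_sum J V x i - c) \<partial>P) - t}
      \<le> exp (- 2 * t\<^sup>2 / (card J * c\<^sup>2))"
    by (simp add: f_def)
qed

text \<open>A row sum has \<open>2 * card J\<close> summands whose p-norms are at most
  \<open>N\<close>. By convexity the p-th power of their average is at most the average of their
  p-th powers.\<close>

lemma row_sum_moment:
  fixes V :: "'a \<times> 'a \<Rightarrow> real" and J :: "'i set" and N p :: real
  assumes J: "finite J" "i \<in> J" and p: "p \<ge> 1" and N: "N > 0" and V: "V \<in> borel_measurable (M \<Otimes>\<^sub>M M)"
    and Vp: "integrable (M \<Otimes>\<^sub>M M) (\<lambda>z. \<bar>V z\<bar> powr p)" "(\<integral>z. \<bar>V z\<bar> powr p \<partial>(M \<Otimes>\<^sub>M M)) \<le> N powr p"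
  shows "integrable (iid M J) (\<lambda>x. (row_sum J V x i / (2 * card J * N)) powr p)"
    and "(\<integral>x. (row_sum J V x i / (2 * card J * N)) powr p \<partial>iid M J) \<le> 1"
proof -
  let ?P = "iid M J"
  interpret P: prob_space ?P by (rule prob_space_iid)
  define n where "n = card J"
  have n: "n > 0" using J by (auto simp: n_def card_gt_0_iff)
  define s where "s x = (\<Sum>j\<in>J. \<bar>sample_matrix V x i j\<bar> powr p + \<bar>sample_matrix V x j i\<bar> powr p)" for x
  have term_eq: "\<bar>sample_matrix V x j l\<bar> powr p = sample_matrix (\<lambda>z. \<bar>V z\<bar> powr p) x j l" for x :: "'i \<Rightarrow> 'a" and j l
    by (simp add: sample_matrix_def)
  have term_int: "integrable ?P (\<lambda>x. \<bar>sample_matrix V x j l\<bar> powr p)" if "j \<in> J" "l \<in> J" for j l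
    unfolding term_eq by (rule sample_matrix_integrable[OF Vp(1) that])
  have term_le: "(\<integral>x. \<bar>sample_matrix V x j l\<bar> powr p \<partial>?P) \<le> N powr p" if "j \<in> J" "l \<in> J" for j l
    unfolding term_eq using iid_pair_integral(2)[OF that _ Vp(1)] Vp(2) by (cases "j = l") (auto simp: sample_matrix_def)
  have s_int: "integrable ?P s"
    unfolding s_def using J by (intro Bochner_Integration.integrable_sum Bochner_Integration.integrable_add term_int)
  have le: "(row_sum J V x i / (2 * n * N)) powr p \<le> s x / (2 * n * N powr p)" for x
  proof -
    \<comment> \<open>The Boolean distinguishes row entries from column entries, so that all
      \<open>2 * n\<close> summands form a single family.\<close>
    define b where "b = (\<lambda>(j, u). if u then \<bar>sample_matrix V x i j\<bar> else \<bar>sample_matrix V x j i\<bar>)"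
    have "((\<Sum>w\<in>J \<times> (UNIV :: bool set). b w) / card (J \<times> (UNIV :: bool set))) powr p
        \<le> (\<Sum>w\<in>J \<times> (UNIV :: bool set). b w powr p) / card (J \<times> (UNIV :: bool set))"
      using J p by (intro power_mean_le) (auto simp: b_def)
    moreover have "(\<Sum>w\<in>J \<times> (UNIV :: bool set). b w) = row_sum J V x i"
      unfolding sum.cartesian_product[symmetric] by (simp add: sum.cartesian_product' b_def row_sum_def UNIV_bool add.commute)
    moreover have "(\<Sum>w\<in>J \<times> (UNIV :: bool set). b w powr p) = s x"
      by (simp add: sum.cartesian_product' b_def s_def UNIV_bool add.commute)
    moreover have "card (J \<times> (UNIV :: bool set)) = 2 * n"
      by (simp add: n_def card_cartesian_product)
    ultimately have "(row_sum J V x i / (2 * n)) powr p \<le> s x / (2 * n)" by simp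
    then have "(row_sum J V x i / (2 * n)) powr p / N powr p \<le> s x / (2 * n) / N powr p"
      by (intro divide_right_mono) auto
    moreover have "(row_sum J V x i / (2 * n * N)) powr p = (row_sum J V x i / (2 * n)) powr p / N powr p"
      using N row_sum_nonneg[of J V x i] by (simp add: powr_divide[symmetric] divide_divide_eq_left)
    ultimately show ?thesis by simp
  qed
  have r_meas: "(\<lambda>x. row_sum J V x i) \<in> borel_measurable ?P"
    unfolding row_sum_def using V J by measurable
  show int: "integrable ?P (\<lambda>x. (row_sum J V x i / (2 * card J * N)) powr p)"
    unfolding n_def[symmetric]
  proof (rule Bochner_Integration.integrable_bound)
    show "integrable ?P (\<lambda>x. s x / (2 * n * N powr p))" using s_int by simp
    show "AE x in ?P. norm ((row_sum J V x i / (2 * n * N)) powr p) \<le> norm (s x / (2 * n * N powr p))"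
      using le by (intro AE_I2) (auto simp: s_def abs_of_nonneg sum_nonneg)
  qed (use r_meas in measurable)
  have "(\<integral>x. (row_sum J V x i / (2 * n * N)) powr p \<partial>?P) \<le> (\<integral>x. s x / (2 * n * N powr p) \<partial>?P)"
    using int s_int by (intro integral_mono le) (auto simp: n_def)
  also have "\<dots> = (\<integral>x. s x \<partial>?P) / (2 * n * N powr p)" by simp
  also have "(\<integral>x. s x \<partial>?P) = (\<Sum>j\<in>J. (\<integral>x. \<bar>sample_matrix V x i j\<bar> powr p \<partial>?P) + (\<integral>x. \<bar>sample_matrix V x j i\<bar> powr p \<partial>?P))"
    unfolding s_def using J term_int by (subst Bochner_Integration.integral_sum) auto
  also have "\<dots> \<le> (\<Sum>j\<in>J. N powr p + N powr p)"
    using J by (intro sum_mono add_mono term_le) auto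
  also have "\<dots> / (2 * n * N powr p) = 1"
    using n N by (simp add: n_def field_simps)
  finally show "(\<integral>x. (row_sum J V x i / (2 * card J * N)) powr p \<partial>?P) \<le> 1"
    using n N by (simp add: n_def divide_right_mono)
qed

end

section \<open>Explicit tail bounds from the p-th moment\<close>

lemma deviation_scaling:
  fixes n L \<tau> N :: real
  assumes n: "n > 0"
  shows "2 * n * \<tau> * N * sqrt (n * L / 2) = n\<^sup>2 * (sqrt (2 * L) * \<tau> * N / sqrt n)"
proof -
  have "2 * sqrt (n * L / 2) = sqrt (2\<^sup>2 * (n * L / 2))"
    by (simp only: real_sqrt_mult real_sqrt_abs)
  also have "2\<^sup>2 * (n * L / 2) = n * (2 * L)" by simp
  finally have 1: "2 * sqrt (n * L / 2) = sqrt n * sqrt (2 * L)"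
    by (simp only: real_sqrt_mult)
  have "n\<^sup>2 / sqrt n = n * sqrt n"
    using n by (simp add: power2_eq_square real_div_sqrt flip: times_divide_eq_right)
  then have "n\<^sup>2 * (sqrt (2 * L) * \<tau> * N / sqrt n) = n * sqrt n * (sqrt (2 * L) * \<tau> * N)"
    by (metis times_divide_eq_left times_divide_eq_right)
  also have "\<dots> = n * \<tau> * N * (2 * sqrt (n * L / 2))"
    unfolding 1 by (simp only: mult_ac)
  also have "\<dots> = 2 * n * \<tau> * N * sqrt (n * L / 2)"
    by (simp only: mult_ac)
  finally show ?thesis by (rule sym)
qed

context prob_space
begin

text \<open>Distinguishing whether \<open>V\<close> exceeds the level \<open>N\<close> gives the
  pointwise bound \<open>N\<^sup>2 + N\<^sup>2 / N powr p * \<bar>V z\<bar> powr p\<close> for the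
  square. The constant 2 is larger than the 1 of Hoelder's inequality; the final constants leave
  room for it.\<close>

lemma Lp_kernel_integrable:
  fixes V :: "'a \<times> 'a \<Rightarrow> real" and N p :: real
  assumes p: "p \<ge> 2" and N: "N > 0" and [measurable]: "V \<in> borel_measurable (M \<Otimes>\<^sub>M M)"
    and Vp: "integrable (M \<Otimes>\<^sub>M M) (\<lambda>z. \<bar>V z\<bar> powr p)" "(\<integral>z. \<bar>V z\<bar> powr p \<partial>(M \<Otimes>\<^sub>M M)) \<le> N powr p"
  shows "integrable (M \<Otimes>\<^sub>M M) V" "integrable (M \<Otimes>\<^sub>M M) (\<lambda>z. (V z)\<^sup>2)"
    and "(\<integral>z. (V z)\<^sup>2 \<partial>(M \<Otimes>\<^sub>M M)) \<le> 2 * N\<^sup>2"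
proof -
  interpret MM: pair_prob_space M M ..
  let ?b = "\<lambda>z. N\<^sup>2 + N\<^sup>2 / N powr p * \<bar>V z\<bar> powr p"
  have b_int: "integrable (M \<Otimes>\<^sub>M M) ?b" using Vp(1) by auto
  have le: "(V z)\<^sup>2 \<le> ?b z" for z
  proof (cases "\<bar>V z\<bar> \<le> N")
    case True
    then have "(V z)\<^sup>2 \<le> N\<^sup>2" using abs_power2_le[of "V z" N] by simp
    then show ?thesis by (simp add: add_increasing2)
  next
    case False
    then have "1 \<le> \<bar>V z\<bar> / N" using N by simp
    then have "(\<bar>V z\<bar> / N) powr 2 \<le> (\<bar>V z\<bar> / N) powr p"
      using p by (rule powr_mono[rotated])
    then have "\<bar>V z\<bar> powr 2 / N powr 2 \<le> \<bar>V z\<bar> powr p / N powr p"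
      using N by (simp add: powr_divide)
    then have "(V z)\<^sup>2 / N\<^sup>2 \<le> \<bar>V z\<bar> powr p / N powr p"
      using N False by simp
    then have "(V z)\<^sup>2 \<le> N\<^sup>2 * (\<bar>V z\<bar> powr p / N powr p)"
      using N by (simp add: divide_le_eq mult.commute)
    then show ?thesis by (simp add: add_increasing)
  qed
  show V2: "integrable (M \<Otimes>\<^sub>M M) (\<lambda>z. (V z)\<^sup>2)"
    by (rule Bochner_Integration.integrable_bound[OF b_int]) (use le in \<open>auto intro!: AE_I2 simp del: abs_add_abs intro: order.trans[OF _ abs_ge_self]\<close>)
  show "integrable (M \<Otimes>\<^sub>M M) V"
  proof (rule Bochner_Integration.integrable_bound)
    show "integrable (M \<Otimes>\<^sub>M M) (\<lambda>z. ((V z)\<^sup>2 / 1 + 1) / 2)" using V2 by simp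
    show "AE z in M \<Otimes>\<^sub>M M. norm (V z) \<le> norm (((V z)\<^sup>2 / 1 + 1) / 2)"
      using abs_le_AM_GM[of 1] by (intro AE_I2) (auto intro: order.trans[OF _ abs_ge_self])
  qed measurable
  have "(\<integral>z. (V z)\<^sup>2 \<partial>(M \<Otimes>\<^sub>M M)) \<le> (\<integral>z. ?b z \<partial>(M \<Otimes>\<^sub>M M))"
    by (intro integral_mono V2 b_int le)
  also have "\<dots> = N\<^sup>2 + N\<^sup>2 / N powr p * (\<integral>z. \<bar>V z\<bar> powr p \<partial>(M \<Otimes>\<^sub>M M))"
    using Vp(1) by (simp add: MM.prob_space)
  also have "\<dots> \<le> N\<^sup>2 + N\<^sup>2 / N powr p * N powr p"
    using Vp(2) by (intro add_left_mono mult_left_mono) auto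
  also have "\<dots> = 2 * N\<^sup>2" using N by simp
  finally show "(\<integral>z. (V z)\<^sup>2 \<partial>(M \<Otimes>\<^sub>M M)) \<le> 2 * N\<^sup>2" .
qed

text \<open>The indices of the sample points in \<open>S\<close> and of those in \<open>T\<close>
  form one admissible pair of index sets. The mean of its sum is the integral over the rectangle
  times the number of off-diagonal pairs.\<close>

lemma mean_cut_max_sample_ge:
  fixes V :: "'a \<times> 'a \<Rightarrow> real" and J :: "'i set"
  assumes J: "finite J" and V: "integrable (M \<Otimes>\<^sub>M M) V" and [measurable]: "S \<in> sets M" "T \<in> sets M"
  shows "card J * (real (card J) - 1) * \<bar>\<integral>z. indicator (S \<times> T) z * V z \<partial>(M \<Otimes>\<^sub>M M)\<bar>
    \<le> (\<integral>x. cut_max J (sample_matrix V x) \<partial>iid M J)"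
proof -
  let ?P = "iid M J"
  define W where "W z = indicator (S \<times> T) z * V z" for z
  define w where "w = (\<integral>z. W z \<partial>(M \<Otimes>\<^sub>M M))"
  have W: "integrable (M \<Otimes>\<^sub>M M) W"
    unfolding W_def using integrable_mult_indicator[OF _ V, of "S \<times> T"] by simp
  have W_int: "integrable ?P (\<lambda>x. sample_matrix W x i j)" if "i \<in> J" "j \<in> J" for i j
    by (rule sample_matrix_integrable[OF W that])
  have "(\<integral>x. (\<Sum>i\<in>J. \<Sum>j\<in>J. sample_matrix W x i j) \<partial>?P) = (\<Sum>i\<in>J. \<Sum>j\<in>J. \<integral>x. sample_matrix W x i j \<partial>?P)"
    using W_int by (subst Bochner_Integration.integral_sum) auto
  also have "\<dots> = (\<Sum>i\<in>J. \<Sum>j\<in>J. if j = i then 0 else w)"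
  proof (intro sum.cong refl)
    fix i j assume "i \<in> J" "j \<in> J"
    then show "(\<integral>x. sample_matrix W x i j \<partial>?P) = (if j = i then 0 else w)"
      using iid_pair_integral(2)[of i J j W] W by (auto simp: sample_matrix_def w_def)
  qed
  also have "\<dots> = (\<Sum>i\<in>J. (real (card J) - 1) * w)"
  proof (intro sum.cong refl)
    fix i assume i: "i \<in> J"
    then have "card J \<ge> 1" using J by (auto simp: Suc_le_eq card_gt_0_iff)
    have "(\<Sum>j\<in>J. if j = i then 0 else w) = (\<Sum>j\<in>J - {i}. w)"
      using J i by (subst sum.remove[OF J i]) (auto intro: sum.cong)
    also have "\<dots> = (real (card J) - 1) * w"
      using J i \<open>card J \<ge> 1\<close> by (simp add: of_nat_diff)
    finally show "(\<Sum>j\<in>J. if j = i then 0 else w) = (real (card J) - 1) * w" .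
  qed
  finally have "(\<integral>x. (\<Sum>i\<in>J. \<Sum>j\<in>J. sample_matrix W x i j) \<partial>?P) = card J * (real (card J) - 1) * w"
    by simp
  moreover have k: "0 \<le> card J * (real (card J) - 1)"
    by (cases "card J") auto
  ultimately have "card J * (real (card J) - 1) * \<bar>w\<bar> = \<bar>\<integral>x. (\<Sum>i\<in>J. \<Sum>j\<in>J. sample_matrix W x i j) \<partial>?P\<bar>"
    using abs_mult[of "card J * (real (card J) - 1)" w] abs_of_nonneg[OF k] by (simp only:)
  also have "\<dots> \<le> (\<integral>x. \<bar>\<Sum>i\<in>J. \<Sum>j\<in>J. sample_matrix W x i j\<bar> \<partial>?P)"
    by (rule integral_abs_bound)
  also have "\<dots> \<le> (\<integral>x. cut_max J (sample_matrix V x) \<partial>?P)"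
  proof (rule integral_mono)
    show "integrable ?P (\<lambda>x. \<bar>\<Sum>i\<in>J. \<Sum>j\<in>J. sample_matrix W x i j\<bar>)"
      using W_int by (intro integrable_abs Bochner_Integration.integrable_sum)
    show "integrable ?P (\<lambda>x. cut_max J (sample_matrix V x))"
      by (rule cut_max_sample_integrable[OF V J order.refl])
    fix x
    let ?A = "{i \<in> J. x i \<in> S}" and ?B = "{j \<in> J. x j \<in> T}"
    have "(\<Sum>i\<in>J. \<Sum>j\<in>J. sample_matrix W x i j) = (\<Sum>i\<in>?A. \<Sum>j\<in>J. sample_matrix W x i j)"
      using J by (intro sum.mono_neutral_right ballI sum.neutral) (auto simp: sample_matrix_def W_def)
    also have "\<dots> = (\<Sum>i\<in>?A. \<Sum>j\<in>?B. sample_matrix W x i j)"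
      using J by (intro sum.cong refl sum.mono_neutral_right) (auto simp: sample_matrix_def W_def)
    also have "\<dots> = (\<Sum>i\<in>?A. \<Sum>j\<in>?B. sample_matrix V x i j)"
      by (intro sum.cong refl) (auto simp: sample_matrix_def W_def)
    finally show "\<bar>\<Sum>i\<in>J. \<Sum>j\<in>J. sample_matrix W x i j\<bar> \<le> cut_max J (sample_matrix V x)"
      using cut_max_upper[OF J, of ?A ?B "sample_matrix V x"] by auto
  qed
  finally show ?thesis by (simp add: w_def W_def)
qed

text \<open>The parameter \<open>\<tau>\<close> measures row sums in units of
  \<open>2 * n * N\<close>: by Markov's inequality for the p-th moment, one row exceeds the
  threshold \<open>d\<close> with probability at most \<open>\<tau> powr - p\<close>. The parameter
  \<open>L\<close> is the exponent demanded of McDiarmid's inequality and determines the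
  deviation.\<close>

lemma cut_max_sample_upper:
  fixes V :: "'a \<times> 'a \<Rightarrow> real" and J :: "'i set" and N p c L \<tau> :: real
  assumes J: "finite J" "J \<noteq> {}" and p: "p \<ge> 2" and N: "N > 0" and V [measurable]: "V \<in> borel_measurable (M \<Otimes>\<^sub>M M)"
    and Vp: "integrable (M \<Otimes>\<^sub>M M) (\<lambda>z. \<bar>V z\<bar> powr p)" "(\<integral>z. \<bar>V z\<bar> powr p \<partial>(M \<Otimes>\<^sub>M M)) \<le> N powr p"
    and cut: "\<And>S T. S \<in> sets M \<Longrightarrow> T \<in> sets M \<Longrightarrow> \<bar>\<integral>z. indicator (S \<times> T) z * V z \<partial>(M \<Otimes>\<^sub>M M)\<bar> \<le> c"
    and \<tau>: "\<tau> > 0" and L: "L > 0"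
  defines "n \<equiv> real (card J)" and "P \<equiv> iid M J"
  shows "measure P {x \<in> space P. cut_max J (sample_matrix V x) > n\<^sup>2 * (c + 8 * N / sqrt n + sqrt (2 * L) * \<tau> * N / sqrt n)}
    \<le> n * \<tau> powr - p + exp (- L)"
proof -
  interpret P: prob_space P unfolding P_def by (rule prob_space_iid)
  have n: "n > 0" using J by (simp add: n_def card_gt_0_iff)
  note kernel = Lp_kernel_integrable[OF p N V Vp]
  define m where "m = (\<integral>x. cut_max J (sample_matrix V x) \<partial>P)"
  define d where "d = 2 * n * \<tau> * N"
  \<comment> \<open>Chosen such that \<open>2 * t\<^sup>2 / (n * d\<^sup>2)\<close> equals
    \<open>L\<close>.\<close>
  define t where "t = d * sqrt (n * L / 2)"
  have d: "d > 0" using n \<tau> N by (simp add: d_def)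
  have t: "t > 0" using d n L by (simp add: t_def)
  have sn: "sqrt n > 0" "sqrt n * sqrt n = n" using n by simp_all
  have "m \<le> n\<^sup>2 * (c + 2 * (\<integral>z. (V z)\<^sup>2 \<partial>(M \<Otimes>\<^sub>M M)) / (sqrt n * N)) + 4 * n * (sqrt n * N)"
  proof -
    \<comment> \<open>This choice of \<open>l\<close> balances the two error terms of the mean: with
      \<open>2 * N\<^sup>2\<close> for the second moment, both become
      \<open>4 * n * sqrt n * N\<close>.\<close>
    have "sqrt n * N > 0" using sn N by simp
    from mean_cut_max_sample_le[where V = V, OF J(1) this kernel(1,2) cut] show ?thesis
      by (simp only: m_def P_def n_def of_nat_power of_nat_mult of_nat_numeral)
  qed
  also have "\<dots> \<le> n\<^sup>2 * (c + 2 * (2 * N\<^sup>2) / (sqrt n * N)) + 4 * n * (sqrt n * N)"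
    using kernel(3) n N by (intro add_right_mono mult_left_mono add_left_mono divide_right_mono) auto
  also have "\<dots> = n\<^sup>2 * (c + 8 * N / sqrt n)"
  proof -
    have "2 * (2 * N\<^sup>2) / (sqrt n * N) = 4 * N / sqrt n"
      using N by (simp add: power2_eq_square)
    moreover have "4 * n * (sqrt n * N) = n\<^sup>2 * (4 * N / sqrt n)"
      using sn by (simp add: field_simps power2_eq_square)
    ultimately show ?thesis by (simp add: algebra_simps)
  qed
  finally have m: "m \<le> n\<^sup>2 * (c + 8 * N / sqrt n)" .
  have t_eq: "t = n\<^sup>2 * (sqrt (2 * L) * \<tau> * N / sqrt n)"
    unfolding t_def d_def by (rule deviation_scaling[OF n])
  have exp_eq: "- 2 * t\<^sup>2 / (card J * d\<^sup>2) = - L"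
    using n L d by (simp add: t_def n_def[symmetric] power_mult_distrib)
  have row: "measure P {x \<in> space P. row_sum J V x i > d} \<le> \<tau> powr - p" if i: "i \<in> J" for i
  proof -
    note mom = row_sum_moment[OF J(1) i _ N V Vp, unfolded of_nat_mult of_nat_numeral, folded P_def n_def]
    have "measure P {x \<in> space P. row_sum J V x i > d}
        \<le> measure P {x \<in> space P. (row_sum J V x i / (2 * n * N)) powr p \<ge> \<tau> powr p}"
    proof (rule P.finite_measure_mono)
      show "{x \<in> space P. row_sum J V x i > d} \<subseteq> {x \<in> space P. (row_sum J V x i / (2 * n * N)) powr p \<ge> \<tau> powr p}"
      proof safe
        fix x assume "row_sum J V x i > d"
        then have "\<tau> \<le> row_sum J V x i / (2 * n * N)"
          using n N by (simp add: d_def field_simps)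
        then show "\<tau> powr p \<le> (row_sum J V x i / (2 * n * N)) powr p"
          using \<tau> p by (intro powr_mono2) auto
      qed
      have "(\<lambda>x. (row_sum J V x i / (2 * n * N)) powr p) \<in> borel_measurable P"
        using mom(1) p by auto
      then show "{x \<in> space P. (row_sum J V x i / (2 * n * N)) powr p \<ge> \<tau> powr p} \<in> sets P"
        by measurable
    qed
    also have "\<dots> \<le> (\<integral>x. (row_sum J V x i / (2 * n * N)) powr p \<partial>P) / \<tau> powr p"
      using mom(1) p \<tau> by (intro integral_Markov_inequality_measure[where A = "space P"]) auto
    also have "\<dots> \<le> 1 / \<tau> powr p"
      using mom(2) p by (intro divide_right_mono) auto
    finally show ?thesis by (simp add: powr_minus_divide)
  qed
  have "measure P {x \<in> space P. cut_max J (sample_matrix V x) > n\<^sup>2 * (c + 8 * N / sqrt n + sqrt (2 * L) * \<tau> * N / sqrt n)}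
      \<le> measure P {x \<in> space P. cut_max J (sample_matrix V x) > m + t}"
  proof (rule P.finite_measure_mono)
    show "{x \<in> space P. cut_max J (sample_matrix V x) > m + t} \<in> sets P"
    proof -
      have "(\<lambda>x. cut_max J (sample_matrix V x)) \<in> borel_measurable P"
        unfolding P_def by (rule cut_max_sample_measurable[OF V J(1) order.refl])
      then show ?thesis by measurable
    qed
    have "n\<^sup>2 * (c + 8 * N / sqrt n + sqrt (2 * L) * \<tau> * N / sqrt n) \<ge> m + t"
      using m unfolding t_eq by (simp only: distrib_left add_right_mono)
    then show "{x \<in> space P. cut_max J (sample_matrix V x) > n\<^sup>2 * (c + 8 * N / sqrt n + sqrt (2 * L) * \<tau> * N / sqrt n)}
        \<subseteq> {x \<in> space P. cut_max J (sample_matrix V x) > m + t}" by auto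
  qed
  also have "\<dots> \<le> exp (- L) + (\<Sum>i\<in>J. measure P {x \<in> space P. row_sum J V x i > d})"
    using cut_max_sample_tails(1)[OF J d t kernel(1)] unfolding exp_eq by (simp add: m_def P_def)
  also have "\<dots> \<le> exp (- L) + (\<Sum>i\<in>J. \<tau> powr - p)"
    by (intro add_left_mono sum_mono row)
  finally show ?thesis by (simp add: n_def)
qed

text \<open>The mean is bounded below through the rectangle \<open>S \<times> T\<close>, the factor
  \<open>1 - 1 / n\<close> accounting for the missing diagonal. The term with
  \<open>\<tau> powr (1 - p)\<close> bounds the total expected excess of the row sums, by which the
  mean of the regularized maximum may fall short.\<close>

lemma cut_max_sample_lower:
  fixes V :: "'a \<times> 'a \<Rightarrow> real" and J :: "'i set" and N p L \<tau> :: real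
  assumes J: "finite J" "J \<noteq> {}" and p: "p \<ge> 2" and N: "N > 0" and V [measurable]: "V \<in> borel_measurable (M \<Otimes>\<^sub>M M)"
    and Vp: "integrable (M \<Otimes>\<^sub>M M) (\<lambda>z. \<bar>V z\<bar> powr p)" "(\<integral>z. \<bar>V z\<bar> powr p \<partial>(M \<Otimes>\<^sub>M M)) \<le> N powr p"
    and ST: "S \<in> sets M" "T \<in> sets M"
    and \<tau>: "\<tau> > 0" and L: "L > 0"
  defines "n \<equiv> real (card J)" and "P \<equiv> iid M J"
    and "v \<equiv> \<bar>\<integral>z. indicator (S \<times> T) z * V z \<partial>(M \<Otimes>\<^sub>M M)\<bar>"
  shows "measure P {x \<in> space P. cut_max J (sample_matrix V x)
      < n\<^sup>2 * ((1 - 1 / n) * v - 2 * N * \<tau> powr (1 - p) - sqrt (2 * L) * \<tau> * N / sqrt n)} \<le> exp (- L)"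
proof -
  interpret P: prob_space P unfolding P_def by (rule prob_space_iid)
  have n: "n > 0" using J by (simp add: n_def card_gt_0_iff)
  note kernel = Lp_kernel_integrable[OF p N V Vp]
  define m where "m = (\<integral>x. cut_max J (sample_matrix V x) \<partial>P)"
  define d where "d = 2 * n * \<tau> * N"
  define t where "t = d * sqrt (n * L / 2)"
  have d: "d > 0" using n \<tau> N by (simp add: d_def)
  have t: "t > 0" using d n L by (simp add: t_def)
  have sn: "sqrt n > 0" "sqrt n * sqrt n = n" using n by simp_all
  have m: "n\<^sup>2 * ((1 - 1 / n) * v) \<le> m"
  proof -
    have "n\<^sup>2 * (1 - 1 / n) = n * (n - 1)"
      using n by (simp add: power2_eq_square right_diff_distrib)
    then have "n\<^sup>2 * ((1 - 1 / n) * v) = n * (n - 1) * v"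
      by (simp only: mult.assoc[symmetric])
    then show ?thesis
      using mean_cut_max_sample_ge[OF J(1) kernel(1) ST] by (simp only: m_def P_def n_def v_def)
  qed
  have t_eq: "t = n\<^sup>2 * (sqrt (2 * L) * \<tau> * N / sqrt n)"
    unfolding t_def d_def by (rule deviation_scaling[OF n])
  have exp_eq: "- 2 * t\<^sup>2 / (card J * d\<^sup>2) = - L"
    using n L d by (simp add: t_def n_def[symmetric] power_mult_distrib)
  have row: "(\<integral>x. max 0 (row_sum J V x i - d) \<partial>P) \<le> d * \<tau> powr - p" if i: "i \<in> J" for i
  proof -
    note mom = row_sum_moment[OF J(1) i _ N V Vp, unfolded of_nat_mult of_nat_numeral, folded P_def n_def]
    define u where "u x = row_sum J V x i / (2 * n * N)" for x
    have u0: "u x \<ge> 0" for x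
      using n N row_sum_nonneg[of J V x i] by (simp add: u_def)
    \<comment> \<open>Beyond the threshold the excess is at most the whole row sum
      \<open>d * (u x / \<tau>)\<close>, and a ratio of at least 1 is bounded by its p-th
      power.\<close>
    have le: "max 0 (row_sum J V x i - d) \<le> d * \<tau> powr - p * u x powr p" for x
    proof (cases "u x \<le> \<tau>")
      case True
      then have "row_sum J V x i \<le> d" using n N by (simp add: u_def d_def field_simps)
      then show ?thesis using d by (simp add: max_def)
    next
      case False
      then have ut: "1 \<le> u x / \<tau>" using \<tau> by simp
      have "row_sum J V x i = d * (u x / \<tau>)" using n N \<tau> by (simp add: u_def d_def)
      also have "u x / \<tau> \<le> (u x / \<tau>) powr p"
        using powr_mono[of 1 p "u x / \<tau>"] ut p u0[of x] \<tau> by simp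
      also have "(u x / \<tau>) powr p = \<tau> powr - p * u x powr p"
        using u0 \<tau> by (simp add: powr_divide powr_minus_divide)
      finally have "row_sum J V x i \<le> d * \<tau> powr - p * u x powr p"
        using d by (simp add: mult.assoc)
      then show ?thesis using d by simp
    qed
    have u_int: "integrable P (\<lambda>x. u x powr p)" "(\<integral>x. u x powr p \<partial>P) \<le> 1"
      using mom p by (simp_all add: u_def)
    have "(\<integral>x. max 0 (row_sum J V x i - d) \<partial>P) \<le> (\<integral>x. d * \<tau> powr - p * u x powr p \<partial>P)"
    proof (rule integral_mono[OF _ _ le])
      show "integrable P (\<lambda>x. max 0 (row_sum J V x i - d))"
        using row_sum_integrable[OF kernel(1) i] unfolding P_def
        by (intro integrable_max Bochner_Integration.integrable_diff) (auto simp: P_def[symmetric])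
    qed (use u_int in simp)
    also have "\<dots> = d * \<tau> powr - p * (\<integral>x. u x powr p \<partial>P)"
      by simp
    also have "\<dots> \<le> d * \<tau> powr - p * 1"
      using u_int(2) d by (intro mult_left_mono) auto
    finally show ?thesis by simp
  qed
  have low: "n\<^sup>2 * ((1 - 1 / n) * v - 2 * N * \<tau> powr (1 - p) - sqrt (2 * L) * \<tau> * N / sqrt n)
      \<le> m - (\<Sum>i\<in>J. \<integral>x. max 0 (row_sum J V x i - d) \<partial>P) - t"
  proof -
    have "(\<Sum>i\<in>J. \<integral>x. max 0 (row_sum J V x i - d) \<partial>P) \<le> (\<Sum>i\<in>J. d * \<tau> powr - p)"
      by (intro sum_mono row)
    also have "\<dots> = n\<^sup>2 * (2 * N * \<tau> powr (1 - p))"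
      using \<tau> by (simp add: n_def[symmetric] d_def powr_diff powr_minus_divide power2_eq_square)
    finally show ?thesis
      using m unfolding t_eq by (simp only: right_diff_distrib)
  qed
  have "measure P {x \<in> space P. cut_max J (sample_matrix V x)
      < n\<^sup>2 * ((1 - 1 / n) * v - 2 * N * \<tau> powr (1 - p) - sqrt (2 * L) * \<tau> * N / sqrt n)}
      \<le> measure P {x \<in> space P. cut_max J (sample_matrix V x) < m - (\<Sum>i\<in>J. \<integral>x. max 0 (row_sum J V x i - d) \<partial>P) - t}"
  proof (rule P.finite_measure_mono)
    have "(\<lambda>x. cut_max J (sample_matrix V x)) \<in> borel_measurable P"
      unfolding P_def by (rule cut_max_sample_measurable[OF V J(1) order.refl])
    then show "{x \<in> space P. cut_max J (sample_matrix V x) < m - (\<Sum>i\<in>J. \<integral>x. max 0 (row_sum J V x i - d) \<partial>P) - t} \<in> sets P"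
      by measurable
  qed (use low in auto)
  also have "\<dots> \<le> exp (- L)"
    using cut_max_sample_tails(2)[OF J d t kernel(1)] unfolding exp_eq by (simp add: m_def P_def)
  finally show ?thesis .
qed

end

section \<open>Kernels on the unit square\<close>

abbreviation (input) uniform_01 :: "real measure" where
  "uniform_01 \<equiv> uniform_measure lborel {0..1}"

lemma prob_space_uniform_01: "prob_space uniform_01"
  by (rule prob_space_uniform_measure) auto

lemma uniform_01_pair_density:
  "uniform_01 \<Otimes>\<^sub>M uniform_01 = density lborel (indicator unit_square)"
proof -
  interpret u: prob_space uniform_01 by (rule prob_space_uniform_01)
  have d: "uniform_01 = density lborel (indicator {0..1})"
    unfolding uniform_measure_def by (intro density_cong) (auto simp: indicator_def)
  have "uniform_01 \<Otimes>\<^sub>M uniform_01 = density (lborel \<Otimes>\<^sub>M lborel) (\<lambda>(x, y). indicator {0..1} x * indicator {0..1} y)"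
    using u.sigma_finite_measure_axioms unfolding d by (intro pair_measure_density) (auto intro: sigma_finite_lborel)
  also have "(\<lambda>(x, y). indicator {0..1::real} x * indicator {0..1::real} y) = (indicator unit_square :: _ \<Rightarrow> ennreal)"
    by (auto simp: fun_eq_iff indicator_def)
  finally show ?thesis by (simp add: lborel_prod)
qed

lemma sets_uniform_01_pair: "sets (uniform_01 \<Otimes>\<^sub>M uniform_01) = sets borel"
  by (simp only: uniform_01_pair_density sets_density sets_lborel)

lemma measurable_uniform_01_pair:
  "f \<in> borel_measurable (uniform_01 \<Otimes>\<^sub>M uniform_01) \<longleftrightarrow> f \<in> borel_measurable borel"
  by (intro arg_cong2[where f = "(\<in>)"] measurable_cong_sets sets_uniform_01_pair refl)

lemma unit_square_sets [measurable]: "unit_square \<in> sets (borel :: (real \<times> real) measure)"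
  by (intro borel_Times) auto

lemma uniform_01_pair_integral:
  fixes f :: "real \<times> real \<Rightarrow> real"
  assumes [measurable]: "f \<in> borel_measurable borel"
  shows "integrable (uniform_01 \<Otimes>\<^sub>M uniform_01) f \<longleftrightarrow> integrable lborel (\<lambda>z. indicator unit_square z * f z)"
    and "(\<integral>z. f z \<partial>(uniform_01 \<Otimes>\<^sub>M uniform_01)) = (\<integral>z. indicator unit_square z * f z \<partial>lborel)"
proof -
  have d: "uniform_01 \<Otimes>\<^sub>M uniform_01 = density lborel (\<lambda>z. ennreal (indicator unit_square z))"
    by (simp add: uniform_01_pair_density ennreal_indicator)
  show "integrable (uniform_01 \<Otimes>\<^sub>M uniform_01) f \<longleftrightarrow> integrable lborel (\<lambda>z. indicator unit_square z * f z)"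
    unfolding d by (subst integrable_density) auto
  show "(\<integral>z. f z \<partial>(uniform_01 \<Otimes>\<^sub>M uniform_01)) = (\<integral>z. indicator unit_square z * f z \<partial>lborel)"
    unfolding d by (subst integral_density) auto
qed

text \<open>The bridge between the completed measure, in which the norms are defined, and the Borel
  product measure, on which the probabilistic estimates are stated.\<close>

lemma lebesgue_on_unit_square_integral:
  fixes f g :: "real \<times> real \<Rightarrow> real"
  assumes [measurable]: "f \<in> borel_measurable borel"
    and g: "g \<in> borel_measurable (lebesgue_on unit_square)"
    and fg: "AE z in lborel. z \<in> unit_square \<longrightarrow> g z = f z"
  shows "integrable (lebesgue_on unit_square) g \<longleftrightarrow> integrable (uniform_01 \<Otimes>\<^sub>M uniform_01) f"
    and "(\<integral>z. g z \<partial>lebesgue_on unit_square) = (\<integral>z. f z \<partial>(uniform_01 \<Otimes>\<^sub>M uniform_01))"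
proof -
  have sq: "unit_square \<inter> space lebesgue \<in> sets lebesgue"
    by (simp add: unit_square_sets)
  have gm: "(\<lambda>z. indicator unit_square z *\<^sub>R g z) \<in> borel_measurable lebesgue"
    using g by (simp only: borel_measurable_restrict_space_iff[OF sq])
  have fm: "(\<lambda>z. indicator unit_square z * f z) \<in> borel_measurable lborel"
    by measurable
  then have fm': "(\<lambda>z. indicator unit_square z * f z) \<in> borel_measurable lebesgue"
    by (rule measurable_completion)
  have ae: "AE z in lebesgue. indicator unit_square z *\<^sub>R g z = indicator unit_square z * f z"
    using AE_completion[OF fg] by eventually_elim (auto simp: indicator_def)
  show "integrable (lebesgue_on unit_square) g \<longleftrightarrow> integrable (uniform_01 \<Otimes>\<^sub>M uniform_01) f"
    unfolding integrable_restrict_space[OF sq] uniform_01_pair_integral(1)[OF assms(1)]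
    using integrable_cong_AE[OF gm fm' ae] integrable_completion[OF fm] by simp
  show "(\<integral>z. g z \<partial>lebesgue_on unit_square) = (\<integral>z. f z \<partial>(uniform_01 \<Otimes>\<^sub>M uniform_01))"
    unfolding integral_restrict_space[OF sq] uniform_01_pair_integral(2)[OF assms(1)]
    using integral_cong_AE[OF gm fm' ae] integral_completion[OF fm] by simp
qed

text \<open>The product of two copies of \<open>uniform_01\<close> has only Borel sets as measurable
  sets, so a Lebesgue measurable kernel has to be replaced before that product measure can be
  used.\<close>

lemma lebesgue_on_unit_square_Borel_version:
  fixes g :: "real \<times> real \<Rightarrow> real"
  assumes g: "g \<in> borel_measurable (lebesgue_on unit_square)"
  obtains f where "f \<in> borel_measurable borel" "AE z in lborel. z \<in> unit_square \<longrightarrow> g z = f z"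
proof -
  have sq: "unit_square \<inter> space lebesgue \<in> sets lebesgue"
    by (simp add: unit_square_sets)
  have "(\<lambda>z. indicator unit_square z *\<^sub>R g z) \<in> borel_measurable lebesgue"
    using g by (simp only: borel_measurable_restrict_space_iff[OF sq])
  from completion_ex_borel_measurable_real[OF this]
  obtain f where f: "f \<in> borel_measurable lborel" "AE z in lborel. indicator unit_square z *\<^sub>R g z = f z"
    by blast
  have "AE z in lborel. z \<in> unit_square \<longrightarrow> g z = f z"
    using f(2) by eventually_elim auto
  with f(1) show ?thesis by (intro that) auto
qed

section \<open>Borel versions of rectangles and the cut norm\<close>

lemma lebesgue_01_Borel_version:
  assumes S: "S \<in> sets (lebesgue_on {0..1::real})"
  obtains S' where "S' \<in> sets borel" "S' \<subseteq> {0..1}" "AE x in lborel. x \<in> S \<longleftrightarrow> x \<in> S'"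
proof -
  have S01: "S \<subseteq> {0..1}" "S \<in> sets lebesgue"
    using S by (auto simp: sets_restrict_space_iff)
  have "(indicator S :: real \<Rightarrow> real) \<in> borel_measurable lebesgue"
    using S01 by simp
  from completion_ex_borel_measurable_real[OF this]
  obtain f where [measurable]: "f \<in> borel_measurable lborel" and f: "AE x in lborel. indicator S x = (f x :: real)"
    by blast
  define S' where "S' = {x \<in> {0..1}. f x = 1}"
  have "S' \<in> sets borel"
  proof -
    have "{x \<in> space lborel. x \<in> {0..1} \<and> f x = 1} \<in> sets lborel" by measurable
    then show ?thesis by (simp add: S'_def)
  qed
  moreover have "AE x in lborel. x \<in> S \<longleftrightarrow> x \<in> S'"
    using f by eventually_elim (use S01 in \<open>auto simp: S'_def indicator_def split: if_splits\<close>)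
  moreover have "S' \<subseteq> {0..1}" by (auto simp: S'_def)
  ultimately show ?thesis by (intro that[of S'])
qed

text \<open>The exceptional points lie in two null strips, one for each coordinate.\<close>

lemma AE_lborel_pair_components:
  assumes P: "AE x in lborel. P (x :: real)" and Q: "AE y in lborel. Q (y :: real)"
  shows "AE z in lborel. P (fst z) \<and> Q (snd z)"
proof -
  obtain A where A: "A \<in> null_sets lborel" "{x \<in> space lborel. \<not> P x} \<subseteq> A"
    using P by (auto elim!: AE_E simp: null_sets_def)
  obtain B where B: "B \<in> null_sets lborel" "{x \<in> space lborel. \<not> Q x} \<subseteq> B"
    using Q by (auto elim!: AE_E simp: null_sets_def)
  have "A \<times> UNIV \<in> null_sets (lborel \<Otimes>\<^sub>M (lborel :: real measure))"
    using A(1) by (intro sigma_finite_measure.times_in_null_sets1 sigma_finite_lborel) auto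
  moreover have "UNIV \<times> B \<in> null_sets ((lborel :: real measure) \<Otimes>\<^sub>M lborel)"
    using B(1) by (intro sigma_finite_measure.times_in_null_sets2 sigma_finite_lborel) auto
  ultimately have "A \<times> UNIV \<union> UNIV \<times> B \<in> null_sets (lborel :: (real \<times> real) measure)"
    by (simp add: lborel_prod null_sets.Un)
  then show ?thesis
    by (rule AE_I') (use A B in auto)
qed

text \<open>Replacing the kernel and both sides of the rectangle by Borel versions changes the
  integrand on a null set only; the measurability of the original integrand is deduced from
  this.\<close>

lemma set_integral_lebesgue_Borel_version:
  fixes f g :: "real \<times> real \<Rightarrow> real"
  assumes f [measurable]: "f \<in> borel_measurable borel" and fg: "AE z in lborel. z \<in> unit_square \<longrightarrow> g z = f z"
    and S: "S \<subseteq> {0..1}" "S' \<subseteq> {0..1}" "S' \<in> sets borel" "AE x in lborel. x \<in> S \<longleftrightarrow> x \<in> S'"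
    and T: "T \<subseteq> {0..1}" "T' \<subseteq> {0..1}" "T' \<in> sets borel" "AE x in lborel. x \<in> T \<longleftrightarrow> x \<in> T'"
  shows "(LINT z:S \<times> T|lebesgue. g z) = (\<integral>z. indicator (S' \<times> T') z * f z \<partial>lborel)"
    and "(LINT z:S \<times> T|lebesgue. g z) = (\<integral>z. indicator (S' \<times> T') z * f z \<partial>(uniform_01 \<Otimes>\<^sub>M uniform_01))"
proof -
  have [measurable]: "S' \<times> T' \<in> sets borel"
    using S T by (intro borel_Times)
  have fm: "(\<lambda>z. indicator (S' \<times> T') z * f z) \<in> borel_measurable lborel"
    by measurable
  then have fm': "(\<lambda>z. indicator (S' \<times> T') z * f z) \<in> borel_measurable lebesgue"
    by (rule measurable_completion)
  have "AE z in lborel. indicator (S' \<times> T') z * f z = indicator (S \<times> T) z *\<^sub>R g z"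
    using AE_lborel_pair_components[OF S(4) T(4)] fg
  proof eventually_elim
    case (elim z)
    then show ?case using S(1,2) T(1,2) by (cases z) (auto simp: indicator_def subset_eq)
  qed
  then have ae: "AE z in lebesgue. indicator (S' \<times> T') z * f z = indicator (S \<times> T) z *\<^sub>R g z"
    by (rule AE_completion)
  then have "(\<lambda>z. indicator (S \<times> T) z *\<^sub>R g z) \<in> borel_measurable lebesgue"
    by (rule borel_measurable_AE[OF fm'])
  then have "(LINT z:S \<times> T|lebesgue. g z) = (\<integral>z. indicator (S' \<times> T') z * f z \<partial>lebesgue)"
    unfolding set_lebesgue_integral_def using ae fm' by (intro integral_cong_AE) (auto elim: eventually_mono)
  then show 1: "(LINT z:S \<times> T|lebesgue. g z) = (\<integral>z. indicator (S' \<times> T') z * f z \<partial>lborel)"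
    using integral_completion[OF fm] by simp
  have "(\<integral>z. indicator unit_square z * (indicator (S' \<times> T') z * f z) \<partial>lborel) = (\<integral>z. indicator (S' \<times> T') z * f z \<partial>lborel)"
    using S(2) T(2) by (intro Bochner_Integration.integral_cong) (auto simp: indicator_def)
  with 1 show "(LINT z:S \<times> T|lebesgue. g z) = (\<integral>z. indicator (S' \<times> T') z * f z \<partial>(uniform_01 \<Otimes>\<^sub>M uniform_01))"
    by (subst uniform_01_pair_integral(2)) auto
qed

lemma Borel_lebesgue_on_01: "S \<in> sets borel \<Longrightarrow> S \<subseteq> {0..1} \<Longrightarrow> S \<in> sets (lebesgue_on {0..1::real})"
  by (auto simp: sets_restrict_space_iff)

text \<open>A supremum of reals dominates its members only when the set is bounded above; here the
  L1 norm of \<open>f\<close> is an upper bound, which is where integrability enters. Arbitrary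
  Borel sides are first cut down to the unit interval.\<close>

lemma cut_norm_upper:
  fixes f g :: "real \<times> real \<Rightarrow> real"
  assumes f: "f \<in> borel_measurable borel" and fg: "AE z in lborel. z \<in> unit_square \<longrightarrow> g z = f z"
    and int: "integrable (uniform_01 \<Otimes>\<^sub>M uniform_01) f"
    and ST: "S \<in> sets borel" "T \<in> sets borel"
  shows "\<bar>\<integral>z. indicator (S \<times> T) z * f z \<partial>(uniform_01 \<Otimes>\<^sub>M uniform_01)\<bar> \<le> cut_norm g"
proof -
  let ?u = "uniform_01 \<Otimes>\<^sub>M uniform_01"
  let ?S = "S \<inter> {0..1}" and ?T = "T \<inter> {0..1}"
  have bd: "\<bar>LINT z:A \<times> B|lebesgue. g z\<bar> \<le> (\<integral>z. \<bar>f z\<bar> \<partial>?u)"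
    if A: "A \<in> sets (lebesgue_on {0..1})" and B: "B \<in> sets (lebesgue_on {0..1})" for A B
  proof -
    obtain A' where A': "A' \<in> sets borel" "A' \<subseteq> {0..1}" "AE x in lborel. x \<in> A \<longleftrightarrow> x \<in> A'"
      by (rule lebesgue_01_Borel_version[OF A])
    obtain B' where B': "B' \<in> sets borel" "B' \<subseteq> {0..1}" "AE x in lborel. x \<in> B \<longleftrightarrow> x \<in> B'"
      by (rule lebesgue_01_Borel_version[OF B])
    have AB: "A \<subseteq> {0..1}" "B \<subseteq> {0..1}" using A B by (auto simp: sets_restrict_space_iff)
    have "A' \<times> B' \<in> sets ?u" using A' B' by (simp add: sets_uniform_01_pair borel_Times)
    then have i: "integrable ?u (\<lambda>z. indicator (A' \<times> B') z * f z)"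
      using integrable_mult_indicator[OF _ int, of "A' \<times> B'"] by simp
    have "\<bar>LINT z:A \<times> B|lebesgue. g z\<bar> = \<bar>\<integral>z. indicator (A' \<times> B') z * f z \<partial>?u\<bar>"
      using set_integral_lebesgue_Borel_version(2)[OF f fg AB(1) A'(2,1,3) AB(2) B'(2,1,3)] by simp
    also have "\<dots> \<le> (\<integral>z. \<bar>indicator (A' \<times> B') z * f z\<bar> \<partial>?u)" by (rule integral_abs_bound)
    also have "\<dots> \<le> (\<integral>z. \<bar>f z\<bar> \<partial>?u)"
      using i int by (intro integral_mono) (auto simp: indicator_def)
    finally show ?thesis .
  qed
  have "(\<integral>z. indicator (S \<times> T) z * f z \<partial>?u) = (\<integral>z. indicator unit_square z * (indicator (S \<times> T) z * f z) \<partial>lborel)"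
    using f ST by (intro uniform_01_pair_integral(2)) (auto intro!: borel_measurable_times borel_measurable_indicator borel_Times)
  also have "\<dots> = (\<integral>z. indicator (?S \<times> ?T) z * f z \<partial>lborel)"
    by (intro Bochner_Integration.integral_cong) (auto simp: indicator_def)
  also have "\<dots> = (LINT z:?S \<times> ?T|lebesgue. g z)"
    using ST by (intro set_integral_lebesgue_Borel_version(1)[OF f fg, symmetric]) auto
  finally have eq: "\<bar>\<integral>z. indicator (S \<times> T) z * f z \<partial>?u\<bar> = \<bar>LINT z:?S \<times> ?T|lebesgue. g z\<bar>" by simp
  show ?thesis
    unfolding cut_norm_def eq case_prod_unfold
    using ST bd by (intro cSUP_upper2[where x = "(?S, ?T)"] bdd_aboveI2[where M = "\<integral>z. \<bar>f z\<bar> \<partial>?u"])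
      (auto intro!: Borel_lebesgue_on_01)
qed

lemma cut_norm_approx:
  fixes f g :: "real \<times> real \<Rightarrow> real"
  assumes f: "f \<in> borel_measurable borel" and fg: "AE z in lborel. z \<in> unit_square \<longrightarrow> g z = f z"
    and c: "c < cut_norm g"
  obtains S T where "S \<in> sets borel" "T \<in> sets borel"
    "c < \<bar>\<integral>z. indicator (S \<times> T) z * f z \<partial>(uniform_01 \<Otimes>\<^sub>M uniform_01)\<bar>"
proof -
  have "\<exists>(A, B)\<in>sets (lebesgue_on {0..1}) \<times> sets (lebesgue_on {0..1}). c < \<bar>LINT z:A \<times> B|lebesgue. g z\<bar>"
  proof (rule ccontr)
    assume "\<not> ?thesis"
    then have "cut_norm g \<le> c"
      unfolding cut_norm_def by (intro cSUP_least) (auto simp: not_less)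
    with c show False by simp
  qed
  then obtain A B where A: "A \<in> sets (lebesgue_on {0..1})" and B: "B \<in> sets (lebesgue_on {0..1})"
    and AB: "c < \<bar>LINT z:A \<times> B|lebesgue. g z\<bar>" by auto
  obtain A' where A': "A' \<in> sets borel" "A' \<subseteq> {0..1}" "AE x in lborel. x \<in> A \<longleftrightarrow> x \<in> A'"
    by (rule lebesgue_01_Borel_version[OF A])
  obtain B' where B': "B' \<in> sets borel" "B' \<subseteq> {0..1}" "AE x in lborel. x \<in> B \<longleftrightarrow> x \<in> B'"
    by (rule lebesgue_01_Borel_version[OF B])
  have s: "A \<subseteq> {0..1}" "B \<subseteq> {0..1}" using A B by (auto simp: sets_restrict_space_iff)
  show ?thesis
    using AB set_integral_lebesgue_Borel_version(2)[OF f fg s(1) A'(2,1,3) s(2) B'(2,1,3)]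
    by (intro that[OF A'(1) B'(1)]) simp
qed

section \<open>Cut norms of step functions\<close>

lemma weighted_sum_le_positive_part:
  fixes \<alpha> w :: "'i \<Rightarrow> real"
  assumes "finite K" "\<And>i. i \<in> K \<Longrightarrow> 0 \<le> \<alpha> i \<and> \<alpha> i \<le> c"
  shows "(\<Sum>i\<in>K. \<alpha> i * w i) \<le> c * (\<Sum>i\<in>{i \<in> K. w i > 0}. w i)"
proof -
  have "(\<Sum>i\<in>K. \<alpha> i * w i) \<le> (\<Sum>i\<in>K. if w i > 0 then c * w i else 0)"
    using assms by (intro sum_mono) (auto intro: mult_right_mono simp: mult_nonneg_nonpos)
  also have "\<dots> = c * (\<Sum>i\<in>{i \<in> K. w i > 0}. w i)"
    unfolding sum_distrib_left using assms(1) by (simp add: sum.inter_filter)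
  finally show ?thesis .
qed

text \<open>A bilinear form on a box attains its extremes at vertices: for fixed
  \<open>\<beta>\<close> the weights \<open>\<alpha>\<close> are pushed to 0 or \<open>c\<close>,
  which produces \<open>A\<close>, and then the same is done with \<open>\<beta>\<close>, which
  produces \<open>B\<close>.\<close>

lemma bilinear_le_cut_max:
  fixes \<alpha> \<beta> :: "'i \<Rightarrow> real" and c :: real
  assumes K: "finite K" and \<alpha>: "\<And>i. i \<in> K \<Longrightarrow> 0 \<le> \<alpha> i \<and> \<alpha> i \<le> c" and \<beta>: "\<And>i. i \<in> K \<Longrightarrow> 0 \<le> \<beta> i \<and> \<beta> i \<le> c"
    and c: "0 \<le> c"
  shows "\<bar>\<Sum>i\<in>K. \<Sum>j\<in>K. a i j * (\<alpha> i * \<beta> j)\<bar> \<le> c\<^sup>2 * cut_max K a"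
proof -
  obtain s :: real where s: "s \<in> {- 1, 1}"
    and abs: "\<bar>\<Sum>i\<in>K. \<Sum>j\<in>K. a i j * (\<alpha> i * \<beta> j)\<bar> = s * (\<Sum>i\<in>K. \<Sum>j\<in>K. a i j * (\<alpha> i * \<beta> j))"
    using abs_eq_sign_mult by blast
  define w where "w i = (\<Sum>j\<in>K. \<beta> j * (s * a i j))" for i
  define A where "A = {i \<in> K. w i > 0}"
  define v where "v j = (\<Sum>i\<in>A. s * a i j)" for j
  define B where "B = {j \<in> K. v j > 0}"
  have "s * (\<Sum>i\<in>K. \<Sum>j\<in>K. a i j * (\<alpha> i * \<beta> j)) = (\<Sum>i\<in>K. \<alpha> i * w i)"
    by (simp add: w_def sum_distrib_left mult_ac)
  also have "\<dots> \<le> c * (\<Sum>i\<in>A. w i)"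
    unfolding A_def by (rule weighted_sum_le_positive_part[OF K \<alpha>])
  also have "(\<Sum>i\<in>A. w i) = (\<Sum>j\<in>K. \<beta> j * v j)"
    unfolding w_def v_def sum_distrib_left by (rule sum.swap)
  also have "c * (\<Sum>j\<in>K. \<beta> j * v j) \<le> c * (c * (\<Sum>j\<in>B. v j))"
    unfolding B_def by (intro mult_left_mono weighted_sum_le_positive_part[OF K \<beta>] c)
  also have "(\<Sum>j\<in>B. v j) = s * (\<Sum>i\<in>A. \<Sum>j\<in>B. a i j)"
    unfolding v_def sum_distrib_left by (rule sum.swap)
  also have "\<dots> \<le> \<bar>\<Sum>i\<in>A. \<Sum>j\<in>B. a i j\<bar>" using s by auto
  also have "\<dots> \<le> cut_max K a"
    by (rule cut_max_upper[OF K]) (auto simp: A_def B_def)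
  finally show ?thesis
    using c by (simp add: abs power2_eq_square mult.assoc mult_left_mono)
qed

lemma step_interval_subset: "i \<in> {1..k} \<Longrightarrow> step_interval k i \<subseteq> {0..1}"
proof
  fix x assume i: "i \<in> {1..k}" and x: "x \<in> step_interval k i"
  then have "0 \<le> (real i - 1) / real k" "real i / real k \<le> 1" by auto
  with x show "x \<in> {0..1}" by (auto simp: step_interval_def)
qed

lemma step_interval_sets [measurable, simp]: "step_interval k i \<in> sets borel"
  by (simp add: step_interval_def)

lemma measure_step_interval: "k > 0 \<Longrightarrow> measure lborel (step_interval k i) = 1 / real k"
  by (simp add: step_interval_def divide_right_mono flip: diff_divide_distrib)

lemma step_interval_disjoint:
  assumes k: "k > 0" and x: "x \<in> step_interval k i" "x \<in> step_interval k j"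
  shows "i = j"
proof -
  have "real i - 1 \<le> x * real k" "x * real k < real i" "real j - 1 \<le> x * real k" "x * real k < real j"
    using k x by (auto simp: step_interval_def field_simps)
  then have "real i < real j + 1" "real j < real i + 1" by linarith+
  then show ?thesis by linarith
qed

lemma measure_lborel_Times:
  fixes A B :: "real set"
  assumes "A \<in> sets borel" "B \<in> sets borel"
  shows "measure lborel (A \<times> B) = measure lborel A * measure lborel B"
proof -
  have "emeasure (lborel \<Otimes>\<^sub>M lborel) (A \<times> B) = emeasure lborel A * emeasure lborel B"
    using assms by (intro sigma_finite_measure.emeasure_pair_measure_Times sigma_finite_lborel) auto
  then show ?thesis
    by (simp add: measure_def lborel_prod enn2real_mult)
qed

lemma sample_eq_sample_matrix:
  "sample k U x z = (\<Sum>i\<in>{1..k}. \<Sum>j\<in>{1..k}. sample_matrix U x i j * indicator (step_interval k i \<times> step_interval k j) z)"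
  by (simp add: sample_def sample_matrix_def)

lemma sample_measurable [measurable]: "sample k U x \<in> borel_measurable borel"
  unfolding sample_eq_sample_matrix[abs_def]
  by (intro borel_measurable_sum borel_measurable_times borel_measurable_const borel_measurable_indicator borel_Times) auto

lemma sample_integral_rectangle:
  assumes S: "S \<in> sets borel" and T: "T \<in> sets borel"
  shows "(\<integral>z. indicator (S \<times> T) z * sample k U x z \<partial>lborel)
    = (\<Sum>i\<in>{1..k}. \<Sum>j\<in>{1..k}. sample_matrix U x i j * (measure lborel (S \<inter> step_interval k i) * measure lborel (T \<inter> step_interval k j)))"
proof -
  let ?R = "\<lambda>i j. (S \<inter> step_interval k i) \<times> (T \<inter> step_interval k j)"
  have R: "?R i j \<in> sets borel" for i j
    using S T by (intro borel_Times) auto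
  have int: "integrable lborel (indicator (?R i j) :: _ \<Rightarrow> real)" for i j
  proof -
    have "bounded (?R i j)"
      by (rule bounded_subset[of "{(real i - 1) / k..real i / k} \<times> {(real j - 1) / k..real j / k}"])
        (auto simp: step_interval_def bounded_Times)
    then show ?thesis
      using R emeasure_bounded_finite by (intro integrable_real_indicator) auto
  qed
  have "(\<integral>z. indicator (S \<times> T) z * sample k U x z \<partial>lborel)
      = (\<integral>z. (\<Sum>i\<in>{1..k}. \<Sum>j\<in>{1..k}. sample_matrix U x i j * indicator (?R i j) z) \<partial>lborel)"
    unfolding sample_eq_sample_matrix sum_distrib_left
    by (intro Bochner_Integration.integral_cong refl sum.cong) (auto simp: indicator_def)
  also have "\<dots> = (\<Sum>i\<in>{1..k}. \<Sum>j\<in>{1..k}. sample_matrix U x i j * measure lborel (?R i j))"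
  proof -
    have "(\<integral>z. (\<Sum>i\<in>{1..k}. \<Sum>j\<in>{1..k}. sample_matrix U x i j * indicator (?R i j) z) \<partial>lborel)
        = (\<Sum>i\<in>{1..k}. \<integral>z. (\<Sum>j\<in>{1..k}. sample_matrix U x i j * indicator (?R i j) z) \<partial>lborel)"
      by (intro Bochner_Integration.integral_sum Bochner_Integration.integrable_sum integrable_mult_right int)
    also have "\<dots> = (\<Sum>i\<in>{1..k}. \<Sum>j\<in>{1..k}. \<integral>z. sample_matrix U x i j * indicator (?R i j) z \<partial>lborel)"
      by (intro sum.cong refl Bochner_Integration.integral_sum integrable_mult_right int)
    also have "\<dots> = (\<Sum>i\<in>{1..k}. \<Sum>j\<in>{1..k}. sample_matrix U x i j * measure lborel (?R i j))"
    proof -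
      have "integral\<^sup>L lborel (indicator (?R i j) :: _ \<Rightarrow> real) = measure lborel (?R i j)" for i j
        by simp
      then show ?thesis by (simp only: integral_mult_right_zero)
    qed
    finally show ?thesis .
  qed
  also have "\<dots> = (\<Sum>i\<in>{1..k}. \<Sum>j\<in>{1..k}. sample_matrix U x i j * (measure lborel (S \<inter> step_interval k i) * measure lborel (T \<inter> step_interval k j)))"
    using S T by (subst measure_lborel_Times) auto
  finally show ?thesis .
qed

text \<open>Integration over a rectangle weights the entry at \<open>i\<close> and \<open>j\<close>
  by the measures of the parts of the two sides in steps \<open>i\<close> and \<open>j\<close>.
  These weights lie between 0 and \<open>1 / k\<close>, and \<open>bilinear_le_cut_max\<close>
  applies. Conversely, unions of steps realize every pair of index sets.\<close>

lemma cut_norm_sample: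
  assumes k: "k > 0"
  shows "cut_norm (sample k U x) = cut_max {1..k} (sample_matrix U x) / (real k)\<^sup>2"
proof (rule order.antisym)
  let ?K = "{1..k}" and ?a = "sample_matrix U x" and ?I = "step_interval k"
  have \<alpha>: "0 \<le> measure lborel (S \<inter> ?I i) \<and> measure lborel (S \<inter> ?I i) \<le> 1 / k" if "S \<in> sets borel" for S i
  proof -
    have "emeasure lborel (?I i) < \<infinity>" by (intro emeasure_bounded_finite) (simp add: step_interval_def)
    then have "measure lborel (S \<inter> ?I i) \<le> measure lborel (?I i)"
      using that by (intro measure_mono_fmeasurable) (auto simp: fmeasurable_def)
    with k show ?thesis by (simp add: measure_step_interval)
  qed
  have rect: "\<bar>\<integral>z. indicator (S \<times> T) z * sample k U x z \<partial>lborel\<bar> \<le> cut_max ?K ?a / (real k)\<^sup>2"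
    if "S \<in> sets borel" "T \<in> sets borel" for S T
    unfolding sample_integral_rectangle[OF that]
    using bilinear_le_cut_max[of ?K "\<lambda>i. measure lborel (S \<inter> ?I i)" "1 / k" "\<lambda>j. measure lborel (T \<inter> ?I j)" ?a] \<alpha> that
    by (simp add: power_one_over)
  have ae: "AE z in lborel. z \<in> unit_square \<longrightarrow> sample k U x z = sample k U x z" by simp
  show "cut_norm (sample k U x) \<le> cut_max ?K ?a / (real k)\<^sup>2"
  proof (rule ccontr)
    assume "\<not> ?thesis"
    then have "cut_max ?K ?a / (real k)\<^sup>2 < cut_norm (sample k U x)" by simp
    then obtain S T where ST: "S \<in> sets borel" "T \<in> sets borel"
      "cut_max ?K ?a / (real k)\<^sup>2 < \<bar>\<integral>z. indicator (S \<times> T) z * sample k U x z \<partial>(uniform_01 \<Otimes>\<^sub>M uniform_01)\<bar>"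
      by (rule cut_norm_approx[OF sample_measurable ae])
    have "(\<integral>z. indicator (S \<times> T) z * sample k U x z \<partial>(uniform_01 \<Otimes>\<^sub>M uniform_01))
        = (\<integral>z. indicator unit_square z * (indicator (S \<times> T) z * sample k U x z) \<partial>lborel)"
      using ST by (intro uniform_01_pair_integral(2) borel_measurable_times borel_measurable_indicator borel_Times sample_measurable)
    also have "\<dots> = (\<integral>z. indicator ((S \<inter> {0..1}) \<times> (T \<inter> {0..1})) z * sample k U x z \<partial>lborel)"
      by (intro Bochner_Integration.integral_cong) (auto simp: indicator_def)
    finally show False using rect[of "S \<inter> {0..1}" "T \<inter> {0..1}"] ST by simp
  qed
  \<comment> \<open>Boundedness is established before a single rectangle is compared with the
    supremum of reals.\<close>
  have bdd: "bdd_above ((\<lambda>(S, T). \<bar>LINT z:S \<times> T|lebesgue. sample k U x z\<bar>) ` (sets (lebesgue_on {0..1}) \<times> sets (lebesgue_on {0..1})))"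
  proof (rule bdd_aboveI2, clarify)
    fix S T assume S: "S \<in> sets (lebesgue_on {0..1::real})" and T: "T \<in> sets (lebesgue_on {0..1::real})"
    obtain S' where S': "S' \<in> sets borel" "S' \<subseteq> {0..1}" "AE x in lborel. x \<in> S \<longleftrightarrow> x \<in> S'"
      by (rule lebesgue_01_Borel_version[OF S])
    obtain T' where T': "T' \<in> sets borel" "T' \<subseteq> {0..1}" "AE x in lborel. x \<in> T \<longleftrightarrow> x \<in> T'"
      by (rule lebesgue_01_Borel_version[OF T])
    have ST: "S \<subseteq> {0..1}" "T \<subseteq> {0..1}" using S T by (auto simp: sets_restrict_space_iff)
    show "\<bar>LINT z:S \<times> T|lebesgue. sample k U x z\<bar> \<le> cut_max ?K ?a / (real k)\<^sup>2"
      using set_integral_lebesgue_Borel_version(1)[OF sample_measurable ae ST(1) S'(2,1,3) ST(2) T'(2,1,3)] rect[OF S'(1) T'(1)]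
      by simp
  qed
  have "cut_max ?K ?a \<le> (real k)\<^sup>2 * cut_norm (sample k U x)"
  proof (rule cut_max_least)
    fix A B assume A: "A \<subseteq> ?K" and B: "B \<subseteq> ?K"
    define S where "S A = (\<Union>i\<in>A. ?I i)" for A
    have S_sets: "S A \<in> sets borel" "S A \<subseteq> {0..1}" if "A \<subseteq> ?K" for A
      using that finite_subset[OF that] step_interval_subset[of _ k] unfolding S_def by (blast intro!: sets.finite_UN step_interval_sets)+
    have S_measure: "measure lborel (S A \<inter> ?I i) = (if i \<in> A then 1 / k else 0)" if "A \<subseteq> ?K" for A i
    proof (cases "i \<in> A")
      case True
      then have "S A \<inter> ?I i = ?I i" by (auto simp: S_def)
      with True k show ?thesis by (simp add: measure_step_interval)
    next
      case False
      then have "S A \<inter> ?I i = {}" using step_interval_disjoint[OF k] by (auto simp: S_def)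
      with False show ?thesis by simp
    qed
    have "(LINT z:S A \<times> S B|lebesgue. sample k U x z) = (\<integral>z. indicator (S A \<times> S B) z * sample k U x z \<partial>lborel)"
      using S_sets[OF A] S_sets[OF B] by (intro set_integral_lebesgue_Borel_version(1) sample_measurable) auto
    also have "\<dots> = (\<Sum>i\<in>?K. \<Sum>j\<in>?K. if i \<in> A then (if j \<in> B then ?a i j / (real k)\<^sup>2 else 0) else 0)"
      unfolding sample_integral_rectangle[OF S_sets(1)[OF A] S_sets(1)[OF B]] S_measure[OF A] S_measure[OF B]
      by (intro sum.cong refl) (simp add: power2_eq_square)
    also have "\<dots> = (\<Sum>i\<in>?K. if i \<in> A then (\<Sum>j\<in>B. ?a i j / (real k)\<^sup>2) else 0)"
      using B by (intro sum.cong refl) (auto simp: sum.inter_restrict[symmetric] Int_absorb1)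
    also have "\<dots> = (\<Sum>i\<in>A. \<Sum>j\<in>B. ?a i j / (real k)\<^sup>2)"
      using A by (simp add: sum.inter_restrict[symmetric] Int_absorb1)
    also have "\<dots> = (\<Sum>i\<in>A. \<Sum>j\<in>B. ?a i j) / (real k)\<^sup>2"
      by (simp add: sum_divide_distrib)
    finally have "\<bar>\<Sum>i\<in>A. \<Sum>j\<in>B. ?a i j\<bar> = (real k)\<^sup>2 * \<bar>LINT z:S A \<times> S B|lebesgue. sample k U x z\<bar>"
      using k by (simp add: abs_divide)
    also have "\<bar>LINT z:S A \<times> S B|lebesgue. sample k U x z\<bar> \<le> cut_norm (sample k U x)"
      unfolding cut_norm_def using S_sets[OF A] S_sets[OF B]
      by (intro cSUP_upper2[OF bdd, of "(S A, S B)"]) (auto intro!: Borel_lebesgue_on_01)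
    finally show "\<bar>\<Sum>i\<in>A. \<Sum>j\<in>B. ?a i j\<bar> \<le> (real k)\<^sup>2 * cut_norm (sample k U x)"
      by (simp add: mult_left_mono)
  qed simp
  then show "cut_max ?K ?a / (real k)\<^sup>2 \<le> cut_norm (sample k U x)"
    using k by (simp add: divide_le_eq mult.commute)
qed

section \<open>The deviation bounds\<close>

text \<open>In the deviation term the exponents agree exactly: \<open>1 / p + \<phi> - 1 / 2\<close>
  is \<open>- ((p - 3) / (4 * p) - \<phi>)\<close> plus \<open>- 1 / 4 + 1 / (4 * p)\<close>. The
  claimed bound is larger only through its constants and, in the error of the mean, through
  replacing the exponent \<open>- 1 / 2\<close> by \<open>- 1 / 4 + 1 / (4 * p)\<close>.\<close>

lemma upper_deviation_numeric:
  fixes k p \<phi> N U1 :: real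
  assumes k: "k \<ge> 2" and p: "p > 2" and \<phi>: "\<phi> > 0" and N: "N \<ge> 0" and U1: "U1 \<ge> 0"
  shows "8 * N / sqrt k + sqrt (2 * (\<phi> * p * ln k)) * k powr (1 / p + \<phi>) * N / sqrt k
    \<le> (30 * N + 6 * sqrt (2 * \<phi> * p) * (U1 + 2 * N) * (sqrt (ln k) / k powr ((p - 3) / (4 * p) - \<phi>)))
      * k powr (- 1 / 4 + 1 / (4 * p))"
proof -
  let ?f = "- 1 / 4 + 1 / (4 * p)" and ?e = "(p - 3) / (4 * p) - \<phi>"
  have sk: "1 / sqrt k = k powr (- 1 / 2)"
    using k by (simp add: powr_minus_divide powr_half_sqrt)
  have "8 * N / sqrt k = 8 * N * k powr (- 1 / 2)"
    unfolding sk[symmetric] by simp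
  also have "\<dots> \<le> 30 * N * k powr ?f"
  proof -
    have "0 \<le> 1 / (4 * p)" using p by simp
    then have "- 1 / 2 \<le> ?f" by linarith
    then have "k powr (- 1 / 2) \<le> k powr ?f" using k by (intro powr_mono) auto
    then show ?thesis using N by (intro mult_mono) auto
  qed
  finally have 1: "8 * N / sqrt k \<le> 30 * N * k powr ?f" .
  have expo: "1 / p + \<phi> + - 1 / 2 = - ?e + ?f"
    using p by (simp add: field_simps)
  have "sqrt (2 * (\<phi> * p * ln k)) = sqrt (2 * \<phi> * p) * sqrt (ln k)"
    by (simp add: real_sqrt_mult mult.assoc)
  then have "sqrt (2 * (\<phi> * p * ln k)) * k powr (1 / p + \<phi>) * N / sqrt k
      = sqrt (2 * \<phi> * p) * sqrt (ln k) * (k powr (1 / p + \<phi>) * (1 / sqrt k)) * N"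
    by simp
  also have "k powr (1 / p + \<phi>) * (1 / sqrt k) = k powr - ?e * k powr ?f"
    unfolding sk powr_add[symmetric] expo ..
  also have "sqrt (2 * \<phi> * p) * sqrt (ln k) * (k powr - ?e * k powr ?f) * N
      \<le> sqrt (2 * \<phi> * p) * sqrt (ln k) * (k powr - ?e * k powr ?f) * (6 * (U1 + 2 * N))"
    using k p \<phi> N U1 by (intro mult_left_mono mult_nonneg_nonneg) auto
  also have "\<dots> = 6 * sqrt (2 * \<phi> * p) * (U1 + 2 * N) * (sqrt (ln k) / k powr ?e) * k powr ?f"
  proof -
    have "a * b * (1 / e * f) * (6 * u) = 6 * a * u * (b / e) * f" for a b e f u :: real by simp
    then show ?thesis unfolding powr_minus_divide by blast
  qed
  finally have 2: "sqrt (2 * (\<phi> * p * ln k)) * k powr (1 / p + \<phi>) * N / sqrt k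
      \<le> 6 * sqrt (2 * \<phi> * p) * (U1 + 2 * N) * (sqrt (ln k) / k powr ?e) * k powr ?f" .
  show ?thesis
    using add_mono[OF 1 2] by (simp only: distrib_right)
qed

text \<open>With \<open>s\<close> the square root of \<open>2 * (\<gamma> * p - 1) * ln k\<close>,
  three losses are measured in units of \<open>s * N * k powr (- 1 / 2 + \<gamma>)\<close>: one unit
  for a rectangle that falls short of the cut norm, two for the excess of the row sums, one for the
  deviation. These four units fit below the claimed term with \<open>6 * (U1 + 2 * N)\<close>; the
  loss \<open>C / k\<close> caused by the diagonal is covered by the claimed term with
  \<open>C\<close>.\<close>

lemma lower_deviation_numeric:
  fixes k p \<gamma> N U1 C v :: real
  assumes k: "k \<ge> 2" and p: "p > 2" and \<gamma>: "1 / p < \<gamma>" and N: "N \<ge> 0" and U1: "U1 \<ge> 0" and C: "C \<ge> 0"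
    and L: "1 \<le> (\<gamma> * p - 1) * ln k"
    and v: "C - sqrt (2 * ((\<gamma> * p - 1) * ln k)) * N * k powr (- 1 / 2 + \<gamma>) \<le> v"
  shows "C - (C + 6 * sqrt (2 * (\<gamma> * p - 1)) * (U1 + 2 * N)) * k powr (- 1 / 2 + \<gamma>) * sqrt (ln k)
    \<le> (1 - 1 / k) * v - 2 * N * (k powr \<gamma>) powr (1 - p) - sqrt (2 * ((\<gamma> * p - 1) * ln k)) * k powr \<gamma> * N / sqrt k"
proof -
  let ?L = "(\<gamma> * p - 1) * ln k" and ?K = "k powr (- 1 / 2 + \<gamma>)"
  define s where "s = sqrt (2 * ?L)"
  have \<gamma>p: "\<gamma> * p > 1" using \<gamma> p by (simp add: field_simps)
  have \<gamma>0: "\<gamma> > 0" using \<gamma> p by (meson divide_pos_pos less_trans zero_less_one zero_less_numeral)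
  \<comment> \<open>The excess of the row sums carries no logarithm; it is absorbed into the units
    because \<open>s\<close> is at least 1.\<close>
  have s: "1 \<le> s" using L by (simp add: s_def)
  have s_eq: "s = sqrt (2 * (\<gamma> * p - 1)) * sqrt (ln k)"
    by (simp only: s_def mult.assoc[symmetric] real_sqrt_mult[of "2 * (\<gamma> * p - 1)"])
  have lnk: "1 / 2 \<le> ln k"
  proof -
    have "1 - 1 / k \<le> ln k" using ln_one_minus_pos_upper_bound[of "1 - 1 / k"] k by (simp add: ln_div)
    moreover have "1 / k \<le> 1 / 2" using k by (simp add: field_simps)
    ultimately show ?thesis by linarith
  qed
  have sk: "1 / sqrt k = k powr (- 1 / 2)"
    using k by (simp add: powr_minus_divide powr_half_sqrt)
  \<comment> \<open>The quotient \<open>1 / k\<close> is split into two equal factors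
    \<open>k powr (- 1 / 2)\<close>: one is at most \<open>k powr (- 1 / 2 + \<gamma>)\<close>, the
    other at most \<open>sqrt (ln k)\<close>.\<close>
  have a: "C / k \<le> C * ?K * sqrt (ln k)"
  proof -
    have "1 / k \<le> 1 / 2" using k by (simp add: field_simps)
    then have "1 / k \<le> ln k" using lnk by linarith
    then have "sqrt (1 / k) \<le> sqrt (ln k)" by (rule real_sqrt_le_mono)
    then have "1 / sqrt k \<le> sqrt (ln k)" by (simp add: real_sqrt_divide)
    then have "1 / sqrt k * (1 / sqrt k) \<le> ?K * sqrt (ln k)"
      unfolding sk using k \<gamma>0 by (intro mult_mono powr_mono) auto
    then have "1 / k \<le> ?K * sqrt (ln k)" using k by simp
    then have "C * (1 / k) \<le> C * (?K * sqrt (ln k))" using C by (rule mult_left_mono)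
    then show ?thesis by (simp add: mult.assoc)
  qed
  have b: "(k powr \<gamma>) powr (1 - p) \<le> s * ?K"
  proof -
    have "(k powr \<gamma>) powr (1 - p) = k powr (\<gamma> * (1 - p))" by (simp add: powr_powr)
    also have "\<dots> \<le> ?K" using k \<gamma>p by (intro powr_mono) (auto simp: algebra_simps)
    also have "\<dots> \<le> s * ?K" using s by (simp add: mult_le_cancel_right1)
    finally show ?thesis .
  qed
  have c: "s * k powr \<gamma> * N / sqrt k = s * N * ?K"
  proof -
    have "s * k powr \<gamma> * N / sqrt k = s * N * (1 / sqrt k * k powr \<gamma>)" by simp
    then show ?thesis unfolding sk by (simp only: powr_add)
  qed
  have K0: "0 \<le> s * N * ?K" using s N by simp
  have "C - C / k - s * N * ?K \<le> (1 - 1 / k) * (C - s * N * ?K)"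
    using K0 k by (simp add: algebra_simps)
  also have "\<dots> \<le> (1 - 1 / k) * v"
    using v k unfolding s_def[symmetric] by (intro mult_left_mono) auto
  finally have d: "C - C / k - s * N * ?K \<le> (1 - 1 / k) * v" .
  have "2 * N * (k powr \<gamma>) powr (1 - p) \<le> 2 * N * (s * ?K)"
    using b N by (intro mult_left_mono) auto
  also have "\<dots> = 2 * (s * N * ?K)" by simp
  finally have e: "2 * N * (k powr \<gamma>) powr (1 - p) \<le> 2 * (s * N * ?K)" .
  have "C - C * ?K * sqrt (ln k) - 4 * (s * N * ?K)
      \<le> (1 - 1 / k) * v - 2 * N * (k powr \<gamma>) powr (1 - p) - s * k powr \<gamma> * N / sqrt k"
    using diff_mono[OF diff_mono[OF d e] eq_refl[OF c]] a by linarith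
  moreover have "4 * (s * N * ?K) \<le> 6 * sqrt (2 * (\<gamma> * p - 1)) * (U1 + 2 * N) * ?K * sqrt (ln k)"
  proof -
    have "4 * (s * N * ?K) = sqrt (2 * (\<gamma> * p - 1)) * sqrt (ln k) * ?K * (4 * N)"
      by (simp add: s_eq)
    also have "\<dots> \<le> sqrt (2 * (\<gamma> * p - 1)) * sqrt (ln k) * ?K * (6 * (U1 + 2 * N))"
      using \<gamma>p lnk N U1 by (intro mult_left_mono mult_nonneg_nonneg) auto
    also have "\<dots> = 6 * sqrt (2 * (\<gamma> * p - 1)) * (U1 + 2 * N) * ?K * sqrt (ln k)"
    proof -
      have "a * b * c * (6 * u) = 6 * a * u * c * b" for a b c u :: real by simp
      then show ?thesis by blast
    qed
    finally show ?thesis .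
  qed
  ultimately show ?thesis
    unfolding s_def[symmetric] distrib_right by linarith
qed

section \<open>Transfer from the given random variables to the product space\<close>

lemma AE_uniform_01_pair:
  assumes "AE z in lborel. z \<in> unit_square \<longrightarrow> P z"
  shows "AE z in uniform_01 \<Otimes>\<^sub>M uniform_01. P z"
  using assms unfolding uniform_01_pair_density by (subst AE_density) (auto simp: indicator_def elim!: eventually_mono)

lemma (in prob_space) AE_iid_pair:
  assumes ae: "AE z in M \<Otimes>\<^sub>M M. Q z" and J: "i \<in> J" "j \<in> J" "i \<noteq> j"
  shows "AE x in iid M J. Q (x i, x j)"
proof -
  have m: "(\<lambda>x. (x i, x j)) \<in> iid M J \<rightarrow>\<^sub>M M \<Otimes>\<^sub>M M"
    using J by (intro measurable_Pair measurable_component_singleton)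
  have "AE z in distr (iid M J) (M \<Otimes>\<^sub>M M) (\<lambda>x. (x i, x j)). Q z"
    unfolding distr_iid_pair[OF J] by (rule ae)
  from AE_distrD[OF m this] show ?thesis .
qed

text \<open>The set \<open>A\<close> is measurable in the completion because it agrees almost
  everywhere with the measurable set \<open>B\<close>.\<close>

lemma AE_completion_measure_eq:
  assumes B: "B \<in> sets M" and A: "A \<subseteq> space M" and ae: "AE x in M. x \<in> A \<longleftrightarrow> x \<in> B"
  shows "measure (completion M) A = measure M B"
proof -
  have ae': "AE x in completion M. x \<in> B \<longleftrightarrow> x \<in> A"
    using AE_completion[OF ae] by eventually_elim auto
  have "A \<in> sets (completion M)"
    by (rule completion.in_sets_AE[OF ae']) (use A B in auto)
  then have "measure (completion M) B = measure (completion M) A"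
    using ae' B by (intro measure_eq_AE) auto
  with B show ?thesis by simp
qed

text \<open>\<open>U\<close> is only Lebesgue measurable, so the left-hand event need not lie in \<open>sets M\<close>; it differs from
  the event for the Borel version \<open>V\<close> by a subset of a null set.\<close>

lemma cut_norm_sample_distribution:
  fixes X :: "nat \<Rightarrow> 'a \<Rightarrow> real" and Q :: "real \<Rightarrow> bool"
  assumes k: "k > 0" and M: "prob_space M" and indep: "prob_space.indep_vars M (\<lambda>_. borel) X {1..k}"
    and X: "\<And>i. i \<in> {1..k} \<Longrightarrow> distr M borel (X i) = uniform_01"
    and V: "V \<in> borel_measurable borel" and UV: "AE z in lborel. z \<in> unit_square \<longrightarrow> U z = V z"
    and Q [measurable]: "Measurable.pred borel Q"
  defines "P \<equiv> Pi\<^sub>M {1..k} (\<lambda>_. uniform_01)"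
  shows "measure (completion M) {\<omega> \<in> space M. Q (cut_norm (sample k U (\<lambda>i. X i \<omega>)))}
    = measure P {x \<in> space P. Q (cut_max {1..k} (sample_matrix V x) / (real k)\<^sup>2)}"
proof -
  interpret M: prob_space M by (rule M)
  interpret u: prob_space uniform_01 by (rule prob_space_uniform_01)
  let ?K = "{1..k}"
  define Y where "Y \<omega> = (\<lambda>i\<in>?K. X i \<omega>)" for \<omega>
  have X_meas: "X i \<in> borel_measurable M" if "i \<in> ?K" for i
    using indep that unfolding M.indep_vars_def by blast
  have sets_P: "sets P = sets (Pi\<^sub>M ?K (\<lambda>_. borel))"
    unfolding P_def by (intro sets_PiM_cong) auto
  have Y_meas: "Y \<in> M \<rightarrow>\<^sub>M Pi\<^sub>M ?K (\<lambda>_. borel)"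
    unfolding Y_def by (intro measurable_restrict X_meas)
  have "distr M (Pi\<^sub>M ?K (\<lambda>_. borel)) Y = Pi\<^sub>M ?K (\<lambda>i. distr M borel (X i))"
    using M.indep_vars_iff_distr_eq_PiM'[of ?K X "\<lambda>_. borel"] X_meas indep k unfolding Y_def by auto
  also have "\<dots> = P"
    unfolding P_def by (intro PiM_cong X refl)
  finally have distr_Y: "distr M P Y = P"
    using distr_cong[OF refl sets_P, of M Y Y] by simp
  have Y_meas_P: "Y \<in> M \<rightarrow>\<^sub>M P"
    using Y_meas measurable_cong_sets[OF refl sets_P, of M] by blast
  define f where "f x = cut_max ?K (sample_matrix V x) / (real k)\<^sup>2" for x
  have f_meas [measurable]: "f \<in> borel_measurable P"
    unfolding f_def P_def using V
    by (intro borel_measurable_divide borel_measurable_const u.cut_max_sample_measurable)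
      (auto simp: measurable_uniform_01_pair)
  have E: "{x \<in> space P. Q (f x)} \<in> sets P"
    by measurable
  \<comment> \<open>Distinct indices are essential: the pair \<open>(x i, x i)\<close> lies on the
    diagonal of the square, a null set on which \<open>U\<close> and \<open>V\<close> may differ.
    The sample has zeros there.\<close>
  have "AE x in P. U (x i, x j) = V (x i, x j)" if "i \<in> ?K" "j \<in> ?K" "i \<noteq> j" for i j
    unfolding P_def by (rule u.AE_iid_pair[OF AE_uniform_01_pair[OF UV] that])
  then have "AE x in P. \<forall>i\<in>?K. \<forall>j\<in>?K. i \<noteq> j \<longrightarrow> U (x i, x j) = V (x i, x j)"
    by (intro AE_finite_allI) auto
  then have "AE x in distr M P Y. \<forall>i\<in>?K. \<forall>j\<in>?K. i \<noteq> j \<longrightarrow> U (x i, x j) = V (x i, x j)"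
    by (simp only: distr_Y)
  then have "AE \<omega> in M. \<forall>i\<in>?K. \<forall>j\<in>?K. i \<noteq> j \<longrightarrow> U (Y \<omega> i, Y \<omega> j) = V (Y \<omega> i, Y \<omega> j)"
    by (rule AE_distrD[OF Y_meas_P])
  then have ae: "AE \<omega> in M. cut_norm (sample k U (\<lambda>i. X i \<omega>)) = f (Y \<omega>)"
  proof eventually_elim
    case (elim \<omega>)
    then have "cut_max ?K (sample_matrix U (\<lambda>i. X i \<omega>)) = cut_max ?K (sample_matrix V (Y \<omega>))"
      by (intro cut_max_cong) (auto simp: sample_matrix_def Y_def)
    then show ?case by (simp add: cut_norm_sample[OF k] f_def)
  qed
  have YE: "Y -` {x \<in> space P. Q (f x)} \<inter> space M = {\<omega> \<in> space M. Q (f (Y \<omega>))}"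
    using measurable_space[OF Y_meas_P] by auto
  have "measure (completion M) {\<omega> \<in> space M. Q (cut_norm (sample k U (\<lambda>i. X i \<omega>)))}
      = measure M {\<omega> \<in> space M. Q (f (Y \<omega>))}"
  proof (rule AE_completion_measure_eq)
    show "{\<omega> \<in> space M. Q (f (Y \<omega>))} \<in> sets M"
      using measurable_sets[OF Y_meas_P E] unfolding YE .
    show "AE \<omega> in M. \<omega> \<in> {\<omega> \<in> space M. Q (cut_norm (sample k U (\<lambda>i. X i \<omega>)))} \<longleftrightarrow> \<omega> \<in> {\<omega> \<in> space M. Q (f (Y \<omega>))}"
      using ae by eventually_elim auto
  qed auto
  also have "\<dots> = measure (distr M P Y) {x \<in> space P. Q (f x)}"
    using measure_distr[OF Y_meas_P E] YE by simp
  finally show ?thesis by (simp only: distr_Y f_def)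
qed

theorem theorem2p1:
  fixes k :: nat and p :: real and U :: "real \<times> real \<Rightarrow> real"
    and M :: "'a measure" and X :: "nat \<Rightarrow> 'a \<Rightarrow> real"
  assumes "k \<ge> 2" and "p > 2" and "U \<in> Lp_sym p"
    and "prob_space M"
    and "prob_space.indep_vars M (\<lambda>_. borel) X {1..k}"
    and "\<And>i. i \<in> {1..k} \<Longrightarrow> distr M borel (X i) = uniform_measure lborel {0..1}"
  shows "(\<forall>\<phi>>0. measure (completion M)
            {\<omega> \<in> space M. cut_norm (sample k U (\<lambda>i. X i \<omega>)) - cut_norm U
               \<le> (30 * Lp_norm p U
                   + 6 * sqrt (2 * \<phi> * p) * (Lp_norm 1 U + 2 * Lp_norm p U)
                     * (sqrt (ln (real k)) / real k powr ((p - 3) / (4 * p) - \<phi>)))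
                  * real k powr (- 1 / 4 + 1 / (4 * p))}
            \<ge> 1 - 4 * real k powr (- \<phi> * p)) \<and>
         (\<forall>\<gamma>\<in>{1 / p<..<1 / 2}. measure (completion M)
            {\<omega> \<in> space M. cut_norm (sample k U (\<lambda>i. X i \<omega>)) - cut_norm U
               \<ge> - (cut_norm U
                   + 6 * sqrt (2 * (\<gamma> * p - 1)) * (Lp_norm 1 U + 2 * Lp_norm p U))
                  * real k powr (- 1 / 2 + \<gamma>) * sqrt (ln (real k))}
            \<ge> 1 - 4 * real k powr (1 - \<gamma> * p))"
proof -
  interpret u: prob_space uniform_01 by (rule prob_space_uniform_01)
  let ?u2 = "uniform_01 \<Otimes>\<^sub>M uniform_01" and ?K = "{1..k}"
  define P where "P = iid uniform_01 ?K"
  interpret P: prob_space P unfolding P_def by (rule u.prob_space_iid)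
  define N where "N = Lp_norm p U"
  define U1 where "U1 = Lp_norm 1 U"
  define C where "C = cut_norm U"
  note k = assms(1) and p = assms(2)
  have N0: "N \<ge> 0" and U1: "U1 \<ge> 0" by (simp_all add: N_def U1_def Lp_norm_def)
  have K: "finite ?K" "?K \<noteq> {}" and card_K: "real (card ?K) = real k" using k by auto
  have U: "U \<in> borel_measurable (lebesgue_on unit_square)" "integrable (lebesgue_on unit_square) (\<lambda>z. \<bar>U z\<bar> powr p)"
    using assms(3) by (auto simp: Lp_sym_def)
  obtain V where V: "V \<in> borel_measurable borel" and UV: "AE z in lborel. z \<in> unit_square \<longrightarrow> U z = V z"
    by (rule lebesgue_on_unit_square_Borel_version[OF U(1)])
  have V': "V \<in> borel_measurable ?u2" using V by (simp only: measurable_uniform_01_pair)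
  have Vp: "integrable ?u2 (\<lambda>z. \<bar>V z\<bar> powr p)" "(\<integral>z. \<bar>V z\<bar> powr p \<partial>?u2) = N powr p"
  proof -
    have m: "(\<lambda>z. \<bar>V z\<bar> powr p) \<in> borel_measurable borel" "(\<lambda>z. \<bar>U z\<bar> powr p) \<in> borel_measurable (lebesgue_on unit_square)"
      using V U(1) by measurable
    have ae: "AE z in lborel. z \<in> unit_square \<longrightarrow> \<bar>U z\<bar> powr p = \<bar>V z\<bar> powr p"
      using UV by eventually_elim auto
    show "integrable ?u2 (\<lambda>z. \<bar>V z\<bar> powr p)"
      using lebesgue_on_unit_square_integral(1)[OF m ae] U(2) by simp
    have "(\<integral>z. \<bar>V z\<bar> powr p \<partial>?u2) = (LINT z|lebesgue_on unit_square. \<bar>U z\<bar> powr p)"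
      using lebesgue_on_unit_square_integral(2)[OF m ae] by simp
    also have "\<dots> = N powr p"
      using p unfolding N_def Lp_norm_def by (simp add: powr_powr)
    finally show "(\<integral>z. \<bar>V z\<bar> powr p \<partial>?u2) = N powr p" .
  qed
  \<comment> \<open>The level \<open>N + 1\<close> is used since \<open>N\<close> may be 0 at this
    point.\<close>
  have V_int: "integrable ?u2 V"
    using u.Lp_kernel_integrable(1)[of p "N + 1" V] p N0 V' Vp powr_mono2[of p N "N + 1"] by simp
  have cut_up: "\<bar>\<integral>z. indicator (S \<times> T) z * V z \<partial>?u2\<bar> \<le> C" if "S \<in> sets uniform_01" "T \<in> sets uniform_01" for S T
    using cut_norm_upper[OF V UV V_int, of S T] that by (simp add: C_def)
  have C0: "C \<ge> 0" using cut_up[of "{}" "{}"] by simp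
  define f where "f x = cut_max ?K (sample_matrix V x) / (real k)\<^sup>2" for x
  have f0: "f x \<ge> 0" for x unfolding f_def by (intro divide_nonneg_nonneg cut_max_nonneg) auto
  have f_meas [measurable]: "f \<in> borel_measurable P"
    unfolding f_def P_def using V' by (intro borel_measurable_divide borel_measurable_const u.cut_max_sample_measurable) auto
  \<comment> \<open>The given probability space is left here: it remains to bound the failure
    probability on the Borel product space \<open>P\<close>.\<close>
  have transfer: "measure (completion M) {\<omega> \<in> space M. Q (cut_norm (sample k U (\<lambda>i. X i \<omega>)))} \<ge> 1 - b"
    if Q [measurable]: "Measurable.pred borel Q" and b: "measure P {x \<in> space P. \<not> Q (f x)} \<le> b" for Q b
  proof -
    have "measure (completion M) {\<omega> \<in> space M. Q (cut_norm (sample k U (\<lambda>i. X i \<omega>)))} = measure P {x \<in> space P. Q (f x)}"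
      unfolding f_def P_def using k by (intro cut_norm_sample_distribution assms V UV Q) auto
    also have "\<dots> = 1 - measure P {x \<in> space P. \<not> Q (f x)}"
      by (subst P.prob_neg) auto
    finally show ?thesis using b by simp
  qed
  \<comment> \<open>The tail bounds measure everything in units of a positive \<open>N\<close>. For
    \<open>N = 0\<close> the kernel vanishes almost everywhere, and the claims are checked
    directly.\<close>
  have N_eq_0: "measure P {x \<in> space P. f x > 0} = 0" "C = 0" if "N = 0"
  proof -
    have "AE z in ?u2. \<bar>V z\<bar> powr p = 0"
      using Vp that p by (subst integral_nonneg_eq_0_iff_AE[symmetric]) auto
    then have V0: "AE z in ?u2. V z = 0"
      by eventually_elim auto
    show "C = 0"
    proof (rule ccontr)
      assume "C \<noteq> 0"
      then have "0 < cut_norm U" using C0 by (simp add: C_def)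
      then obtain S T where ST: "S \<in> sets borel" "T \<in> sets borel" "0 < \<bar>\<integral>z. indicator (S \<times> T) z * V z \<partial>?u2\<bar>"
        by (rule cut_norm_approx[OF V UV])
      have "(\<integral>z. indicator (S \<times> T) z * V z \<partial>?u2) = 0"
        by (rule integral_eq_zero_AE) (use V0 in \<open>eventually_elim, simp\<close>)
      with ST(3) show False by simp
    qed
    have "AE x in P. V (x i, x j) = 0" if "i \<in> ?K" "j \<in> ?K" "i \<noteq> j" for i j
      unfolding P_def by (rule u.AE_iid_pair[OF V0 that])
    then have "AE x in P. \<forall>i\<in>?K. \<forall>j\<in>?K. i \<noteq> j \<longrightarrow> V (x i, x j) = 0"
      by (intro AE_finite_allI) auto
    then have "AE x in P. \<not> f x > 0"
    proof eventually_elim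
      case (elim x)
      then have "cut_max ?K (sample_matrix V x) = cut_max ?K (\<lambda>_ _. 0)"
        by (intro cut_max_cong) (auto simp: sample_matrix_def)
      then show ?case by (simp add: f_def cut_max_zero)
    qed
    then show "measure P {x \<in> space P. f x > 0} = 0"
      by (subst P.prob_Collect_eq_0) auto
  qed
  show ?thesis
  proof (intro conjI allI impI ballI)
    fix \<phi> :: real assume \<phi>: "\<phi> > 0"
    define B where "B = (30 * N + 6 * sqrt (2 * \<phi> * p) * (U1 + 2 * N) * (sqrt (ln (real k)) / real k powr ((p - 3) / (4 * p) - \<phi>)))
      * real k powr (- 1 / 4 + 1 / (4 * p))"
    have B: "8 * N / sqrt k + sqrt (2 * (\<phi> * p * ln k)) * real k powr (1 / p + \<phi>) * N / sqrt k \<le> B"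
      unfolding B_def using k p \<phi> N0 U1 by (intro upper_deviation_numeric) auto
    have "measure P {x \<in> space P. \<not> f x - C \<le> B} \<le> 4 * real k powr (- \<phi> * p)"
    proof (cases "N = 0")
      case True
      have "B \<ge> 0" using B True by simp
      then have "measure P {x \<in> space P. \<not> f x - C \<le> B} \<le> measure P {x \<in> space P. f x > 0}"
        using C0 by (intro P.finite_measure_mono) auto
      then show ?thesis using N_eq_0(1)[OF True] by (simp add: order.trans)
    next
      case False
      let ?b = "(real k)\<^sup>2 * (C + 8 * N / sqrt k + sqrt (2 * (\<phi> * p * ln k)) * real k powr (1 / p + \<phi>) * N / sqrt k)"
      have "{x \<in> space P. \<not> f x - C \<le> B} \<subseteq> {x \<in> space P. cut_max ?K (sample_matrix V x) > ?b}"
      proof safe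
        fix x assume "\<not> f x - C \<le> B"
        then have "C + 8 * N / sqrt k + sqrt (2 * (\<phi> * p * ln k)) * real k powr (1 / p + \<phi>) * N / sqrt k < f x"
          using B by linarith
        then show "?b < cut_max ?K (sample_matrix V x)"
          using k by (simp add: f_def field_simps)
      qed
      then have "measure P {x \<in> space P. \<not> f x - C \<le> B} \<le> measure P {x \<in> space P. cut_max ?K (sample_matrix V x) > ?b}"
      proof (rule P.finite_measure_mono)
        have "(\<lambda>x. cut_max ?K (sample_matrix V x)) \<in> borel_measurable P"
          unfolding P_def by (rule u.cut_max_sample_measurable[OF V' K(1) order.refl])
        then show "{x \<in> space P. cut_max ?K (sample_matrix V x) > ?b} \<in> sets P" by measurable
      qed
      \<comment> \<open>The choice \<open>\<tau> = k powr (1 / p + \<phi>)\<close> gives the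
        \<open>k\<close> row events the total probability \<open>k powr (- \<phi> * p)\<close>, and
        \<open>L = \<phi> * p * ln k\<close> gives McDiarmid's inequality the same one. Their sum,
        twice this value, is below the claimed four times.\<close>
      also have "\<dots> \<le> real k * (real k powr (1 / p + \<phi>)) powr - p + exp (- (\<phi> * p * ln k))"
        using u.cut_max_sample_upper[OF K _ _ V' Vp(1) _ cut_up, of N "real k powr (1 / p + \<phi>)" "\<phi> * p * ln k"]
          False N0 p \<phi> k Vp(2) unfolding card_K P_def by simp
      also have "real k * (real k powr (1 / p + \<phi>)) powr - p = real k powr (- \<phi> * p)"
      proof -
        have "1 + (1 / p + \<phi>) * - p = - \<phi> * p" using p by (simp add: field_simps)
        then show ?thesis
          using k powr_add[of "real k" 1 "(1 / p + \<phi>) * - p"] by (simp add: powr_powr)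
      qed
      also have "exp (- (\<phi> * p * ln k)) = real k powr (- \<phi> * p)"
        using k by (simp add: powr_def)
      finally show ?thesis using powr_ge_zero[of "real k" "- \<phi> * p"] by linarith
    qed
    then have "measure (completion M) {\<omega> \<in> space M. cut_norm (sample k U (\<lambda>i. X i \<omega>)) - C \<le> B} \<ge> 1 - 4 * real k powr (- \<phi> * p)"
      by (intro transfer[of "\<lambda>r. r - C \<le> B"]) measurable
    then show "measure (completion M)
            {\<omega> \<in> space M. cut_norm (sample k U (\<lambda>i. X i \<omega>)) - cut_norm U
               \<le> (30 * Lp_norm p U
                   + 6 * sqrt (2 * \<phi> * p) * (Lp_norm 1 U + 2 * Lp_norm p U)
                     * (sqrt (ln (real k)) / real k powr ((p - 3) / (4 * p) - \<phi>)))
                  * real k powr (- 1 / 4 + 1 / (4 * p))}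
            \<ge> 1 - 4 * real k powr (- \<phi> * p)"
      unfolding B_def N_def U1_def C_def .
  next
    fix \<gamma> :: real assume "\<gamma> \<in> {1 / p<..<1 / 2}"
    then have \<gamma>: "1 / p < \<gamma>" by simp
    \<comment> \<open>With this exponent McDiarmid's inequality alone yields the probability
      \<open>k powr (1 - \<gamma> * p)\<close>; the scale of the row sums will be
      \<open>\<tau> = k powr \<gamma>\<close>.\<close>
    define L where "L = (\<gamma> * p - 1) * ln k"
    define B where "B = - (C + 6 * sqrt (2 * (\<gamma> * p - 1)) * (U1 + 2 * N)) * real k powr (- 1 / 2 + \<gamma>) * sqrt (ln (real k))"
    have \<gamma>p: "\<gamma> * p > 1" using \<gamma> p by (simp add: field_simps)
    have L: "L > 0" using \<gamma>p k by (simp add: L_def)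
    have exp_L: "exp (- L) = real k powr (1 - \<gamma> * p)"
      using k by (simp add: powr_def L_def algebra_simps)
    have "measure P {x \<in> space P. \<not> f x - C \<ge> B} \<le> 4 * real k powr (1 - \<gamma> * p)"
    proof (cases "L < 1")
      case True
      \<comment> \<open>the claimed probability is then not positive\<close>
      have "1 / 4 \<le> exp (- 1 :: real)"
        using exp_le by (simp add: exp_minus field_simps)
      also have "\<dots> \<le> exp (- L)" using True by simp
      finally have "1 \<le> 4 * real k powr (1 - \<gamma> * p)" unfolding exp_L by simp
      then show ?thesis using P.prob_le_1 by (rule order.trans[rotated])
    next
      case False
      show ?thesis
      proof (cases "N = 0")
        case True
        have "B \<le> 0"
        proof -
          have "0 \<le> C + 6 * sqrt (2 * (\<gamma> * p - 1)) * (U1 + 2 * N)"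
            using C0 U1 N0 \<gamma>p by (intro add_nonneg_nonneg mult_nonneg_nonneg) auto
          then show ?thesis
            using k unfolding B_def by (intro mult_nonpos_nonneg) (simp_all only: neg_le_0_iff_le, auto)
        qed
        then have "f x - C \<ge> B" for x
          using f0[of x] N_eq_0(2)[OF True] by simp
        then show ?thesis by simp
      next
        case False
        then have N: "N > 0" using N0 by simp
        \<comment> \<open>The supremum in the cut norm need not be attained. The tolerance has
          exactly the size of the deviation term, one unit in
          \<open>lower_deviation_numeric\<close>.\<close>
        define \<eta> where "\<eta> = sqrt (2 * L) * N * real k powr (- 1 / 2 + \<gamma>)"
        have "\<eta> > 0" using N L k by (simp add: \<eta>_def)
        then have "C - \<eta> < cut_norm U" by (simp add: C_def)
        then obtain S T where ST: "S \<in> sets borel" "T \<in> sets borel" "C - \<eta> < \<bar>\<integral>z. indicator (S \<times> T) z * V z \<partial>?u2\<bar>"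
          by (rule cut_norm_approx[OF V UV])
        define v where "v = \<bar>\<integral>z. indicator (S \<times> T) z * V z \<partial>?u2\<bar>"
        let ?b = "(1 - 1 / real k) * v - 2 * N * (real k powr \<gamma>) powr (1 - p) - sqrt (2 * L) * real k powr \<gamma> * N / sqrt k"
        have "C - (C + 6 * sqrt (2 * (\<gamma> * p - 1)) * (U1 + 2 * N)) * real k powr (- 1 / 2 + \<gamma>) * sqrt (ln (real k)) \<le> ?b"
          unfolding L_def
        proof (rule lower_deviation_numeric)
          show "C - sqrt (2 * ((\<gamma> * p - 1) * ln (real k))) * N * real k powr (- 1 / 2 + \<gamma>) \<le> v"
            using ST(3) unfolding v_def \<eta>_def L_def by (rule less_imp_le)
        qed (use k p \<gamma> N0 U1 C0 \<open>\<not> L < 1\<close> in \<open>auto simp: L_def not_less\<close>)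
        then have "C + B \<le> ?b"
          by (simp only: B_def mult_minus_left add_uminus_conv_diff)
        then have "{x \<in> space P. \<not> f x - C \<ge> B} \<subseteq> {x \<in> space P. cut_max ?K (sample_matrix V x) < (real k)\<^sup>2 * ?b}"
        proof safe
          fix x assume "C + B \<le> ?b" "\<not> f x - C \<ge> B"
          then have "f x < ?b" by linarith
          then show "cut_max ?K (sample_matrix V x) < (real k)\<^sup>2 * ?b"
            using k by (simp add: f_def divide_less_eq mult.commute)
        qed
        then have "measure P {x \<in> space P. \<not> f x - C \<ge> B} \<le> measure P {x \<in> space P. cut_max ?K (sample_matrix V x) < (real k)\<^sup>2 * ?b}"
        proof (rule P.finite_measure_mono)
          have "(\<lambda>x. cut_max ?K (sample_matrix V x)) \<in> borel_measurable P"
            unfolding P_def by (rule u.cut_max_sample_measurable[OF V' K(1) order.refl])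
          then show "{x \<in> space P. cut_max ?K (sample_matrix V x) < (real k)\<^sup>2 * ?b} \<in> sets P" by measurable
        qed
        also have "\<dots> \<le> exp (- L)"
          using u.cut_max_sample_lower[where S = S and T = T and \<tau> = "real k powr \<gamma>", OF K _ N V' Vp(1) _ _ _ _ L] p k Vp(2) ST
          unfolding card_K P_def v_def by simp
        finally show ?thesis unfolding exp_L using powr_ge_zero[of "real k" "1 - \<gamma> * p"] by linarith
      qed
    qed
    then have "measure (completion M) {\<omega> \<in> space M. cut_norm (sample k U (\<lambda>i. X i \<omega>)) - C \<ge> B} \<ge> 1 - 4 * real k powr (1 - \<gamma> * p)"
      by (intro transfer[of "\<lambda>r. r - C \<ge> B"]) measurable
    then show "measure (completion M)
            {\<omega> \<in> space M. cut_norm (sample k U (\<lambda>i. X i \<omega>)) - cut_norm U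
               \<ge> - (cut_norm U
                   + 6 * sqrt (2 * (\<gamma> * p - 1)) * (Lp_norm 1 U + 2 * Lp_norm p U))
                  * real k powr (- 1 / 2 + \<gamma>) * sqrt (ln (real k))}
            \<ge> 1 - 4 * real k powr (1 - \<gamma> * p)"
      unfolding B_def N_def U1_def C_def .
  qed
qed

end
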